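(* Let $k>1/2$ be real, and let $H_k$ and $Y_k$ be as defined in the context. Then, for $\zeta$ in the upper half-plane, $$H_k(\zeta)=\zeta-\left(k-\tfrac12\right)\log(-\zeta)+\log\left\{\frac1\pi\int_0^\infty\frac{t^{k-\frac12}e^{-t}\,dt}{t-\zeta}\right\};$$ in particular, $$Y_k=\log\Gamma\left(k+\tfrac12\right)-\log\pi.$$
   Context: For real $k>1/2$ let $$\Pi_k=\mathbb{C}_+\setminus\{w:\ \operatorname{Re}w=-\log t,\ |\operatorname{Im}w-k\pi|\le\arccos t,\ t\in(0,1]\},$$ where $\mathbb{C}_+$ is the open upper half-plane. The boundary of $\Pi_k$ has two infinite points: $\infty_1$, reached as $\operatorname{Re}w\to+\infty$ in the channel between the real axis and the deleted set, and the other one, $\infty_2$. $H_k:\mathbb{C}_+\to\Pi_k$ is the conformal map (extended to the boundary) normalized by $H_k(0)=\infty_1$, $H_k(\infty)=\infty_2$ and $H_k(\zeta)=\zeta+\dots$ as $\zeta\to\infty$ (the leading coefficient is $1$). $D_k>0$ is the number with $H_k(-D_k)=0$, and $\rho_k(t)=\frac1\pi\operatorname{Im}H_k(t)$ for $t>0$ (one has $\rho_k(t)\to k+\frac12$ as $t\to+\infty$). The constant $Y_k$ is $$Y_k=D_k+\left(k+\tfrac12\right)\log D_k-\int_0^\infty\frac{\rho_k(t)-\left(k+\frac12\right)}{t+D_k}\,dt.$$ The branches of the logarithms are the analytic ones that are real for $\zeta<0$. *)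

theory Defs
  imports "HOL-Complex_Analysis.Complex_Analysis"
begin

definition upper_half_plane :: "complex set" where
  "upper_half_plane = {z. Im z > 0}"

definition Pi_dom :: "real \<Rightarrow> complex set" where
  "Pi_dom k = upper_half_plane -
     {w. \<exists>t\<in>{0<..1}. Re w = - ln t \<and> \<bar>Im w - k * pi\<bar> \<le> arccos t}"

text \<open>
  The deleted set is symmetric about the line \<open>Im w = k * pi\<close> and contains the half of
  that line with \<open>Re w \<ge> 0\<close>, so the part of the domain in the quadrant
  \<open>Re w > 0\<close>, \<open>Im w < k * pi\<close> lies between the real axis and the deleted set.
\<close>

definition channel :: "real \<Rightarrow> complex set" where
  "channel k = {w \<in> Pi_dom k. Re w > 0 \<and> Im w < k * pi}"

text \<open>
  The two infinite boundary points are represented by the filters of their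
  neighbourhoods in the domain.
\<close>

definition infty1 :: "real \<Rightarrow> complex filter" where
  "infty1 k = inf (filtercomap Re at_top) (principal (channel k))"

definition infty2 :: "real \<Rightarrow> complex filter" where
  "infty2 k = inf at_infinity (principal (Pi_dom k - channel k))"

text \<open>
  The normalized conformal map, extended continuously to the real axis without \<open>0\<close>;
  the values at the boundary points \<open>0\<close> and infinity are the limits \<open>infty1 k\<close>
  and \<open>infty2 k\<close>.
\<close>

definition is_normalized_map :: "real \<Rightarrow> (complex \<Rightarrow> complex) \<Rightarrow> bool" where
  "is_normalized_map k H \<longleftrightarrow>
     H holomorphic_on upper_half_plane \<and>
     bij_betw H upper_half_plane (Pi_dom k) \<and>
     continuous_on ({z. Im z \<ge> 0} - {0}) H \<and>
     filterlim H (infty1 k) (at 0 within upper_half_plane) \<and>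
     filterlim H (infty2 k) (inf at_infinity (principal upper_half_plane)) \<and>
     ((\<lambda>z. H z / z) \<longlongrightarrow> 1) (inf at_infinity (principal upper_half_plane))"

text \<open>
  A choice operator is used because the conditions determine the map only on the
  closed upper half-plane without \<open>0\<close>; its values elsewhere are irrelevant.
\<close>

definition H_map :: "real \<Rightarrow> complex \<Rightarrow> complex" where
  "H_map k = (SOME H. is_normalized_map k H)"

definition D_const :: "real \<Rightarrow> real" where
  "D_const k = (THE D. D > 0 \<and> H_map k (- complex_of_real D) = 0)"

definition rho :: "real \<Rightarrow> real \<Rightarrow> real" where
  "rho k t = Im (H_map k (complex_of_real t)) / pi"

definition Y_const :: "real \<Rightarrow> real" where
  "Y_const k = D_const k + (k + 1/2) * ln (D_const k)
     - integral {0<..} (\<lambda>t. (rho k t - (k + 1/2)) / (t + D_const k))"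

text \<open>
  The integral below is positive for \<open>z < 0\<close> and has positive imaginary part for \<open>Im z > 0\<close>,
  while \<open>- z\<close> is positive for \<open>z < 0\<close> and has negative imaginary part for \<open>Im z > 0\<close>.
  So on the upper half-plane the principal branch \<open>Ln\<close> of the logarithm of either
  function is the analytic branch that is real for \<open>z < 0\<close>.
\<close>

definition stieltjes_int :: "real \<Rightarrow> complex \<Rightarrow> complex" where
  "stieltjes_int k z =
     integral {0<..} (\<lambda>t. complex_of_real (t powr (k - 1/2) * exp (- t)) / (complex_of_real t - z))"

end

theory Submission
  imports Defs "HOL-Probability.Sinc_Integral" "HOL-Real_Asymp.Real_Asymp"
begin

text \<open>Put \<open>a = k - 1/2\<close> and let \<open>S z\<close> be the integral of \<open>t^a e^(-t) / (t - z)\<close> over \<open>t > 0\<close>.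
The proof takes \<open>F z = z - a Ln (-z) + Ln (S z / pi)\<close>, shows that \<open>F\<close> is a normalized conformal
map of the upper half-plane onto \<open>Pi_dom k\<close>, and shows that there is only one such map.

The key is the linear equation \<open>z S' + (z - a) S = -Gamma (a + 1)\<close> (\<open>stieltjes_int_ode\<close>), which
holds because the corresponding integrand is the derivative of \<open>-t w(t) / (t - z)\<close>, where
\<open>w(t) = t^a e^(-t)\<close>. It says that \<open>exp F\<close> is a multiple of an incomplete gamma function of \<open>-z\<close>,
and it has two consequences.

\<^item> \<open>F' = -Gamma (a + 1) / (z S)\<close>. As \<open>z S + Gamma (a + 1)\<close> is the integral of the same kind with
  \<open>a + 1\<close> for \<open>a\<close>, \<open>z S\<close> has positive imaginary part. So \<open>Im F' > 0\<close> on a convex domain, and \<open>F\<close>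
  is injective.

\<^item> The function \<open>z^(-a) e^z S / pi\<close> has the derivative \<open>-Gamma (a + 1) / pi * e^z z^(-a-1)\<close>, which
  is holomorphic across the positive axis. So \<open>S\<close> continues analytically across that axis. The Poisson
  kernel gives \<open>Im S = pi w\<close> there (\<open>Im_stieltjes_ext_pos_axis\<close>), and this is exactly the statement
  that \<open>F\<close> maps the positive axis into the curve \<open>exp (Re w) * cos (Im w - k pi) = 1\<close> that bounds
  the deleted set (\<open>explicit_map_pos\<close>). The negative axis is mapped into the real axis.

The same formula for the derivative, integrated over short vertical segments, yields
\<open>z S \<rightarrow> -Gamma (a + 1)\<close> at infinity and \<open>S \<rightarrow> Gamma a\<close> at 0 without any restriction on the
direction, and hence the limits of \<open>F\<close> at 0 and at infinity.

That \<open>Pi_dom k\<close> is the image of \<open>F\<close> is a connectedness argument (\<open>connected_subset_image\<close>): \<open>F\<close> is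
proper, so a connected set that contains no boundary value of \<open>F\<close> and meets the image lies in the
image. This applies to \<open>Pi_dom k\<close>. If the image contained a point of the deleted set, it would apply
to a ray that runs to the right inside the deleted set, but the limits of \<open>F\<close> at 0 and at infinity
keep the far end of such a ray out of the image.

Two normalized maps differ by an automorphism of the half-plane that tends to 0 at 0 and is
asymptotic to \<open>z\<close> at infinity. By the Schwarz lemma it is the identity.

For the constant let \<open>Q = F - z + (k + 1/2) Ln (-z)\<close>. It equals \<open>Ln (-z S / pi)\<close> and so tends to
\<open>ln (Gamma (k + 1/2) / pi)\<close> at infinity, it is real on the negative axis, and
\<open>Im Q = pi (rho k - (k + 1/2))\<close> on the positive axis. Cauchy's theorem on half-discs expresses
\<open>Q (-D) - Q (\<infinity>)\<close> as the integral of \<open>(rho k t - (k + 1/2)) / (t + D)\<close>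
(\<open>half_plane_schwarz_integral\<close>). For the \<open>D\<close> with \<open>F (-D) = 0\<close> one has \<open>Q (-D) = D + (k + 1/2) ln D\<close>,
so \<open>Y_const k\<close> is the limit of \<open>Q\<close> at infinity.\<close>

section \<open>The Stieltjes transform of a gamma density and its differential equation\<close>

definition gamma_weight :: "real \<Rightarrow> real \<Rightarrow> real" where
  "gamma_weight k t = t powr (k - 1/2) * exp (- t)"

lemma gamma_weight_nonneg: "gamma_weight k t \<ge> 0"
  by (simp add: gamma_weight_def)

lemma gamma_weight_pos: "t > 0 \<Longrightarrow> gamma_weight k t > 0"
  by (simp add: gamma_weight_def)

lemma gamma_weight_Suc: "t > 0 \<Longrightarrow> gamma_weight (k + 1) t = t * gamma_weight k t"
proof -
  assume "t > 0"
  then have "t powr (k - 1/2 + 1) = t powr (k - 1/2) * t"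
    by (subst powr_add) simp
  then show ?thesis by (simp add: gamma_weight_def algebra_simps)
qed

lemma stieltjes_int_gamma_weight:
  "stieltjes_int k z = integral {0<..} (\<lambda>t. of_real (gamma_weight k t) / (of_real t - z))"
  by (simp add: stieltjes_int_def gamma_weight_def)

lemma gamma_weight_has_integral:
  assumes "k > -1/2"
  shows "(gamma_weight k has_integral Gamma (k + 1/2)) {0<..}"
proof -
  have "((\<lambda>t. t powr (k + 1/2 - 1) / exp t) has_integral Gamma (k + 1/2)) {0..}"
    using assms by (intro Gamma_integral_real) auto
  moreover have "(\<lambda>t. t powr (k + 1/2 - 1) / exp t) = gamma_weight k"
    by (auto simp: gamma_weight_def exp_minus field_simps fun_eq_iff)
  ultimately have "(gamma_weight k has_integral Gamma (k + 1/2)) {0..}" by simp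
  then show ?thesis
    by (subst has_integral_spike_set_eq[of _ "{0..}"]) (auto intro: negligible_subset[of "{0}"])
qed

lemma gamma_weight_continuous_on: "continuous_on {0<..} (gamma_weight k)"
  unfolding gamma_weight_def by (intro continuous_intros) auto

lemma gamma_weight_mult_absolutely_integrable:
  fixes g :: "real \<Rightarrow> complex"
  assumes "k > -1/2" "continuous_on {0<..} g" "\<And>t. t > 0 \<Longrightarrow> norm (g t) \<le> B"
  shows "(\<lambda>t. of_real (gamma_weight k t) * g t) absolutely_integrable_on {0<..}"
proof (rule measurable_bounded_by_integrable_imp_absolutely_integrable)
  show "(\<lambda>t. of_real (gamma_weight k t) * g t) \<in> borel_measurable (lebesgue_on {0<..})"
    by (intro continuous_imp_measurable_on_sets_lebesgue continuous_intros
        gamma_weight_continuous_on assms(2))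
       auto
  show "(\<lambda>t. B * gamma_weight k t) integrable_on {0<..}"
    using gamma_weight_has_integral[OF assms(1)] by (intro integrable_on_mult_right) (auto simp:
        integrable_on_def)
  show "norm (of_real (gamma_weight k t) * g t) \<le> B * gamma_weight k t" if "t \<in> {0<..}" for t
    using mult_right_mono[OF assms(3)[of t] gamma_weight_nonneg[of k t]] that gamma_weight_nonneg[of k t]
    by (simp add: norm_mult mult.commute)
qed auto

lemma gamma_weight_mult_integral_bound:
  fixes g :: "real \<Rightarrow> complex"
  assumes "k > -1/2" "continuous_on {0<..} g" "\<And>t. t > 0 \<Longrightarrow> norm (g t) \<le> B"
  shows "norm (integral {0<..} (\<lambda>t. of_real (gamma_weight k t) * g t)) \<le> B * Gamma (k + 1/2)"
proof -
  have "norm (integral {0<..} (\<lambda>t. of_real (gamma_weight k t) * g t)) \<le> integral {0<..} (\<lambda>t. B *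
      gamma_weight k t)"
  proof (rule integral_norm_bound_integral)
    show "(\<lambda>t. of_real (gamma_weight k t) * g t) integrable_on {0<..}"
      using gamma_weight_mult_absolutely_integrable[OF assms] by (rule set_lebesgue_integral_eq_integral)
    show "(\<lambda>t. B * gamma_weight k t) integrable_on {0<..}"
      using gamma_weight_has_integral[OF assms(1)] by (intro integrable_on_mult_right) (auto simp:
          integrable_on_def)
    show "norm (of_real (gamma_weight k t) * g t) \<le> B * gamma_weight k t" if "t \<in> {0<..}" for t
      using mult_right_mono[OF assms(3)[of t] gamma_weight_nonneg[of k t]] that gamma_weight_nonneg[of k t]
      by (simp add: norm_mult mult.commute)
  qed
  also have "\<dots> = B * Gamma (k + 1/2)"
    using gamma_weight_has_integral[OF assms(1)] by (simp add: integral_unique)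
  finally show ?thesis .
qed

abbreviation slit :: "complex set" where
  "slit \<equiv> - \<real>\<^sub>\<ge>\<^sub>0"

lemma open_slit: "open slit"
  by (auto intro: closed_nonneg_Reals_complex)

text \<open>Near a point off the nonnegative axis the kernel \<open>1 / (t - w)\<close> is bounded uniformly in \<open>t\<close> and \<open>w\<close>;
this is what allows differentiation under the integral sign.\<close>

lemma slit_distE:
  assumes "z \<in> slit"
  obtains d where "d > 0" "ball z d \<subseteq> slit" "\<And>t w. t > 0 \<Longrightarrow> dist z w \<le> d/2 \<Longrightarrow> norm (of_real t - w) \<ge> d/2"
proof -
  obtain d where d: "d > 0" "ball z d \<subseteq> slit"
    using open_slit assms open_contains_ball by blast
  have "norm (of_real t - w) \<ge> d/2" if "t > 0" "dist z w \<le> d/2" for t :: real and w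
  proof -
    have "of_real t \<notin> ball z d" using d(2) that by (auto simp: subset_iff)
    then have "d \<le> dist z (of_real t)" by (simp add: dist_commute)
    also have "\<dots> \<le> dist z w + dist w (of_real t)" by (rule dist_triangle)
    finally show ?thesis using that(2) by (simp add: dist_norm norm_minus_commute)
  qed
  then show ?thesis using d that by blast
qed

lemma slit_neq: "z \<in> slit \<Longrightarrow> t > 0 \<Longrightarrow> complex_of_real t - z \<noteq> 0"
  by (auto simp: complex_nonneg_Reals_iff)

lemma upper_half_plane_slit: "upper_half_plane \<subseteq> slit"
  by (auto simp: upper_half_plane_def complex_nonneg_Reals_iff)

lemma cauchy_kernel_continuous:
  "z \<in> slit \<Longrightarrow> continuous_on {0<..} (\<lambda>t. 1 / (of_real t - z))"
  "z \<in> slit \<Longrightarrow> continuous_on {0<..} (\<lambda>t. 1 / (of_real t - z)\<^sup>2)"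
  using slit_neq by (auto intro!: continuous_intros)

lemma cauchy_kernel_bounded:
  assumes "z \<in> slit"
  obtains B where "B > 0" "\<And>t. t > 0 \<Longrightarrow> norm (1 / (complex_of_real t - z)) \<le> B"
proof -
  obtain d where d: "d > 0" "\<And>t w. t > 0 \<Longrightarrow> dist z w \<le> d/2 \<Longrightarrow> norm (of_real t - w) \<ge> d/2"
    using slit_distE[OF assms] by metis
  show ?thesis
  proof (rule that)
    show "2/d > 0" using d by simp
    show "norm (1 / (complex_of_real t - z)) \<le> 2/d" if "t > 0" for t
      using d(2)[OF that, of z] d(1) slit_neq[OF assms that] by (simp add: norm_divide field_simps)
  qed
qed

lemma cauchy_kernel_integrable:
  assumes "k > -1/2" "z \<in> slit"
  shows "(\<lambda>t. of_real (gamma_weight k t) / (of_real t - z)) absolutely_integrable_on {0<..}"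
    and "(\<lambda>t. of_real (gamma_weight k t) / (of_real t - z)^2) absolutely_integrable_on {0<..}"
proof -
  obtain B where B: "B > 0" "\<And>t. t > 0 \<Longrightarrow> norm (1 / (complex_of_real t - z)) \<le> B"
    using cauchy_kernel_bounded[OF assms(2)] by metis
  show "(\<lambda>t. of_real (gamma_weight k t) / (of_real t - z)) absolutely_integrable_on {0<..}"
    using gamma_weight_mult_absolutely_integrable[OF assms(1) cauchy_kernel_continuous(1)[OF assms(2)] B(2)]
    by simp
  have B2: "norm (1 / (complex_of_real t - z)\<^sup>2) \<le> B^2" if "t > 0" for t
    using power_mono[OF B(2)[OF that], of 2] by (simp add: norm_divide norm_power power_divide)
  show "(\<lambda>t. of_real (gamma_weight k t) / (of_real t - z)^2) absolutely_integrable_on {0<..}"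
    using gamma_weight_mult_absolutely_integrable[OF assms(1) cauchy_kernel_continuous(2)[OF assms(2)] B2]
    by simp
qed

lemma stieltjes_has_integral:
  assumes "k > -1/2" "z \<in> slit"
  shows "((\<lambda>t. of_real (gamma_weight k t) / (of_real t - z)) has_integral stieltjes_int k z) {0<..}"
  unfolding stieltjes_int_gamma_weight
  using cauchy_kernel_integrable(1)[OF assms] by (intro integrable_integral
      set_lebesgue_integral_eq_integral)

text \<open>The difference quotient minus the expected derivative is itself \<open>w - z\<close> times the integral of the
weight against \<open>1 / ((t - z)^2 (t - w))\<close>, which is bounded near \<open>z\<close>.\<close>

lemma stieltjes_int_has_derivative:
  assumes k: "k > -1/2" and z: "z \<in> slit"
  shows "(stieltjes_int k has_field_derivative
           integral {0<..} (\<lambda>t. of_real (gamma_weight k t) / (of_real t - z)\<^sup>2)) (at z)"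
proof -
  obtain d where d: "d > 0" "ball z d \<subseteq> slit" 
    "\<And>t w. t > 0 \<Longrightarrow> dist z w \<le> d/2 \<Longrightarrow> norm (of_real t - w) \<ge> d/2"
    using slit_distE[OF z] by metis
  define D where "D = integral {0<..} (\<lambda>t. of_real (gamma_weight k t) / (of_real t - z)\<^sup>2)"
  have D: "((\<lambda>t. of_real (gamma_weight k t) / (of_real t - z)\<^sup>2) has_integral D) {0<..}"
    unfolding D_def
    using cauchy_kernel_integrable(2)[OF k z] by (intro integrable_integral
        set_lebesgue_integral_eq_integral)
  have bd: "norm ((stieltjes_int k w - stieltjes_int k z) / (w - z) - D) 
             \<le> norm (w - z) * (8 / d^3 * Gamma (k + 1/2))"
    if w: "w \<noteq> z" "dist z w < d/2" for w
  proof -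
    have ws: "w \<in> slit" using w d(1,2) by (auto simp: subset_iff)
    have "((\<lambda>t. (of_real (gamma_weight k t) / (of_real t - w) - of_real (gamma_weight k t) /
        (of_real t - z)) / (w - z)
             - of_real (gamma_weight k t) / (of_real t - z)\<^sup>2) 
           has_integral (stieltjes_int k w - stieltjes_int k z) / (w - z) - D) {0<..}"
      by (intro has_integral_diff has_integral_divide stieltjes_has_integral k z ws D)
    then have eq: "((\<lambda>t. of_real (gamma_weight k t) * ((w - z) * (1 / (of_real t - z) / (of_real t -
        w) / (of_real t - z))))
           has_integral (stieltjes_int k w - stieltjes_int k z) / (w - z) - D) {0<..}"
    proof (rule has_integral_eq[rotated], goal_cases)
      case (1 t)
      then have "complex_of_real t - z \<noteq> 0" "complex_of_real t - w \<noteq> 0" "w - z \<noteq> 0"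
        using slit_neq z ws w by auto
      then show ?case by (simp add: divide_simps power2_eq_square) (simp add: algebra_simps)
    qed
    have "norm (integral {0<..} (\<lambda>t. of_real (gamma_weight k t) * ((w - z) * (1 / (of_real t - z) /
        (of_real t - w) / (of_real t - z)))))
       \<le> norm (w - z) * (8 / d^3) * Gamma (k + 1/2)"
    proof (rule gamma_weight_mult_integral_bound[OF k])
      show "continuous_on {0<..} (\<lambda>t. (w - z) * (1 / (of_real t - z) / (of_real t - w) / (of_real t - z)))"
        using slit_neq z ws by (auto intro!: continuous_intros)
      fix t :: real assume t: "t > 0"
      have "norm (of_real t - z) \<ge> d/2" "norm (of_real t - w) \<ge> d/2"
        using d(3)[OF t, of z] d(3)[OF t, of w] w d(1) by auto
      then have "1 / norm (of_real t - z) \<le> 2/d" "1 / norm (of_real t - w) \<le> 2/d"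
        using d(1) le_imp_inverse_le[of "d/2"] by (auto simp: inverse_eq_divide)
      then have "1 / norm (of_real t - z) * (1 / norm (of_real t - w)) * (1 / norm (of_real t - z))
          \<le> (2/d)*(2/d)*(2/d)"
        using d(1) by (intro mult_mono mult_nonneg_nonneg) auto
      then have "norm (1 / (of_real t - z) / (of_real t - w) / (of_real t - z)) \<le> 8/d^3"
        by (simp add: norm_divide norm_mult power3_eq_cube)
      then show "norm ((w - z) * (1 / (of_real t - z) / (of_real t - w) / (of_real t - z))) \<le> norm
          (w - z) * (8/d^3)"
        unfolding norm_mult by (intro mult_left_mono) auto
    qed
    then show ?thesis using integral_unique[OF eq] by (simp add: mult.assoc)
  qed
  have "((\<lambda>w. (stieltjes_int k w - stieltjes_int k z) / (w - z) - D) \<longlongrightarrow> 0) (at z)"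
  proof (rule Lim_null_comparison)
    show "eventually (\<lambda>w. norm ((stieltjes_int k w - stieltjes_int k z) / (w - z) - D) 
             \<le> norm (w - z) * (8 / d^3 * Gamma (k + 1/2))) (at z)"
      unfolding eventually_at
    proof (intro exI[of _ "d/2"] conjI ballI impI)
      show "0 < d/2" using d(1) by simp
    qed (use bd in \<open>auto simp: dist_commute\<close>)
    show "((\<lambda>w. norm (w - z) * (8 / d^3 * Gamma (k + 1/2))) \<longlongrightarrow> 0) (at z)"
      using d(1) by (auto intro!: tendsto_eq_intros)
  qed
  then show ?thesis
    by (simp add: has_field_derivative_iff LIM_zero_iff D_def)
qed

lemma stieltjes_int_holomorphic: "k > -1/2 \<Longrightarrow> stieltjes_int k holomorphic_on slit"
  using stieltjes_int_has_derivative open_slit by (auto simp: holomorphic_on_open)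

lemma powr_exp_deriv:
  assumes "t > (0::real)"
  shows "((\<lambda>t. t powr c * exp (- t)) has_real_derivative (c / t - 1) * (t powr c * exp (- t))) (at t)"
  using assms by (auto intro!: derivative_eq_intros simp: powr_diff field_simps)

text \<open>Because \<open>t w'(t) = (k - 1/2 - t) w(t)\<close> for the weight \<open>w\<close>, the derivative of \<open>-t w(t) / (t - z)\<close> in \<open>t\<close>
is the integrand of the left side minus the right side, and this function vanishes at both ends of
the half-line.\<close>

lemma stieltjes_int_ode:
  assumes k: "k > -1/2" and z: "z \<in> slit"
  obtains D where "(stieltjes_int k has_field_derivative D) (at z)"
    "z * D + (z - of_real (k - 1/2)) * stieltjes_int k z = - of_real (Gamma (k + 1/2))"
proof -
  let ?f = "\<lambda>t. complex_of_real (gamma_weight k t)"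
  define D where "D = integral {0<..} (\<lambda>t. of_real (gamma_weight k t) / (of_real t - z)\<^sup>2)"
  have D: "((\<lambda>t. of_real (gamma_weight k t) / (of_real t - z)\<^sup>2) has_integral D) {0<..}"
    unfolding D_def
    using cauchy_kernel_integrable(2)[OF k z] by (intro integrable_integral
        set_lebesgue_integral_eq_integral)
  let ?h = "\<lambda>t. z * (?f t / (of_real t - z)\<^sup>2) 
            + (z - of_real (k - 1/2)) * (?f t / (of_real t - z)) + ?f t"
  have fi: "?f absolutely_integrable_on {0<..}"
    using gamma_weight_mult_absolutely_integrable[OF k, of "\<lambda>_. 1" 1] by simp
  have hI: "(?h has_integral (z * D + (z - of_real (k - 1/2)) * stieltjes_int k z + of_real (Gamma
      (k + 1/2)))) {0<..}"
    by (intro has_integral_add has_integral_mult_right D stieltjes_has_integral[OF k z]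
        has_integral_of_real gamma_weight_has_integral k)
  have hai: "?h absolutely_integrable_on {0<..}"
    by (intro set_integral_add set_integrable_mult_right cauchy_kernel_integrable k z fi)
  have tw0: "((\<lambda>t. of_real t * ?f t) \<longlongrightarrow> 0) (at_right 0)"
  proof -
    have "((\<lambda>t::real. t * (t powr (k - 1/2) * exp (- t))) \<longlongrightarrow> 0) (at_right 0)"
      using k by real_asymp
    then have "((\<lambda>t. complex_of_real (t * (t powr (k - 1/2) * exp (- t)))) \<longlongrightarrow> of_real 0) (at_right 0)"
      by (rule tendsto_of_real)
    then show ?thesis by (simp add: gamma_weight_def)
  qed
  have twi: "((\<lambda>t. of_real t * ?f t) \<longlongrightarrow> 0) at_top"
  proof -
    have "((\<lambda>t::real. t * (t powr (k - 1/2) * exp (- t))) \<longlongrightarrow> 0) at_top"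
      using k by real_asymp
    then have "((\<lambda>t. complex_of_real (t * (t powr (k - 1/2) * exp (- t)))) \<longlongrightarrow> of_real 0) at_top"
      by (rule tendsto_of_real)
    then show ?thesis by (simp add: gamma_weight_def)
  qed
  obtain B where B: "B > 0" "\<And>t. t > 0 \<Longrightarrow> norm (1 / (complex_of_real t - z)) \<le> B"
    using cauchy_kernel_bounded[OF z] by metis
  let ?G = "\<lambda>t. - (of_real t * ?f t * (1 / (of_real t - z)))"
  have lim: "(?G \<longlongrightarrow> 0) F" if "((\<lambda>t. of_real t * ?f t) \<longlongrightarrow> 0) F" "eventually (\<lambda>t. t > 0) F" for F
  proof -
    have "Zfun (\<lambda>t. of_real t * ?f t * (1 / (of_real t - z))) F"
    proof (rule bounded_bilinear.Zfun_prod_Bfun[OF bounded_bilinear_mult])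
      show "Zfun (\<lambda>t. of_real t * ?f t) F" using that(1) by (simp add: tendsto_Zfun_iff)
      show "Bfun (\<lambda>t. 1 / (of_real t - z)) F"
        by (rule BfunI[of _ B], rule eventually_mono[OF that(2)], rule B(2))
    qed
    then show ?thesis unfolding tendsto_Zfun_iff by (simp only: diff_zero Zfun_minus)
  qed
  \<comment> \<open>\<open>?h\<close> is the integrand of the left side minus the right side of the equation\<close>
  have der: "(?G has_vector_derivative ?h t) (at t)" if t: "t > 0" for t
  proof -
    have nz: "of_real t - z \<noteq> 0" using slit_neq[OF z t] .
    have gd: "(gamma_weight k has_real_derivative ((k - 1/2) / t - 1) * gamma_weight k t) (at t)"
      unfolding gamma_weight_def using powr_exp_deriv[OF t, of "k - 1/2"] .
    define g' where "g' = ((k - 1/2) / t - 1) * gamma_weight k t"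
    have inv: "((\<lambda>t. 1 / (of_real t - z)) has_vector_derivative (- 1 / (of_real t - z)\<^sup>2)) (at t)"
      by (rule has_vector_derivative_real_field) 
         (use nz in \<open>auto intro!: derivative_eq_intros simp: power2_eq_square\<close>)
    have "?f t * of_real (k - 1/2) - of_real t * ?f t = of_real t * complex_of_real g'"
      using t unfolding g'_def by (simp add: field_simps flip: of_real_mult of_real_diff of_real_add
          of_real_divide)
    then have eq: "of_real t * of_real g' = (of_real (k - 1/2) - of_real t) * ?f t"
      by (simp add: algebra_simps)
    have "(?G has_vector_derivative - ((of_real t * ?f t) * (- 1 / (of_real t - z)\<^sup>2) 
             + (of_real t * of_real g' + 1 * ?f t) * (1 / (of_real t - z)))) (at t)"
      by (intro has_vector_derivative_minus has_vector_derivative_mult inv has_vector_derivative_of_real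
           has_vector_derivative_real_field gd[folded g'_def]) (auto intro!: derivative_eq_intros)
    also have "- ((of_real t * ?f t) * (- 1 / (of_real t - z)\<^sup>2) 
             + (of_real t * of_real g' + 1 * ?f t) * (1 / (of_real t - z))) = ?h t"
      unfolding eq using nz by (simp add: divide_simps power2_eq_square) (simp add: algebra_simps)
    finally show ?thesis .
  qed
  have cont: "continuous_on {0<..} ?h"
    using slit_neq[OF z] by (auto intro!: continuous_intros gamma_weight_continuous_on)
  have hb: "set_integrable lborel {0<..} ?h"
  proof -
    have "(\<lambda>t. indicator {0<..} t *\<^sub>R ?h t) \<in> borel_measurable borel"
      by (intro borel_measurable_continuous_on_indicator cont) auto
    then show ?thesis using hai by (simp add: set_integrable_def integrable_completion)
  qed
  have "(LBINT t=0..\<infinity>. ?h t) = 0 - 0"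
  proof (rule interval_integral_FTC_integrable[where F = ?G])
    have "einterval 0 \<infinity> = {0<..}" by (auto simp: einterval_iff)
    then show "set_integrable lborel (einterval 0 \<infinity>) ?h" using hb by simp
    show "isCont ?h t" if "0 < ereal t" "ereal t < \<infinity>" for t
      using cont that by (auto simp: continuous_on_eq_continuous_at)
    show "((?G \<circ> real_of_ereal) \<longlongrightarrow> 0) (at_right 0)"
      using lim[OF tw0 eventually_at_right_less] unfolding zero_ereal_def ereal_tendsto_simps1 .
    show "((?G \<circ> real_of_ereal) \<longlongrightarrow> 0) (at_left \<infinity>)"
      using lim[OF twi eventually_gt_at_top] unfolding ereal_tendsto_simps1 .
  qed (use der in auto)
  then have "integral {0<..} ?h = 0"
    unfolding interval_lebesgue_integral_0_infty set_borel_integral_eq_integral(2)[OF hb] by simp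
  then have "z * D + (z - of_real (k - 1/2)) * stieltjes_int k z + of_real (Gamma (k + 1/2)) = 0"
    using integral_unique[OF hI] by simp
  then show ?thesis 
    using that[of D] stieltjes_int_has_derivative[OF k z] by (simp add: D_def eq_neg_iff_add_eq_0
        algebra_simps)
qed

section \<open>A logarithm that is continuous up to the real axis\<close>

text \<open>The logarithm with the cut along the negative imaginary axis. Unlike \<open>Ln (-z)\<close>, whose cut is the
positive axis, it is holomorphic near every boundary point of the half-plane other than 0.\<close>

definition Ln_up :: "complex \<Rightarrow> complex" where
  "Ln_up z = Ln (- \<i> * z) + \<i> * of_real (pi / 2)"

definition cutplane :: "complex set" where
  "cutplane = {z. Re z \<noteq> 0 \<or> Im z > 0}"

abbreviation closed_uhp0 :: "complex set" where
  "closed_uhp0 \<equiv> {z. Im z \<ge> 0} - {0}"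

lemma uhp_subset: "upper_half_plane \<subseteq> closed_uhp0" "closed_uhp0 \<subseteq> cutplane" "upper_half_plane \<subseteq> cutplane"
  by (auto simp: upper_half_plane_def cutplane_def complex_eq_iff)

lemma open_uhp: "open upper_half_plane" and convex_uhp: "convex upper_half_plane"
  unfolding upper_half_plane_def by (auto simp: open_halfspace_Im_gt convex_halfspace_Im_gt)

lemma open_cutplane: "open cutplane"
proof -
  have "cutplane = {z. Re z < 0} \<union> {z. Re z > 0} \<union> {z. Im z > 0}" by (auto simp: cutplane_def)
  then show ?thesis by (metis open_halfspace_Im_gt open_halfspace_Re_gt open_halfspace_Re_lt open_Un)
qed

lemma starlike_cutplane: "starlike cutplane"
  unfolding starlike_def
proof (intro bexI[of _ \<i>] ballI)
  fix z assume z: "z \<in> cutplane"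
  show "closed_segment \<i> z \<subseteq> cutplane"
  proof
    fix w assume "w \<in> closed_segment \<i> z"
    then obtain u where u: "0 \<le> u" "u \<le> 1" "w = (1 - u) *\<^sub>R \<i> + u *\<^sub>R z"
      by (auto simp: in_segment)
    then have w: "Re w = u * Re z" "Im w = (1 - u) + u * Im z" by simp_all
    show "w \<in> cutplane"
    proof (cases "u = 0 \<or> Re z \<noteq> 0")
      case False
      then have "Im z > 0" "u > 0" using z u by (auto simp: cutplane_def)
      then have "u * Im z > 0" by simp
      then show ?thesis using w u by (simp add: cutplane_def)
    qed (use w in \<open>auto simp: cutplane_def\<close>)
  qed
qed (simp add: cutplane_def)

lemma Ln_up_has_derivative:
  assumes "z \<in> cutplane"
  shows "(Ln_up has_field_derivative 1 / z) (at z)"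
proof -
  have "z \<noteq> 0" using assms by (auto simp: cutplane_def)
  moreover have "- \<i> * z \<notin> \<real>\<^sub>\<le>\<^sub>0"
    using assms by (auto simp: cutplane_def complex_nonpos_Reals_iff)
  ultimately show ?thesis unfolding Ln_up_def
    by (auto intro!: derivative_eq_intros simp: field_simps)
qed

lemma Ln_up_has_derivative' [derivative_intros]:
  assumes "(f has_field_derivative f') (at z within A)" "f z \<in> cutplane"
  shows "((\<lambda>z. Ln_up (f z)) has_field_derivative f' / f z) (at z within A)"
  using DERIV_chain2[OF Ln_up_has_derivative[OF assms(2)] assms(1)] by simp

lemma Ln_up_holomorphic: "Ln_up holomorphic_on cutplane"
  using Ln_up_has_derivative open_cutplane by (auto simp: holomorphic_on_open)

lemma Ln_up_holomorphic' [holomorphic_intros]: 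
  "A \<subseteq> cutplane \<Longrightarrow> Ln_up holomorphic_on A"
  using Ln_up_holomorphic holomorphic_on_subset by blast

lemma exp_half_pi: "exp (\<i> * of_real (pi / 2)) = \<i>"
  by (metis cis_conv_exp cis_pi_half)

lemma exp_Ln_up: "z \<noteq> 0 \<Longrightarrow> exp (Ln_up z) = z"
  by (simp only: Ln_up_def exp_add exp_half_pi) (simp add: exp_Ln, simp add: complex_eq_iff)

lemma Re_Ln_up: "z \<noteq> 0 \<Longrightarrow> Re (Ln_up z) = ln (norm z)"
  by (simp add: Ln_up_def norm_mult)

lemma Im_Ln_up_strict: 
  assumes "z \<in> upper_half_plane"
  shows "0 < Im (Ln_up z)" "Im (Ln_up z) < pi"
proof -
  have "z \<noteq> 0" using assms by (auto simp: upper_half_plane_def)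
  then have "\<bar>Im (Ln (- \<i> * z))\<bar> < pi / 2"
    using assms by (subst Re_Ln_pos_lt) (auto simp: upper_half_plane_def)
  then show "0 < Im (Ln_up z)" "Im (Ln_up z) < pi" by (auto simp: Ln_up_def abs_less_iff)
qed

lemma Ln_uminus_Ln_up: 
  assumes "z \<in> upper_half_plane"
  shows "Ln (- z) = Ln_up z - \<i> * of_real pi"
proof -
  have "z \<noteq> 0" using assms by (auto simp: upper_half_plane_def)
  then have "exp (Ln_up z - \<i> * of_real pi) = - z"
    by (simp add: exp_diff exp_Ln_up)
  moreover have "Ln (exp (Ln_up z - \<i> * of_real pi)) = Ln_up z - \<i> * of_real pi"
    using Im_Ln_up_strict[OF assms] by (intro Ln_exp) auto
  ultimately show ?thesis by simp
qed

lemma Im_Ln_uminus: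
  assumes "z \<in> upper_half_plane"
  shows "-pi < Im (Ln (- z))" "Im (Ln (- z)) < 0"
  using Im_Ln_up_strict[OF assms] by (simp_all add: Ln_uminus_Ln_up[OF assms])

lemma Ln_up_pos: "x > 0 \<Longrightarrow> Ln_up (of_real x) = of_real (ln x)"
proof -
  assume x: "x > 0"
  have "exp (of_real (ln x) - \<i> * of_real (pi/2)) = - \<i> * of_real x"
    unfolding exp_diff exp_half_pi using x by (simp add: exp_of_real)
  moreover have "Ln (exp (of_real (ln x) - \<i> * of_real (pi/2))) = of_real (ln x) - \<i> * of_real (pi/2)"
    using pi_gt_zero by (intro Ln_exp) (simp_all del: pi_gt_zero)
  ultimately show ?thesis by (simp add: Ln_up_def)
qed

lemma Ln_up_neg: "x > 0 \<Longrightarrow> Ln_up (- of_real x) = of_real (ln x) + \<i> * of_real pi"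
proof -
  assume x: "x > 0"
  have "exp (of_real (ln x) + \<i> * of_real (pi/2)) = \<i> * of_real x"
    unfolding exp_add exp_half_pi using x by (simp add: exp_of_real)
  moreover have "Ln (exp (of_real (ln x) + \<i> * of_real (pi/2))) = of_real (ln x) + \<i> * of_real (pi/2)"
    by (intro Ln_exp) auto
  ultimately show ?thesis by (simp add: Ln_up_def)
qed

lemma norm_exp_Ln_up: "z \<noteq> 0 \<Longrightarrow> norm (exp (w + of_real c * Ln_up z)) = exp (Re w) * norm z powr c"
  by (simp add: norm_exp_eq_Re Re_Ln_up exp_add powr_def norm_mult)

lemma holomorphic_on_imp_isCont: "f holomorphic_on S \<Longrightarrow> open S \<Longrightarrow> z \<in> S \<Longrightarrow> isCont f z"
  using holomorphic_on_imp_continuous_on continuous_on_eq_continuous_at by blast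

section \<open>Passing to the boundary of the half-plane\<close>

lemma at_within_uhp_nontrivial: "Im z \<ge> 0 \<Longrightarrow> at z within upper_half_plane \<noteq> bot"
proof -
  assume z: "Im z \<ge> 0"
  have "z islimpt upper_half_plane"
    unfolding islimpt_approachable
  proof (intro allI impI)
    fix e :: real assume "e > 0"
    then show "\<exists>x'\<in>upper_half_plane. x' \<noteq> z \<and> dist x' z < e"
      using z by (intro bexI[of _ "z + \<i> * of_real (e/2)"]) (auto simp: upper_half_plane_def
          dist_norm norm_mult)
  qed
  then show ?thesis by (simp add: trivial_limit_within)
qed

text \<open>Estimates and identities that are proved inside the half-plane extend to the punctured real axis by
continuity; this lemma and the next one do that.\<close>

lemma le_on_boundary:
  fixes f g :: "complex \<Rightarrow> real"
  assumes "continuous_on closed_uhp0 f" "continuous_on closed_uhp0 g" "z \<in> closed_uhp0" 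
     "eventually (\<lambda>z. f z \<le> g z) (at z within upper_half_plane)"
  shows "f z \<le> g z"
proof (rule tendsto_le[OF _ _ _ assms(4)])
  show "(g \<longlongrightarrow> g z) (at z within upper_half_plane)" "(f \<longlongrightarrow> f z) (at z within upper_half_plane)"
    using assms uhp_subset(1) by (meson continuous_on_def tendsto_within_subset)+
qed (use assms at_within_uhp_nontrivial in auto)

lemma eq_on_boundary:
  fixes f g :: "complex \<Rightarrow> 'b :: t2_space"
  assumes "isCont f z" "isCont g z" "Im z \<ge> 0" "\<And>z. z \<in> upper_half_plane \<Longrightarrow> f z = g z"
  shows "f z = g z"
proof -
  have "(f \<longlongrightarrow> f z) (at z within upper_half_plane)" "(g \<longlongrightarrow> g z) (at z within upper_half_plane)"
    using assms by (auto simp: isCont_def intro: tendsto_within_subset)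
  moreover have "(f \<longlongrightarrow> g z) (at z within upper_half_plane) \<longleftrightarrow> (g \<longlongrightarrow> g z) (at z within upper_half_plane)"
    by (intro tendsto_cong) (auto simp: eventually_at_filter assms)
  ultimately show ?thesis
    using tendsto_unique[OF at_within_uhp_nontrivial[OF assms(3)]] by blast
qed

section \<open>Continuation of the transform across the positive axis\<close>

text \<open>The derivative of \<open>z^(1/2 - k) e^z S(z) / pi\<close>, where \<open>S\<close> is the transform. It has no trace of the
integral, so it is defined on the whole cut plane.\<close>

definition gamma_prim_deriv :: "real \<Rightarrow> complex \<Rightarrow> complex" where
  "gamma_prim_deriv k z = - of_real (Gamma (k + 1/2) / pi) * exp (z - of_real (k + 1/2) * Ln_up z)"

text \<open>The cut plane is starlike, so the derivative has a primitive there. By the differential equation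
\<open>z^(1/2 - k) e^z S(z) / pi\<close> is another primitive on the half-plane, and the two differ by a constant.\<close>

lemma gamma_prim_exists:
  assumes k: "k > -1/2"
  shows "\<exists>K. (\<forall>z\<in>cutplane. (K has_field_derivative gamma_prim_deriv k z) (at z)) \<and>
             (\<forall>z\<in>upper_half_plane. K z = exp (z - of_real (k - 1/2) * Ln_up z) * stieltjes_int k z /
                 of_real pi)"
proof -
  have "gamma_prim_deriv k holomorphic_on cutplane"
    unfolding gamma_prim_deriv_def by (intro holomorphic_intros) auto
  then obtain g where g: "\<And>z. z \<in> cutplane \<Longrightarrow> (g has_field_derivative gamma_prim_deriv k z) (at z)"
    using holomorphic_starlike_primitive[OF _ starlike_cutplane open_cutplane, of "gamma_prim_deriv k" "{}"]
    by (metis Diff_iff finite.emptyI holomorphic_on_imp_continuous_on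
        holomorphic_on_imp_differentiable_at open_cutplane)
  let ?L = "\<lambda>z. exp (z - of_real (k - 1/2) * Ln_up z) * stieltjes_int k z / of_real pi"
  have L: "(?L has_field_derivative gamma_prim_deriv k z) (at z)" if z: "z \<in> upper_half_plane" for z
  proof -
    have zs: "z \<in> slit" "z \<in> cutplane" and z0: "z \<noteq> 0"
      using z upper_half_plane_slit uhp_subset by (auto simp: upper_half_plane_def)
    obtain D where D: "(stieltjes_int k has_field_derivative D) (at z)"
      "z * D + (z - of_real (k - 1/2)) * stieltjes_int k z = - of_real (Gamma (k + 1/2))"
      using stieltjes_int_ode[OF k zs(1)] by metis
    let ?E = "exp (z - of_real (k - 1/2) * Ln_up z)"
    have "exp (z - of_real (k + 1/2) * Ln_up z) = exp ((z - of_real (k - 1/2) * Ln_up z) - Ln_up z)"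
      by (simp add: algebra_simps add_divide_distrib)
    then have E: "exp (z - of_real (k + 1/2) * Ln_up z) = ?E / z"
      by (simp only: exp_diff[of "z - of_real (k - 1/2) * Ln_up z"] exp_Ln_up[OF z0])
    have "(?L has_field_derivative ((?E * (1 - of_real (k - 1/2) * (1 / z))) * stieltjes_int k z +
        ?E * D) / of_real pi) (at z)"
      using zs z0 by (auto intro!: derivative_eq_intros D(1) simp: mult.commute)
    also have "((?E * (1 - of_real (k - 1/2) * (1 / z))) * stieltjes_int k z + ?E * D) / of_real pi
        = ?E / z * (z * D + (z - of_real (k - 1/2)) * stieltjes_int k z) / of_real pi"
      using z0 by (simp add: divide_simps) (simp add: algebra_simps)
    also have "\<dots> = gamma_prim_deriv k z" unfolding D(2) gamma_prim_deriv_def E by (simp add: field_simps)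
    finally show ?thesis .
  qed
  have "\<exists>c. \<forall>z\<in>upper_half_plane. ?L z - g z = c"
  proof (rule has_field_derivative_zero_constant)
    show "((\<lambda>z. ?L z - g z) has_field_derivative 0) (at z within upper_half_plane)" if "z \<in>
        upper_half_plane" for z
      using DERIV_diff[OF L[OF that] g[of z]] that uhp_subset by (auto intro:
          has_field_derivative_at_within)
  qed (simp add: convex_uhp)
  then obtain c where c: "\<And>z. z \<in> upper_half_plane \<Longrightarrow> ?L z - g z = c" by blast
  show ?thesis
  proof (intro exI[of _ "\<lambda>z. g z + c"] conjI ballI)
    show "((\<lambda>z. g z + c) has_field_derivative gamma_prim_deriv k z) (at z)" if "z \<in> cutplane" for z
      using g[OF that] by (auto intro!: derivative_eq_intros)
  qed (use c in \<open>simp add: algebra_simps\<close>)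
qed

text \<open>Up to a constant factor this is the incomplete gamma function \<open>Gamma (1/2 - k, -z)\<close>.\<close>

definition gamma_prim :: "real \<Rightarrow> complex \<Rightarrow> complex" where
  "gamma_prim k = (SOME K. (\<forall>z\<in>cutplane. (K has_field_derivative gamma_prim_deriv k z) (at z)) \<and>
             (\<forall>z\<in>upper_half_plane. K z = exp (z - of_real (k - 1/2) * Ln_up z) * stieltjes_int k z /
                 of_real pi))"

lemma gamma_prim:
  assumes "k > -1/2"
  shows "z \<in> cutplane \<Longrightarrow> (gamma_prim k has_field_derivative gamma_prim_deriv k z) (at z)"
    "z \<in> upper_half_plane \<Longrightarrow> gamma_prim k z = exp (z - of_real (k - 1/2) * Ln_up z) * stieltjes_int k
        z / of_real pi"
  using someI_ex[OF gamma_prim_exists[OF assms], folded gamma_prim_def] by blast+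

text \<open>The analytic continuation of the transform from the upper half-plane to the cut plane. Below the positive
axis it differs from \<open>stieltjes_int k\<close>.\<close>

definition stieltjes_ext :: "real \<Rightarrow> complex \<Rightarrow> complex" where
  "stieltjes_ext k z = of_real pi * exp (of_real (k - 1/2) * Ln_up z - z) * gamma_prim k z"

lemma stieltjes_ext_holomorphic: "k > -1/2 \<Longrightarrow> stieltjes_ext k holomorphic_on cutplane"
proof -
  assume "k > -1/2"
  then have "gamma_prim k holomorphic_on cutplane" 
    using gamma_prim open_cutplane by (auto simp: holomorphic_on_open)
  then show ?thesis unfolding stieltjes_ext_def by (intro holomorphic_intros) auto
qed

lemma stieltjes_ext_uhp: "k > -1/2 \<Longrightarrow> z \<in> upper_half_plane \<Longrightarrow> stieltjes_ext k z = stieltjes_int k z"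
  by (simp add: stieltjes_ext_def gamma_prim(2) flip: mult.assoc exp_add)

lemma stieltjes_ext_neg:
  assumes "k > -1/2" "x > 0"
  shows "stieltjes_ext k (- of_real x) = stieltjes_int k (- of_real x)"
proof (rule eq_on_boundary[where f = "stieltjes_ext k" and g = "stieltjes_int k"])
  show "isCont (stieltjes_ext k) (- of_real x)"
    using assms(2) by (intro holomorphic_on_imp_isCont[OF stieltjes_ext_holomorphic[OF assms(1)]
        open_cutplane]) (auto simp: cutplane_def)
  show "isCont (stieltjes_int k) (- of_real x)"
    using assms(2) by (intro holomorphic_on_imp_isCont[OF stieltjes_int_holomorphic[OF assms(1)]
        open_slit]) 
      (auto simp: complex_nonneg_Reals_iff)
qed (use stieltjes_ext_uhp assms in auto)

section \<open>Signs of the transform\<close>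

text \<open>From \<open>z / (t - z) + 1 = t / (t - z)\<close>.\<close>

lemma stieltjes_int_add1:
  assumes k: "k > -1/2" and z: "z \<in> slit"
  shows "z * stieltjes_int k z + of_real (Gamma (k + 1/2)) = stieltjes_int (k + 1) z"
proof (rule has_integral_unique)
  show "((\<lambda>t. z * (of_real (gamma_weight k t) / (of_real t - z)) + of_real (gamma_weight k t)) has_integral
      z * stieltjes_int k z + of_real (Gamma (k + 1/2))) {0<..}"
    by (intro has_integral_add has_integral_mult_right stieltjes_has_integral[OF k z]
        has_integral_of_real gamma_weight_has_integral k)
  have "k + 1 > -1/2" using k by simp
  from stieltjes_has_integral[OF this z]
  show "((\<lambda>t. z * (of_real (gamma_weight k t) / (of_real t - z)) + of_real (gamma_weight k t)) has_integral
      stieltjes_int (k + 1) z) {0<..}"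
  proof (rule has_integral_eq[rotated])
    fix t :: real assume t: "t \<in> {0<..}"
    then show "of_real (gamma_weight (k + 1) t) / (of_real t - z) = z * (of_real (gamma_weight k t)
        / (of_real t - z)) + of_real (gamma_weight k t)"
      using slit_neq[OF z, of t] by (simp add: gamma_weight_Suc divide_simps) (simp add: algebra_simps)
  qed
qed

lemma Im_kernel: "Im (of_real w / (of_real t - z)) = w * Im z / ((t - Re z)\<^sup>2 + (Im z)\<^sup>2)"
  by (simp add: Im_divide)

lemma Im_stieltjes_has_integral:
  assumes k: "k > -1/2" and z: "z \<in> slit"
  shows "((\<lambda>t. gamma_weight k t * Im z / ((t - Re z)\<^sup>2 + (Im z)\<^sup>2)) has_integral Im (stieltjes_int k
      z)) {0<..}"
  using has_integral_Im[OF stieltjes_has_integral[OF k z]] by (simp add: Im_kernel)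

lemma has_integral_continuous_pos:
  fixes f :: "real \<Rightarrow> real"
  assumes "(f has_integral I) {0<..}" "continuous_on {0<..} f" "\<And>t. t > 0 \<Longrightarrow> f t > 0"
  shows "I > 0"
proof -
  have 1: "f integrable_on {1..2}"
    using assms(2) by (intro integrable_continuous_real) (auto elim: continuous_on_subset)
  have "\<exists>x\<in>{1..2}. \<forall>y\<in>{1..2}. f x \<le> f y"
    using assms(2) by (intro continuous_attains_inf) (auto elim: continuous_on_subset)
  then obtain x where x: "x \<in> {1..2}" "\<And>y. y \<in> {1..2} \<Longrightarrow> f x \<le> f y" by blast
  have "0 < f x" using assms(3) x(1) by auto
  also have "f x = integral {1..2::real} (\<lambda>_. f x)" by simp
  also have "\<dots> \<le> integral {1..2} f"
    using 1 x by (intro integral_le) auto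
  also have "\<dots> \<le> integral {0<..} f"
    using assms 1 by (intro integral_subset_le) (auto simp: integrable_on_def intro: less_imp_le)
  finally show ?thesis using assms(1) by (simp add: integral_unique)
qed

lemma Im_stieltjes_pos:
  assumes k: "k > -1/2" and z: "z \<in> upper_half_plane"
  shows "Im (stieltjes_int k z) > 0"
proof (rule has_integral_continuous_pos[OF Im_stieltjes_has_integral[OF k]])
  have "Im z > 0" using z by (simp add: upper_half_plane_def)
  then have nz: "(t - Re z)\<^sup>2 + (Im z)\<^sup>2 > 0" for t by (simp add: add_nonneg_pos)
  show "z \<in> slit" using z upper_half_plane_slit by blast
  show "continuous_on {0<..} (\<lambda>t. gamma_weight k t * Im z / ((t - Re z)\<^sup>2 + (Im z)\<^sup>2))"
    by (intro continuous_intros gamma_weight_continuous_on ballI) (use nz in \<open>metis less_irrefl\<close>)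
  show "gamma_weight k t * Im z / ((t - Re z)\<^sup>2 + (Im z)\<^sup>2) > 0" if "t > 0" for t
    using gamma_weight_pos[OF that] nz \<open>Im z > 0\<close> by simp
qed

text \<open>Adding a real constant turns \<open>z S\<close> into a transform of the same kind. This sign makes the derivative
of the explicit map have positive imaginary part.\<close>

lemma Im_z_stieltjes_pos:
  assumes k: "k > -1/2" and z: "z \<in> upper_half_plane"
  shows "Im (z * stieltjes_int k z) > 0"
proof -
  have "z * stieltjes_int k z = stieltjes_int (k + 1) z - of_real (Gamma (k + 1/2))"
    using stieltjes_int_add1[OF k, of z] z upper_half_plane_slit by (auto simp: algebra_simps)
  then show ?thesis using Im_stieltjes_pos[of "k + 1" z] k z by simp
qed

lemma stieltjes_neg_axis:
  assumes k: "k > -1/2" and x: "x > 0"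
  shows "((\<lambda>t. gamma_weight k t / (t + x)) has_integral Re (stieltjes_int k (- of_real x))) {0<..}"
        "Im (stieltjes_int k (- of_real x)) = 0" "Re (stieltjes_int k (- of_real x)) > 0"
proof -
  have z: "- of_real x \<in> slit" using x by (auto simp: complex_nonneg_Reals_iff)
  have "((\<lambda>t. complex_of_real (gamma_weight k t / (t + x))) has_integral stieltjes_int k (- of_real
      x)) {0<..}"
    using stieltjes_has_integral[OF k z] by simp
  from has_integral_Re[OF this] has_integral_Im[OF this] 
  show 1: "((\<lambda>t. gamma_weight k t / (t + x)) has_integral Re (stieltjes_int k (- of_real x))) {0<..}"
    and "Im (stieltjes_int k (- of_real x)) = 0" by (simp_all add: has_integral_0_eq)
  show "Re (stieltjes_int k (- of_real x)) > 0"
    using x by (intro has_integral_continuous_pos[OF 1] continuous_intros gamma_weight_continuous_on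
        divide_pos_pos gamma_weight_pos) auto
qed

section \<open>The boundary value on the positive axis\<close>

lemma gamma_weight_bounded:
  assumes "k \<ge> 1/2"
  obtains B where "\<And>t. t > 0 \<Longrightarrow> gamma_weight k t \<le> B"
proof -
  have "((\<lambda>t::real. t powr (k - 1/2) * exp (- t)) \<longlongrightarrow> 0) at_top" using assms by real_asymp
  then have "eventually (\<lambda>t. gamma_weight k t < 1) at_top" unfolding gamma_weight_def by (rule
      order_tendstoD) simp
  then obtain T where T: "\<And>t. t \<ge> T \<Longrightarrow> gamma_weight k t < 1" by (auto simp: eventually_at_top_linorder)
  have "gamma_weight k t \<le> max 1 (max T 1 powr (k - 1/2))" if "t > 0" for t
  proof (cases "t \<ge> T")
    case False
    have "t powr (k - 1/2) * exp (- t) \<le> max T 1 powr (k - 1/2) * 1"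
      using False assms that by (intro mult_mono powr_mono2) auto
    then show ?thesis by (simp add: gamma_weight_def)
  qed (use T[of t] in auto)
  then show ?thesis using that by blast
qed

text \<open>The imaginary part at \<open>x + i y\<close> is \<open>pi\<close> times the Poisson integral of the weight. After the substitution
\<open>t = x + y s\<close> the kernel \<open>1 / (1 + s^2)\<close> no longer depends on \<open>y\<close>, and dominated convergence applies.\<close>

lemma Im_stieltjes_limit:
  assumes k: "k \<ge> 1/2" and x: "x > 0"
  shows "(\<lambda>n. Im (stieltjes_int k (of_real x + \<i> * of_real (1 / real (Suc n))))) \<longlonglongrightarrow> pi * gamma_weight k x"
proof -
  obtain B where B: "\<And>t. t > 0 \<Longrightarrow> gamma_weight k t \<le> B" using gamma_weight_bounded[OF k] by blast
  define \<phi> where "\<phi> t = (if t > 0 then gamma_weight k t else 0)" for t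
  have \<phi>B: "\<bar>\<phi> t\<bar> \<le> \<bar>B\<bar>" for t
    using B[of t] gamma_weight_nonneg[of k t] by (auto simp: \<phi>_def)
  have [measurable]: "\<phi> \<in> borel_measurable borel" unfolding \<phi>_def gamma_weight_def by measurable
  have contphi: "isCont \<phi> x"
  proof -
    have "isCont (gamma_weight k) x" using gamma_weight_continuous_on x by (simp add:
        continuous_on_eq_continuous_at)
    moreover have "eventually (\<lambda>t. \<phi> t = gamma_weight k t) (nhds x)"
      using eventually_nhds_in_open[of "{0<..}" x] x by (auto elim!: eventually_mono simp: \<phi>_def)
    ultimately show ?thesis by (metis isCont_cong)
  qed
  have eq: "Im (stieltjes_int k (of_real x + \<i> * of_real y)) = (\<integral>s. \<phi> (x + y * s) * inverse (1 +
      s\<^sup>2) \<partial>lborel)"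
    if y: "y > 0" for y
  proof -
    let ?z = "of_real x + \<i> * of_real y"
    let ?g = "\<lambda>t. gamma_weight k t * y / ((t - x)\<^sup>2 + y\<^sup>2)"
    have "?z \<in> slit" using y by (auto simp: complex_nonneg_Reals_iff)
    then have "(?g has_integral Im (stieltjes_int k ?z)) {0<..}"
      using Im_stieltjes_has_integral[of k ?z] k by simp
    then have h: "((\<lambda>t. \<phi> t * y / ((t - x)\<^sup>2 + y\<^sup>2)) has_integral Im (stieltjes_int k ?z)) UNIV"
      by (subst (asm) has_integral_restrict_UNIV[symmetric]) (auto simp: \<phi>_def elim!:
          has_integral_eq[rotated])
    have "((\<lambda>t. \<phi> t * y / ((t - x)\<^sup>2 + y\<^sup>2)) has_integral (\<integral>t. \<phi> t * y / ((t - x)\<^sup>2 + y\<^sup>2) \<partial>lborel)) UNIV"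
    proof (rule has_integral_integral_lborel)
      have "(\<lambda>t. \<phi> t * y / ((t - x)\<^sup>2 + y\<^sup>2)) absolutely_integrable_on UNIV"
        using h y by (intro nonnegative_absolutely_integrable_1) (auto simp: integrable_on_def \<phi>_def
            gamma_weight_nonneg)
      then show "integrable lborel (\<lambda>t. \<phi> t * y / ((t - x)\<^sup>2 + y\<^sup>2))"
        by (simp add: set_integrable_def integrable_completion)
    qed
    with h have "Im (stieltjes_int k ?z) = (\<integral>t. \<phi> t * y / ((t - x)\<^sup>2 + y\<^sup>2) \<partial>lborel)"
      by (rule has_integral_unique)
    also have "\<dots> = \<bar>y\<bar> *\<^sub>R (\<integral>s. \<phi> (x + y * s) * y / ((x + y * s - x)\<^sup>2 + y\<^sup>2) \<partial>lborel)"
      using y by (intro lborel_integral_real_affine) auto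
    also have "\<dots> = (\<integral>s. y * (\<phi> (x + y * s) * y / ((x + y * s - x)\<^sup>2 + y\<^sup>2)) \<partial>lborel)"
      unfolding integral_mult_right_zero using y by simp
    also have "\<dots> = (\<integral>s. \<phi> (x + y * s) * inverse (1 + s\<^sup>2) \<partial>lborel)"
    proof (rule Bochner_Integration.integral_cong)
      fix s
      have "(x + y * s - x)\<^sup>2 + y\<^sup>2 = y * y * (1 + s\<^sup>2)" by (simp add: power2_eq_square algebra_simps)
      then show "y * (\<phi> (x + y * s) * y / ((x + y * s - x)\<^sup>2 + y\<^sup>2)) = \<phi> (x + y * s) * inverse (1 + s\<^sup>2)"
        using y by (simp only: inverse_eq_divide) simp
    qed auto
    finally show ?thesis .
  qed
  have UN: "einterval (-\<infinity>) \<infinity> = UNIV" by (auto simp: einterval_iff)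
  have I: "integrable lborel (\<lambda>s::real. inverse (1 + s\<^sup>2))"
    using integrable_inverse_1_plus_square unfolding UN by (simp add: set_integrable_def)
  have V: "(\<integral>s. inverse (1 + s\<^sup>2) \<partial>lborel) = pi"
    using LBINT_inverse_1_plus_square by (simp add: interval_lebesgue_integral_def UN
        set_lebesgue_integral_def)
  have "(\<lambda>n. \<integral>s. \<phi> (x + 1 / real (Suc n) * s) * inverse (1 + s\<^sup>2) \<partial>lborel)
          \<longlonglongrightarrow> (\<integral>s. \<phi> x * inverse (1 + s\<^sup>2) \<partial>lborel)"
  proof (rule integral_dominated_convergence[where w = "\<lambda>s. \<bar>B\<bar> * inverse (1 + s\<^sup>2)"])
    show "AE s in lborel. (\<lambda>n. \<phi> (x + 1 / real (Suc n) * s) * inverse (1 + s\<^sup>2)) \<longlonglongrightarrow> \<phi> x * inverse (1 + s\<^sup>2)"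
    proof (intro AE_I2 tendsto_mult tendsto_const isCont_tendsto_compose[OF contphi])
      fix s
      have "(\<lambda>n. 1 / real (Suc n) * s) \<longlonglongrightarrow> 0" by real_asymp
      from tendsto_add[OF tendsto_const[of x] this] show "(\<lambda>n. x + 1 / real (Suc n) * s) \<longlonglongrightarrow> x" by simp
    qed
    show "AE s in lborel. norm (\<phi> (x + 1 / real (Suc n) * s) * inverse (1 + s\<^sup>2)) \<le> \<bar>B\<bar> * inverse (1
        + s\<^sup>2)" for n
      using \<phi>B by (intro AE_I2) (auto simp: abs_mult intro!: mult_right_mono)
  qed (use I in auto)
  also have "(\<integral>s. \<phi> x * inverse (1 + s\<^sup>2) \<partial>lborel) = pi * gamma_weight k x"
    using x V by (simp add: \<phi>_def)
  finally show ?thesis by (subst eq) auto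
qed

lemma Im_stieltjes_ext_pos_axis:
  assumes k: "k \<ge> 1/2" and x: "x > 0"
  shows "Im (stieltjes_ext k (of_real x)) = pi * gamma_weight k x"
proof (rule LIMSEQ_unique)
  let ?z = "\<lambda>n. of_real x + \<i> * of_real (1 / real (Suc n))"
  have "isCont (stieltjes_ext k) (of_real x)"
    using stieltjes_ext_holomorphic[of k] k open_cutplane x by (intro holomorphic_on_imp_isCont)
        (auto simp: cutplane_def)
  moreover have "?z \<longlonglongrightarrow> of_real x"
  proof -
    have "(\<lambda>n. 1 / real (Suc n)) \<longlonglongrightarrow> 0" by real_asymp
    then have "?z \<longlonglongrightarrow> of_real x + \<i> * of_real 0" by (intro tendsto_intros)
    then show ?thesis by simp
  qed
  ultimately have "(\<lambda>n. Im (stieltjes_ext k (?z n))) \<longlonglongrightarrow> Im (stieltjes_ext k (of_real x))"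
    by (rule tendsto_Im[OF isCont_tendsto_compose])
  moreover have "stieltjes_ext k (?z n) = stieltjes_int k (?z n)" for n
    using k by (intro stieltjes_ext_uhp) (auto simp: upper_half_plane_def)
  ultimately show "(\<lambda>n. Im (stieltjes_int k (?z n))) \<longlonglongrightarrow> Im (stieltjes_ext k (of_real x))" by simp
qed (rule Im_stieltjes_limit[OF assms])

section \<open>The transform near infinity\<close>

text \<open>In the closed upper half-plane the modulus does not decrease along upward vertical segments. So negative
powers of the modulus are largest at the lower end, even if that end is close to the real axis.\<close>

lemma norm_ge_segment_up:
  assumes "Im z \<ge> 0" "w \<in> closed_segment z (z + \<i> * of_real d)" "d \<ge> 0"
  shows "Im w \<ge> Im z" "Re w = Re z" "norm w \<ge> norm z" "norm w \<le> norm z + d"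
proof -
  obtain u where u: "0 \<le> u" "u \<le> 1" "w = (1 - u) *\<^sub>R z + u *\<^sub>R (z + \<i> * of_real d)"
    using assms(2) by (auto simp: in_segment)
  then have w: "w = z + \<i> * of_real (u * d)" by (simp add: scaleR_conv_of_real algebra_simps)
  have 2: "Im w = Im z + u * d" unfolding w by simp
  show 1: "Re w = Re z" unfolding w by simp
  show 3: "Im w \<ge> Im z" using u(1) assms(3) unfolding 2 by simp
  have "(Im z)\<^sup>2 \<le> (Im w)\<^sup>2" using 3 assms by (intro power_mono) auto
  then show "norm w \<ge> norm z" using 1 by (simp add: cmod_def)
  have "norm w \<le> norm z + norm (\<i> * of_real (u * d))" unfolding w by (rule norm_triangle_ineq)
  also have "norm (\<i> * of_real (u * d)) = u * d" using u assms by (simp add: norm_mult)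
  also have "u * d \<le> d" using u assms by (simp add: mult_left_le_one_le)
  finally show "norm w \<le> norm z + d" by simp
qed

text \<open>At distance at least 1 from the real axis the kernel of the transform with \<open>k + 1\<close> is bounded by 1.\<close>

lemma stieltjes_bound_far:
  assumes k: "k > -1/2" and z: "Im z \<ge> 1"
  shows "norm (z * stieltjes_int k z) \<le> Gamma (k + 1/2) + Gamma (k + 3/2)"
proof -
  have zs: "z \<in> slit" using z by (auto simp: complex_nonneg_Reals_iff)
  have "norm (stieltjes_int (k + 1) z) \<le> 1 * Gamma (k + 1 + 1/2)"
    unfolding stieltjes_int_gamma_weight
  proof -
    have "norm (1 / (of_real t - z)) \<le> 1" if "t > 0" for t :: real
    proof -
      have "1 \<le> \<bar>Im (of_real t - z)\<bar>" using z by simp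
      also have "\<dots> \<le> norm (of_real t - z)" by (rule abs_Im_le_cmod)
      finally show ?thesis using slit_neq[OF zs that] by (simp add: norm_divide)
    qed
    then show "norm (integral {0<..} (\<lambda>t. complex_of_real (gamma_weight (k + 1) t) / (of_real t -
        z))) \<le> 1 * Gamma (k + 1 + 1/2)"
      using gamma_weight_mult_integral_bound[of "k + 1" "\<lambda>t. 1 / (of_real t - z)" 1]
          cauchy_kernel_continuous(1)[OF zs] k
      by simp
  qed
  moreover have "z * stieltjes_int k z = stieltjes_int (k + 1) z - of_real (Gamma (k + 1/2))"
    using stieltjes_int_add1[OF k zs] by (simp add: algebra_simps)
  moreover have "norm (complex_of_real (Gamma (k + 1/2))) = Gamma (k + 1/2)"
    using k Gamma_real_pos[of "k + 1/2"] by simp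
  ultimately show ?thesis
    using norm_triangle_ineq4[of "stieltjes_int (k + 1) z" "of_real (Gamma (k + 1/2))"]
    by (simp add: add.commute)
qed

text \<open>The integral does not show that the transform is small near the positive axis. Moving up by 1 along a
vertical segment, on which the derivative of the primitive is explicit, reduces the estimate to points
with imaginary part at least 1; the factors \<open>e^z\<close> cancel because the real part is constant on the
segment.\<close>

lemma stieltjes_step:
  assumes k: "k \<ge> 1/2" and z: "z \<in> upper_half_plane"
  shows "norm (stieltjes_int k z) \<le> norm (stieltjes_int k (z + \<i>)) + Gamma (k + 1/2) / norm z"
proof -
  have z': "z + \<i> \<in> upper_half_plane" and z0: "z \<noteq> 0" "z + \<i> \<noteq> 0" and Imz: "Im z \<ge> 0"
    using z by (auto simp: upper_half_plane_def complex_eq_iff)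
  let ?S = "closed_segment z (z + \<i> * of_real 1)"
  have seg: "w \<in> upper_half_plane" "Re w = Re z" "norm w \<ge> norm z" if "w \<in> ?S" for w
    using norm_ge_segment_up[OF Imz that] z by (auto simp: upper_half_plane_def)
  have G: "Gamma (k + 1/2) > 0" using k by (intro Gamma_real_pos) auto
  have nz: "norm z > 0" using z0 by simp
  let ?a = "k - 1/2"
  have S: "norm (gamma_prim k w) = exp (Re w) * norm w powr (- ?a) * norm (stieltjes_int k w) / pi"
    if "w \<in> upper_half_plane" for w
  proof -
    have "w \<noteq> 0" using that by (auto simp: upper_half_plane_def)
    have "norm (exp (w - of_real ?a * Ln_up w)) = exp (Re w) * norm w powr (- ?a)"
      using norm_exp_Ln_up[OF \<open>w \<noteq> 0\<close>, of w "- ?a"] by (simp only: of_real_minus mult_minus_left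
          add_uminus_conv_diff)
    moreover have "gamma_prim k w = exp (w - of_real ?a * Ln_up w) * stieltjes_int k w / of_real pi"
      using gamma_prim(2)[of k w] k that by simp
    ultimately show ?thesis by (simp add: norm_mult norm_divide)
  qed
  have "norm (gamma_prim k z - gamma_prim k (z + \<i>)) \<le> Gamma (k + 1/2) / pi * exp (Re z) * norm z
      powr (- (k + 1/2)) * norm (z - (z + \<i>))"
  proof (rule field_differentiable_bound[where S = ?S])
    show "convex ?S" by simp
    show "(gamma_prim k has_field_derivative gamma_prim_deriv k w) (at w within ?S)" if "w \<in> ?S" for w
      using gamma_prim(1)[of k w] seg(1)[OF that] uhp_subset k by (auto intro:
          has_field_derivative_at_within)
    show "norm (gamma_prim_deriv k w) \<le> Gamma (k + 1/2) / pi * exp (Re z) * norm z powr (- (k +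
        1/2))" if "w \<in> ?S" for w
    proof -
      have w0: "w \<noteq> 0" using seg[OF that] nz by auto
      have "norm (gamma_prim_deriv k w) = Gamma (k + 1/2) / pi * (exp (Re w) * norm w powr (- (k + 1/2)))"
        using norm_exp_Ln_up[OF w0, of w "- (k + 1/2)"] G
        by (simp only: gamma_prim_deriv_def norm_mult norm_minus_cancel norm_of_real of_real_minus
            mult_minus_left add_uminus_conv_diff) simp
      also have "\<dots> \<le> Gamma (k + 1/2) / pi * (exp (Re w) * norm z powr (- (k + 1/2)))"
        using seg[OF that] nz k G by (intro mult_left_mono powr_mono2') auto
      finally show ?thesis using seg(2)[OF that] by (simp only: mult.assoc)
    qed
  qed auto
  then have K: "norm (gamma_prim k z) \<le> norm (gamma_prim k (z + \<i>)) + Gamma (k + 1/2) / pi * exp (Re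
      z) * norm z powr (- (k + 1/2))"
    using norm_triangle_ineq2[of "gamma_prim k z" "gamma_prim k (z + \<i>)"] by simp
  have "norm (z + \<i>) \<ge> norm z" using norm_ge_segment_up(3)[OF Imz, of "z + \<i>" 1] by simp
  then have "norm (z + \<i>) powr (- ?a) \<le> norm z powr (- ?a)"
    using nz k by (intro powr_mono2') auto
  then have "exp (Re z) * norm (z + \<i>) powr (- ?a) * norm (stieltjes_int k (z + \<i>)) / pi
    \<le> exp (Re z) * norm z powr (- ?a) * norm (stieltjes_int k (z + \<i>)) / pi"
    by (intro divide_right_mono mult_right_mono mult_left_mono) auto
  moreover have "norm z powr (- (k + 1/2)) = norm z powr (- ?a) / norm z"
  proof -
    have "norm z powr (- (k + 1/2)) = norm z powr (- ?a - 1)" by (rule arg_cong[of _ _ "\<lambda>c. norm z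
        powr c"]) simp
    then show ?thesis using nz by (simp only: powr_diff powr_one norm_ge_zero)
  qed
  moreover define e where "e = exp (Re z) * norm z powr (- ?a) / pi"
  ultimately have "e * norm (stieltjes_int k z) \<le> e * norm (stieltjes_int k (z + \<i>)) + e * (Gamma (k
      + 1/2) / norm z)"
    using K unfolding S[OF z] S[OF z'] by (simp add: mult_ac)
  moreover have "e > 0" using nz by (simp add: e_def)
  ultimately show ?thesis by (simp only: flip: distrib_left) (simp only: mult_le_cancel_left_pos)
qed

lemma stieltjes_bound:
  assumes k: "k \<ge> 1/2" and z: "z \<in> upper_half_plane"
  shows "norm (stieltjes_int k z) \<le> (2 * Gamma (k + 1/2) + Gamma (k + 3/2)) / norm z"
proof -
  have Imz: "Im z > 0" and nz: "norm z > 0" using z by (auto simp: upper_half_plane_def)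
  have "norm (z + \<i>) \<ge> norm z" using norm_ge_segment_up(3)[of z "z + \<i>" 1] Imz by simp
  then have "norm z * norm (stieltjes_int k (z + \<i>)) \<le> norm (z + \<i>) * norm (stieltjes_int k (z + \<i>))"
    by (intro mult_right_mono) auto
  also have "\<dots> \<le> Gamma (k + 1/2) + Gamma (k + 3/2)"
    using stieltjes_bound_far[of k "z + \<i>"] Imz k by (simp add: norm_mult)
  finally have "norm (stieltjes_int k (z + \<i>)) \<le> (Gamma (k + 1/2) + Gamma (k + 3/2)) / norm z"
    using nz by (simp add: field_simps)
  then show ?thesis using stieltjes_step[OF assms] by (simp add: add_divide_distrib)
qed

text \<open>The left side is the transform with \<open>k + 1\<close>, so the bound for that one applies.\<close>

lemma z_stieltjes_asymp:
  assumes k: "k > -1/2"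
  obtains C where "C > 0" "\<And>z. z \<in> upper_half_plane \<Longrightarrow> 
     norm (z * stieltjes_int k z + of_real (Gamma (k + 1/2))) \<le> C / norm z"
proof -
  have "2 * Gamma (k + 1 + 1/2) + Gamma (k + 1 + 3/2) > 0"
    using k Gamma_real_pos[of "k + 1 + 1/2"] Gamma_real_pos[of "k + 1 + 3/2"] by linarith
  moreover have "norm (z * stieltjes_int k z + of_real (Gamma (k + 1/2))) \<le> (2 * Gamma (k + 1 + 1/2)
      + Gamma (k + 1 + 3/2)) / norm z"
    if "z \<in> upper_half_plane" for z
    using stieltjes_bound[of "k + 1" z] stieltjes_int_add1[OF k, of z] upper_half_plane_slit that k by auto
  ultimately show ?thesis using that by blast
qed

section \<open>The transform near 0\<close>

lemma norm_exp_minus_1_le: "norm (z::complex) \<le> 1 \<Longrightarrow> norm (exp z - 1) \<le> exp 1 * norm z"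
proof -
  assume z: "norm z \<le> 1"
  have "norm (exp z - exp 0) \<le> exp 1 * norm (z - 0)"
  proof (rule field_differentiable_bound[where S = "cball 0 1"])
    show "(exp has_field_derivative exp w) (at w within cball 0 1)" for w :: complex
      by (auto intro!: derivative_eq_intros)
    show "norm (exp w) \<le> exp 1" if "w \<in> cball 0 1" for w :: complex
      using that complex_Re_le_cmod[of w] by (simp add: norm_exp_eq_Re)
  qed (use z in auto)
  then show ?thesis by simp
qed

text \<open>Let \<open>a = k - 1/2\<close>. Subtracting \<open>Gamma a / pi * z^(-a)\<close> from the primitive leaves a function \<open>M\<close> whose
derivative is \<open>O(|z|^(-a))\<close> instead of \<open>O(|z|^(-a-1))\<close>. On a vertical segment of length \<open>\<delta>\<close> this changes
\<open>|z|^a |M|\<close> by \<open>O(\<delta>)\<close>, and at the upper end of the segment \<open>M\<close> stays bounded as \<open>z\<close> tends to 0.\<close>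

lemma stieltjes_limit_0:
  assumes k: "k > 1/2"
  shows "(stieltjes_int k \<longlongrightarrow> of_real (Gamma (k - 1/2))) (at 0 within upper_half_plane)"
proof -
  define a where "a = k - 1/2"
  have a: "a > 0" using k by (simp add: a_def)
  define G where "G = Gamma a"
  have G: "G > 0" using a by (simp add: G_def Gamma_real_pos)
  have Ga: "Gamma (k + 1/2) = a * G"
    using Gamma_plus1[of a] a by (simp add: a_def G_def add.commute nonpos_Ints_def)
  \<comment> \<open>subtract the leading term of the primitive at 0\<close>
  define M where "M z = gamma_prim k z - of_real (G / pi) * exp (- of_real a * Ln_up z)" for z
  define C where "C = a * G / pi * exp 1"
  have C: "C > 0" using a G by (simp add: C_def)
  have n1: "norm (complex_of_real (a * G / pi)) = a * G / pi"
    using a G by (simp only: norm_of_real) simp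
  have dM: "(M has_field_derivative (of_real (a * G / pi) * exp (- of_real (a + 1) * Ln_up z) * (1 -
      exp z))) (at z)"
    if z: "z \<in> cutplane" for z
  proof -
    have z0: "z \<noteq> 0" using z by (auto simp: cutplane_def)
    have e: "exp (- of_real (a + 1) * Ln_up z) = exp (- of_real a * Ln_up z) / z"
    proof -
      have "- of_real (a + 1) * Ln_up z = - of_real a * Ln_up z - Ln_up z" by (simp add: algebra_simps)
      then show ?thesis by (simp only: exp_diff exp_Ln_up[OF z0])
    qed
    have "gamma_prim_deriv k z = - of_real (a * G / pi) * exp (z + (- of_real (a + 1) * Ln_up z))"
    proof -
      have "z - of_real (k + 1/2) * Ln_up z = z + (- of_real (a + 1) * Ln_up z)" by (simp add: a_def
          algebra_simps)
      then show ?thesis unfolding gamma_prim_deriv_def Ga by (simp only: mult_minus_left)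
    qed
    also have "\<dots> = - of_real (a * G / pi) * (exp z * (exp (- of_real a * Ln_up z) / z))"
      by (simp only: exp_add e)
    finally have gamma_prim_deriv: "gamma_prim_deriv k z = - of_real (a * G / pi) * (exp z * (exp (-
        of_real a * Ln_up z) / z))" .
    have "(M has_field_derivative (gamma_prim_deriv k z - of_real (G / pi) * (exp (- of_real a *
        Ln_up z) * (- of_real a * (1 / z))))) (at z)"
      unfolding M_def using z k by (auto intro!: derivative_eq_intros gamma_prim(1) simp: mult_ac)
    also have "gamma_prim_deriv k z - of_real (G / pi) * (exp (- of_real a * Ln_up z) * (- of_real a
        * (1 / z))) = 
       of_real (a * G / pi) * exp (- of_real (a + 1) * Ln_up z) * (1 - exp z)"
    proof -
      have "complex_of_real (a * G / pi) = of_real (G / pi) * of_real a" by simp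
      then show ?thesis unfolding gamma_prim_deriv e by (simp only:) (simp add: algebra_simps
          diff_divide_distrib)
    qed
    finally show ?thesis .
  qed
  have bM: "norm z powr a * norm (M z) \<le> norm z powr a * norm (M (z + \<i> * of_real d)) + C * d"
    if z: "z \<in> upper_half_plane" "norm z < 1/2" and d: "0 < d" "d \<le> 1/2" for z d
  proof -
    have nz: "norm z > 0" using z by (auto simp: upper_half_plane_def)
    have Imz: "Im z \<ge> 0" using z by (auto simp: upper_half_plane_def)
    let ?S = "closed_segment z (z + \<i> * of_real d)"
    note seg = norm_ge_segment_up[OF Imz _ less_imp_le[OF d(1)]]
    have "norm (M z - M (z + \<i> * of_real d)) \<le> C * norm z powr (- a) * norm (z - (z + \<i> * of_real d))"
    proof (rule field_differentiable_bound[where S = ?S])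
      fix w assume w: "w \<in> ?S"
      have w0: "w \<noteq> 0" using seg[OF w] nz by auto
      have "w \<in> upper_half_plane" using seg[OF w] z by (auto simp: upper_half_plane_def)
      then show "(M has_field_derivative (of_real (a * G / pi) * exp (- of_real (a + 1) * Ln_up w) *
          (1 - exp w))) (at w within ?S)"
        using dM[of w] uhp_subset by (auto intro: has_field_derivative_at_within)
      have "norm w \<le> 1" using seg(4)[OF w] z d by simp
      then have "norm (1 - exp w) \<le> exp 1 * norm w"
        using norm_exp_minus_1_le[of w] by (simp add: norm_minus_commute)
      moreover have "norm (exp (- of_real (a + 1) * Ln_up w)) = norm w powr (- (a + 1))"
        using norm_exp_Ln_up[OF w0, of 0 "- (a + 1)"] by simp
      ultimately have "norm (of_real (a * G / pi) * exp (- of_real (a + 1) * Ln_up w) * (1 - exp w))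
          \<le> (a * G / pi) * norm w powr (- (a + 1)) * (exp 1 * norm w)"
        unfolding norm_mult n1 using a G by (intro mult_mono) auto
      also have "\<dots> = C * (norm w powr (- (a + 1)) * norm w)" by (simp add: C_def)
      also have "norm w powr (- (a + 1)) * norm w = norm w powr (- a)"
        using powr_mult_base[of "norm w" "- (a + 1)"] by (simp add: mult.commute)
      also have "norm w powr (- a) \<le> norm z powr (- a)"
        using seg[OF w] nz a by (intro powr_mono2') auto
      finally show "norm (of_real (a * G / pi) * exp (- of_real (a + 1) * Ln_up w) * (1 - exp w)) \<le>
          C * norm z powr (- a)"
        using C by simp
    qed auto
    also have "norm (z - (z + \<i> * of_real d)) = d" using d by (simp add: norm_mult)
    finally have "norm (M z) \<le> norm (M (z + \<i> * of_real d)) + C * norm z powr (- a) * d"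
      using norm_triangle_ineq2[of "M z" "M (z + \<i> * of_real d)"] by simp
    then have "norm z powr a * norm (M z) \<le> norm z powr a * (norm (M (z + \<i> * of_real d)) + C * norm
        z powr (- a) * d)"
      by (intro mult_left_mono) auto
    also have "\<dots> = norm z powr a * norm (M (z + \<i> * of_real d)) + C * d"
      using nz by (simp add: algebra_simps powr_minus field_simps)
    finally show ?thesis .
  qed
  let ?F = "at 0 within upper_half_plane"
  have powr0: "((\<lambda>z. norm z powr a) \<longlongrightarrow> 0) ?F"
  proof -
    have "((\<lambda>z::complex. norm z powr a) \<longlongrightarrow> norm (0::complex) powr a) ?F"
      using a by (intro tendsto_powr2 tendsto_intros) auto
    then show ?thesis using a by simp
  qed
  have inU: "eventually (\<lambda>z. z \<in> upper_half_plane) ?F" by (simp add: eventually_at_filter)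
  have small: "eventually (\<lambda>z. norm z < 1/2) ?F"
    by (rule order_tendstoD[OF tendsto_norm_zero[OF tendsto_ident_at]]) auto
  have lim1: "((\<lambda>z. norm z powr a * norm (M z)) \<longlongrightarrow> 0) ?F"
    unfolding tendsto_iff
  proof (intro allI impI)
    fix e :: real assume e: "e > 0"
    \<comment> \<open>chosen so that moving up by \<open>d\<close> costs at most \<open>e / 2\<close>\<close>
    define d where "d = min (1/2) (e / (2 * C))"
    have d: "0 < d" "d \<le> 1/2" using e C by (auto simp: d_def)
    have "C * d \<le> C * (e / (2 * C))" using C by (intro mult_left_mono) (auto simp: d_def)
    then have Cd: "C * d \<le> e / 2" using C by simp
    have "isCont M (\<i> * of_real d)"
      using dM[of "\<i> * of_real d"] d DERIV_isCont by (auto simp: cutplane_def)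
    moreover have "((\<lambda>z. z + \<i> * of_real d) \<longlongrightarrow> 0 + \<i> * of_real d) ?F" by (intro tendsto_intros)
    ultimately have "((\<lambda>z. M (z + \<i> * of_real d)) \<longlongrightarrow> M (\<i> * of_real d)) ?F"
      using isCont_tendsto_compose[of "\<i> * of_real d" M] by simp
    from tendsto_mult[OF powr0 tendsto_norm[OF this]]
    have "((\<lambda>z. norm z powr a * norm (M (z + \<i> * of_real d))) \<longlongrightarrow> 0) ?F" by simp
    then have "eventually (\<lambda>z. norm z powr a * norm (M (z + \<i> * of_real d)) < e / 2) ?F"
      using e by (intro order_tendstoD) auto
    then show "eventually (\<lambda>z. dist (norm z powr a * norm (M z)) 0 < e) ?F"
      using inU small 
      by eventually_elim (use bM d Cd in \<open>fastforce simp: dist_norm\<close>)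
  qed
  have lim2: "((\<lambda>z. exp (of_real a * Ln_up z) * M z) \<longlongrightarrow> 0) ?F"
  proof (rule tendsto_norm_zero_cancel)
    have "eventually (\<lambda>z. norm (exp (of_real a * Ln_up z) * M z) = norm z powr a * norm (M z)) ?F"
      using inU
    proof eventually_elim
      case (elim z)
      then have "z \<noteq> 0" by (auto simp: upper_half_plane_def)
      then show ?case using norm_exp_Ln_up[of z 0 a] by (simp add: norm_mult)
    qed
    then show "((\<lambda>z. norm (exp (of_real a * Ln_up z) * M z)) \<longlongrightarrow> 0) ?F"
      using lim1 by (simp cong: tendsto_cong)
  qed
  have "((\<lambda>z. exp (- z) * (of_real pi * (exp (of_real a * Ln_up z) * M z) + of_real G)) \<longlongrightarrow> exp (- 0)
      * (of_real pi * 0 + of_real G)) ?F"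
    by (intro tendsto_intros lim2)
  moreover have "eventually (\<lambda>z. exp (- z) * (of_real pi * (exp (of_real a * Ln_up z) * M z) +
      of_real G) = stieltjes_int k z) ?F"
    using inU
  proof eventually_elim
    case (elim z)
    have "stieltjes_int k z = of_real pi * exp (of_real a * Ln_up z - z) * gamma_prim k z"
      using stieltjes_ext_uhp[of k z] elim k by (simp add: stieltjes_ext_def a_def)
    also have "\<dots> = exp (- z) * (of_real pi * (exp (of_real a * Ln_up z) * M z) + of_real G * (exp
        (of_real a * Ln_up z) * exp (- of_real a * Ln_up z)))"
      by (simp add: M_def exp_diff exp_minus field_simps)
    also have "exp (of_real a * Ln_up z) * exp (- of_real a * Ln_up z) = 1" by (simp add: exp_minus)
    finally show ?case by simp
  qed
  ultimately show ?thesis by (simp add: G_def a_def tendsto_cong)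
qed

section \<open>The explicit map and its injectivity\<close>

definition explicit_map :: "real \<Rightarrow> complex \<Rightarrow> complex" where
  "explicit_map k z = z - of_real (k - 1/2) * (Ln_up z - \<i> * of_real pi) + Ln (stieltjes_ext k z /
      of_real pi)"

lemma explicit_map_uhp:
  assumes "k > 1/2" "z \<in> upper_half_plane"
  shows "explicit_map k z = z - of_real (k - 1/2) * Ln (- z) + Ln (of_real (1 / pi) * stieltjes_int k z)"
  using assms by (simp add: explicit_map_def Ln_uminus_Ln_up stieltjes_ext_uhp)

lemma closed_uhp0_cases:
  assumes "z \<in> closed_uhp0"
  obtains "z \<in> upper_half_plane" | x where "x > 0" "z = of_real x" | x where "x > 0" "z = - of_real x"
proof (cases "Im z > 0")
  case False
  then have "Im z = 0" "Re z \<noteq> 0" using assms by (auto simp: complex_eq_iff)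
  then show ?thesis using that(2)[of "Re z"] that(3)[of "- Re z"] by (cases "Re z > 0") (auto simp:
      complex_eq_iff)
qed (use that in \<open>simp add: upper_half_plane_def\<close>)

text \<open>An open set around the closed half-plane without 0 on which the formula for the map is holomorphic. It is
needed at points of the real axis.\<close>

definition ext_dom :: "real \<Rightarrow> complex set" where
  "ext_dom k = {z \<in> cutplane. stieltjes_ext k z \<notin> \<real>\<^sub>\<le>\<^sub>0}"

lemma closed_uhp0_ext_dom:
  assumes "k > 1/2"
  shows "closed_uhp0 \<subseteq> ext_dom k"
proof
  fix z assume z: "z \<in> closed_uhp0"
  have "stieltjes_ext k z \<notin> \<real>\<^sub>\<le>\<^sub>0"
    using z
  proof (cases rule: closed_uhp0_cases)
    case 1
    then show ?thesis using Im_stieltjes_pos[of k z] assms by (auto simp: stieltjes_ext_uhp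
        complex_nonpos_Reals_iff)
  next
    case (2 x)
    then show ?thesis using Im_stieltjes_ext_pos_axis[of k x] assms gamma_weight_pos[of x k] by
        (auto simp: complex_nonpos_Reals_iff)
  next
    case (3 x)
    then show ?thesis using stieltjes_neg_axis[of k x] assms by (auto simp: stieltjes_ext_neg
        complex_nonpos_Reals_iff)
  qed
  then show "z \<in> ext_dom k" using z uhp_subset by (auto simp: ext_dom_def)
qed

lemma open_ext_dom:
  assumes "k > 1/2"
  shows "open (ext_dom k)"
proof -
  have "ext_dom k = stieltjes_ext k -` (- \<real>\<^sub>\<le>\<^sub>0) \<inter> cutplane" by (auto simp: ext_dom_def)
  moreover have "open (- (\<real>\<^sub>\<le>\<^sub>0 :: complex set))" by (auto intro: closed_nonpos_Reals_complex)
  ultimately show ?thesis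
    using continuous_open_preimage[OF holomorphic_on_imp_continuous_on[OF stieltjes_ext_holomorphic]
        open_cutplane, of k] assms
    by (auto simp: Int_commute)
qed

lemma explicit_map_holomorphic_ext:
  assumes "k > 1/2"
  shows "explicit_map k holomorphic_on ext_dom k"
proof -
  have "stieltjes_ext k z / of_real pi \<notin> \<real>\<^sub>\<le>\<^sub>0" if "z \<in> ext_dom k" for z
    using that pi_gt_zero by (auto simp: ext_dom_def complex_nonpos_Reals_iff divide_le_0_iff simp
        flip: not_less)
  moreover have "stieltjes_ext k holomorphic_on ext_dom k"
    using assms by (intro holomorphic_on_subset[OF stieltjes_ext_holomorphic]) (auto simp: ext_dom_def)
  ultimately show ?thesis unfolding explicit_map_def
    by (intro holomorphic_intros) (auto simp: ext_dom_def)
qed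

lemma explicit_map_continuous_on: "k > 1/2 \<Longrightarrow> continuous_on closed_uhp0 (explicit_map k)"
  by (rule continuous_on_subset[OF holomorphic_on_imp_continuous_on[OF explicit_map_holomorphic_ext]
      closed_uhp0_ext_dom])

lemma explicit_map_holomorphic: "k > 1/2 \<Longrightarrow> explicit_map k holomorphic_on upper_half_plane"
  by (rule holomorphic_on_subset[OF explicit_map_holomorphic_ext order_trans[OF uhp_subset(1)
      closed_uhp0_ext_dom]])

lemma explicit_map_has_derivative:
  assumes k: "k > 1/2" and z: "z \<in> upper_half_plane"
  shows "(explicit_map k has_field_derivative (- of_real (Gamma (k + 1/2)) / (z * stieltjes_int k
      z))) (at z)"
proof -
  have zs: "z \<in> slit" "z \<in> cutplane" and z0: "z \<noteq> 0"
    using z upper_half_plane_slit uhp_subset by (auto simp: upper_half_plane_def)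
  obtain D where D: "(stieltjes_int k has_field_derivative D) (at z)"
    "z * D + (z - of_real (k - 1/2)) * stieltjes_int k z = - of_real (Gamma (k + 1/2))"
    using stieltjes_int_ode[OF _ zs(1), of k] k by auto
  have S: "Im (stieltjes_int k z) > 0" using Im_stieltjes_pos[of k z] k z by simp
  then have S0: "stieltjes_int k z \<noteq> 0" by auto
  have nr: "stieltjes_int k z / of_real pi \<notin> \<real>\<^sub>\<le>\<^sub>0" using S by (auto simp: complex_nonpos_Reals_iff)
  let ?h = "\<lambda>z. z - of_real (k - 1/2) * (Ln_up z - \<i> * of_real pi) + Ln (stieltjes_int k z / of_real pi)"
  have "(?h has_field_derivative (1 - of_real (k - 1/2) * (1 / z) + (D / of_real pi) /
      (stieltjes_int k z / of_real pi))) (at z)"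
    using zs z0 nr by (auto intro!: derivative_eq_intros D(1) simp: field_simps)
  also have "1 - of_real (k - 1/2) * (1 / z) + (D / of_real pi) / (stieltjes_int k z / of_real pi)
      = (z * D + (z - of_real (k - 1/2)) * stieltjes_int k z) / (z * stieltjes_int k z)"
    using z0 S0 by (simp add: divide_simps)
  finally have "(?h has_field_derivative - of_real (Gamma (k + 1/2)) / (z * stieltjes_int k z)) (at z)"
    unfolding D(2) .
  then show ?thesis
    by (rule has_field_derivative_transform_within_open[OF _ open_uhp z]) (use k in \<open>auto simp:
        explicit_map_def stieltjes_ext_uhp\<close>)
qed

lemma Im_deriv_explicit_map_pos:
  assumes k: "k > 1/2" and z: "z \<in> upper_half_plane"
  shows "Im (- of_real (Gamma (k + 1/2)) / (z * stieltjes_int k z)) > 0"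
proof -
  have "Im (z * stieltjes_int k z) > 0" "Gamma (k + 1/2) > 0"
    using Im_z_stieltjes_pos[of k z] k z by (auto intro!: Gamma_real_pos)
  moreover from this have "(Re (z * stieltjes_int k z))\<^sup>2 + (Im (z * stieltjes_int k z))\<^sup>2 > 0"
    by (intro add_nonneg_pos) auto
  ultimately show ?thesis unfolding Im_divide by (auto intro!: divide_pos_pos)
qed

text \<open>The criterion of Noshiro and Warschawski: along the segment from \<open>a\<close> to \<open>b\<close> the imaginary part of
\<open>f / (b - a)\<close> is strictly increasing.\<close>

lemma inj_on_Im_deriv_pos:
  assumes S: "convex S" and der: "\<And>z. z \<in> S \<Longrightarrow> (f has_field_derivative f' z) (at z)"
    and pos: "\<And>z. z \<in> S \<Longrightarrow> Im (f' z) > 0"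
  shows "inj_on f S"
proof (rule inj_onI, rule ccontr)
  fix a b assume ab: "a \<in> S" "b \<in> S" "f a = f b" "a \<noteq> b"
  define g where "g t = Im (f (a + of_real t * (b - a)) / (b - a))" for t :: real
  have "\<exists>y. (g has_real_derivative y) (at t) \<and> y > 0" if t: "0 \<le> t" "t \<le> 1" for t
  proof -
    let ?w = "a + of_real t * (b - a)"
    have "?w = (1 - t) *\<^sub>R a + t *\<^sub>R b" by (simp add: scaleR_conv_of_real algebra_simps)
    then have w: "?w \<in> S" using S ab t by (metis convexD_alt)
    have "((\<lambda>t. f (a + of_real t * (b - a)) / (b - a)) has_vector_derivative f' ?w) (at t)"
    proof (rule has_vector_derivative_real_field)
      show "((\<lambda>t. f (a + t * (b - a)) / (b - a)) has_field_derivative f' ?w) (at (of_real t))"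
      proof -
        have "((\<lambda>t. f (a + t * (b - a))) has_field_derivative f' ?w * (b - a)) (at (of_real t))"
          by (rule DERIV_chain2[where f = f and g = "\<lambda>t. a + t * (b - a)"])
             (auto intro!: derivative_eq_intros der[OF w])
        from DERIV_cdivide[OF this, of "b - a"] show ?thesis using ab(4) by simp
      qed
    qed
    then have "(g has_vector_derivative Im (f' ?w)) (at t)"
      unfolding g_def by (rule bounded_linear.has_vector_derivative[OF bounded_linear_Im])
    then show ?thesis using pos[OF w] by (auto simp: has_real_derivative_iff_has_vector_derivative)
  qed
  then have "g 0 < g 1" by (rule DERIV_pos_imp_increasing[OF zero_less_one])
  then show False using ab(3) by (simp add: g_def)
qed

lemma explicit_map_inj_on: "k > 1/2 \<Longrightarrow> inj_on (explicit_map k) upper_half_plane"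
  by (rule inj_on_Im_deriv_pos[OF convex_uhp explicit_map_has_derivative Im_deriv_explicit_map_pos])

lemma Im_Ln_stieltjes:
  assumes "k > 1/2" "z \<in> upper_half_plane"
  shows "0 < Im (Ln (of_real (1 / pi) * stieltjes_int k z))" "Im (Ln (of_real (1 / pi) *
      stieltjes_int k z)) < pi"
  using Im_Ln_pos_lt_imp[of "of_real (1 / pi) * stieltjes_int k z"] Im_stieltjes_pos[of k z] assms by auto

lemma Im_explicit_map_gt:
  assumes k: "k > 1/2" and z: "z \<in> upper_half_plane"
  shows "Im (explicit_map k z) > Im z" 
proof -
  have "(k - 1/2) * Im (Ln (- z)) < 0" using k Im_Ln_uminus[OF z] by (simp add: mult_pos_neg)
  then show ?thesis using Im_Ln_stieltjes[OF assms] z by (simp add: explicit_map_uhp[OF assms]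
      upper_half_plane_def)
qed

section \<open>The explicit map near infinity and near 0\<close>

text \<open>The part of the map that has a limit at infinity. Its boundary values are \<open>pi (rho k t - (k + 1/2))\<close> in
the imaginary part for \<open>t > 0\<close>, and 0 for \<open>t < 0\<close>.\<close>

definition log_remainder :: "real \<Rightarrow> complex \<Rightarrow> complex" where
  "log_remainder k z = explicit_map k z - z + of_real (k + 1/2) * (Ln_up z - \<i> * of_real pi)"

text \<open>The two principal logarithms may be added because their imaginary parts lie in \<open>(-pi, 0)\<close> and \<open>(0, pi)\<close>.\<close>

lemma log_remainder_uhp:
  assumes k: "k > 1/2" and z: "z \<in> upper_half_plane"
  shows "log_remainder k z = Ln (- (z * stieltjes_int k z) / of_real pi)"
proof -
  let ?S = "of_real (1 / pi) * stieltjes_int k z"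
  have S: "?S \<noteq> 0" "z \<noteq> 0" using Im_stieltjes_pos[of k z] k z by (auto simp: upper_half_plane_def)
  have "log_remainder k z = Ln (- z) + Ln ?S"
    by (simp add: log_remainder_def explicit_map_uhp[OF assms] Ln_uminus_Ln_up[OF z] algebra_simps
        add_divide_distrib)
  also have "\<dots> = Ln (exp (Ln (- z) + Ln ?S))"
    using Im_Ln_uminus[OF z] Im_Ln_stieltjes[OF assms] by (intro Ln_exp[symmetric]) auto
  also have "exp (Ln (- z) + Ln ?S) = - (z * stieltjes_int k z) / of_real pi"
    using S by (simp add: exp_add exp_Ln)
  finally show ?thesis .
qed

abbreviation at_inf_uhp :: "complex filter" where "at_inf_uhp \<equiv> inf at_infinity (principal
    upper_half_plane)"
abbreviation at_0_uhp :: "complex filter" where "at_0_uhp \<equiv> at 0 within upper_half_plane"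

lemma at_inf_uhp_at_infinity: "filterlim (\<lambda>z. z) at_infinity at_inf_uhp"
  by (simp add: filterlim_def)

lemma at_inf_uhp_norm: "filterlim norm at_top at_inf_uhp"
  using filterlim_norm_at_top by (rule filterlim_mono) auto

lemma eventually_uhp_at_inf: "eventually (\<lambda>z. z \<in> upper_half_plane) at_inf_uhp"
  by (simp add: eventually_inf_principal)

lemma eventually_uhp_at_0: "eventually (\<lambda>z. z \<in> upper_half_plane) at_0_uhp"
  by (simp add: eventually_at_filter)

lemma log_remainder_limit_infinity:
  assumes k: "k > 1/2"
  shows "(log_remainder k \<longlongrightarrow> of_real (ln (Gamma (k + 1/2) / pi))) at_inf_uhp"
proof -
  obtain C where C: "C > 0" "\<And>z. z \<in> upper_half_plane \<Longrightarrow> 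
     norm (z * stieltjes_int k z + of_real (Gamma (k + 1/2))) \<le> C / norm z"
    using z_stieltjes_asymp[of k] k by auto
  have G: "Gamma (k + 1/2) / pi > 0" using k by (intro divide_pos_pos Gamma_real_pos) auto
  have "((\<lambda>z. z * stieltjes_int k z + of_real (Gamma (k + 1/2))) \<longlongrightarrow> 0) at_inf_uhp"
  proof (rule Lim_null_comparison)
    show "eventually (\<lambda>z. norm (z * stieltjes_int k z + of_real (Gamma (k + 1/2))) \<le> C / norm z) at_inf_uhp"
      using eventually_uhp_at_inf by eventually_elim (rule C(2))
    show "((\<lambda>z. C / norm z) \<longlongrightarrow> 0) at_inf_uhp"
      by (rule real_tendsto_divide_at_top[OF tendsto_const at_inf_uhp_norm])
  qed
  then have "((\<lambda>z. (of_real (Gamma (k + 1/2)) - (z * stieltjes_int k z + of_real (Gamma (k + 1/2))))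
      / of_real pi) 
       \<longlongrightarrow> (of_real (Gamma (k + 1/2)) - 0) / of_real pi) at_inf_uhp"
    by (intro tendsto_intros) auto
  then have "((\<lambda>z. Ln (- (z * stieltjes_int k z) / of_real pi)) \<longlongrightarrow> Ln (of_real (Gamma (k + 1/2) /
      pi))) at_inf_uhp"
    using G by (intro tendsto_Ln) (auto simp: complex_nonpos_Reals_iff)
  also have "Ln (of_real (Gamma (k + 1/2) / pi)) = of_real (ln (Gamma (k + 1/2) / pi))"
    using G by (rule Ln_of_real)
  finally show ?thesis
    by (rule Lim_transform_eventually) (use eventually_uhp_at_inf in eventually_elim, simp add:
        log_remainder_uhp[OF k])
qed

lemma explicit_map_log_remainder: "explicit_map k z = z - of_real (k + 1/2) * (Ln_up z - \<i> * of_real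
    pi) + log_remainder k z"
  by (simp add: log_remainder_def)

lemma Ln_up_over_z: "((\<lambda>z. (Ln_up z - \<i> * of_real pi) / z) \<longlongrightarrow> 0) at_inf_uhp"
proof (rule Lim_null_comparison)
  have "eventually (\<lambda>z. norm z > 1) at_inf_uhp" using at_inf_uhp_norm by (simp add: filterlim_at_top_dense)
  with eventually_uhp_at_inf show "eventually (\<lambda>z. norm ((Ln_up z - \<i> * of_real pi) / z) \<le> (ln (norm
      z) + pi) / norm z) at_inf_uhp"
  proof eventually_elim
    case (elim z)
    have "norm (Ln_up z - \<i> * of_real pi) \<le> \<bar>Re (Ln_up z - \<i> * of_real pi)\<bar> + \<bar>Im (Ln_up z - \<i> *
        of_real pi)\<bar>"
      by (rule cmod_le)
    also have "\<dots> \<le> ln (norm z) + pi"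
    proof (rule add_mono)
      have "z \<noteq> 0" using elim by auto
      then show "\<bar>Re (Ln_up z - \<i> * of_real pi)\<bar> \<le> ln (norm z)" using elim by (simp add: Re_Ln_up)
      show "\<bar>Im (Ln_up z - \<i> * of_real pi)\<bar> \<le> pi" using Im_Ln_up_strict[OF elim(1)] by simp
    qed
    finally show ?case by (simp add: norm_divide divide_right_mono)
  qed
  have "((\<lambda>r::real. (ln r + pi) / r) \<longlongrightarrow> 0) at_top" by real_asymp
  then show "((\<lambda>z. (ln (norm z) + pi) / norm z) \<longlongrightarrow> 0) at_inf_uhp"
    by (rule filterlim_compose) (rule at_inf_uhp_norm)
qed

lemma explicit_map_over_z:
  assumes k: "k > 1/2"
  shows "((\<lambda>z. explicit_map k z / z) \<longlongrightarrow> 1) at_inf_uhp"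
proof -
  have "((\<lambda>z. 1 - of_real (k + 1/2) * ((Ln_up z - \<i> * of_real pi) / z) + log_remainder k z / z) \<longlongrightarrow> 1
      - of_real (k + 1/2) * 0 + 0) at_inf_uhp"
    by (intro tendsto_intros Ln_up_over_z tendsto_divide_0[OF log_remainder_limit_infinity[OF k]]
        at_inf_uhp_at_infinity)
  then have "((\<lambda>z. 1 - of_real (k + 1/2) * ((Ln_up z - \<i> * of_real pi) / z) + log_remainder k z / z)
      \<longlongrightarrow> 1) at_inf_uhp" by simp
  then show ?thesis
  proof (rule Lim_transform_eventually)
    show "eventually (\<lambda>z. 1 - of_real (k + 1/2) * ((Ln_up z - \<i> * of_real pi) / z) + log_remainder k
        z / z = explicit_map k z / z) at_inf_uhp"
      using eventually_uhp_at_inf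
    proof eventually_elim
      case (elim z)
      then have "z \<noteq> 0" by (auto simp: upper_half_plane_def)
      then show ?case unfolding explicit_map_log_remainder by (simp add: add_divide_distrib
          diff_divide_distrib right_diff_distrib)
    qed
  qed
qed

lemma explicit_map_at_infinity:
  assumes k: "k > 1/2"
  shows "filterlim (explicit_map k) at_infinity at_inf_uhp"
proof -
  have "filterlim (\<lambda>z. explicit_map k z / z * z) at_infinity at_inf_uhp"
    by (rule tendsto_mult_filterlim_at_infinity[OF explicit_map_over_z[OF k] _ at_inf_uhp_at_infinity]) auto
  moreover have ev: "eventually (\<lambda>z. explicit_map k z / z * z = explicit_map k z) at_inf_uhp"
    using eventually_uhp_at_inf by eventually_elim (auto simp: upper_half_plane_def)
  ultimately show ?thesis using filterlim_cong[OF refl refl ev, of at_infinity] by blast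
qed

lemma x_cos_le_sin: "0 \<le> x \<Longrightarrow> x \<le> pi \<Longrightarrow> x * cos x \<le> sin (x::real)"
proof -
  assume x: "0 \<le> x" "x \<le> pi"
  have "sin 0 - 0 * cos 0 \<le> sin x - x * cos x"
  proof (rule DERIV_nonneg_imp_nondecreasing[OF x(1)])
    fix y assume y: "0 \<le> y" "y \<le> x"
    show "\<exists>d. ((\<lambda>x. sin x - x * cos x) has_real_derivative d) (at y) \<and> 0 \<le> d"
    proof (intro exI[of _ "y * sin y"] conjI)
      show "((\<lambda>x. sin x - x * cos x) has_real_derivative y * sin y) (at y)"
        by (auto intro!: derivative_eq_intros)
      show "0 \<le> y * sin y" using y x sin_ge_zero[of y] by simp
    qed
  qed
  then show ?thesis by simp
qed

text \<open>In polar form this is \<open>x cos x \<le> sin x\<close> for the argument \<open>x\<close>.\<close>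

lemma Ln_up_Re_Im:
  assumes "z \<in> upper_half_plane"
  shows "Im (Ln_up z) * Re z \<le> Im z"
proof -
  have z0: "z \<noteq> 0" using assms by (auto simp: upper_half_plane_def)
  have "Re z = norm z * cos (Im (Ln_up z))" "Im z = norm z * sin (Im (Ln_up z))"
    using exp_Ln_up[OF z0] Re_Ln_up[OF z0] z0 by (metis Re_exp exp_ln zero_less_norm_iff, metis
        Im_exp exp_ln zero_less_norm_iff)
  moreover have "Im (Ln_up z) * cos (Im (Ln_up z)) \<le> sin (Im (Ln_up z))"
    using Im_Ln_up_strict[OF assms] by (intro x_cos_le_sin) auto
  ultimately show ?thesis
    using mult_left_mono[of "Im (Ln_up z) * cos (Im (Ln_up z))" "sin (Im (Ln_up z))" "norm z"] by
        (simp add: mult_ac)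
qed

text \<open>If \<open>Re F > 0\<close> far out, then \<open>Re z\<close> exceeds \<open>(k + 1/2) ln |z|\<close> up to a constant, so it is large. Then the
argument of \<open>z\<close> is at most \<open>Im z / Re z\<close>, and \<open>Im F\<close>, which is \<open>Im z - (k + 1/2) (arg z - pi)\<close> up
to a null term, is almost \<open>(k + 1/2) pi\<close> or larger. This describes the approach to \<open>infty2 k\<close> above the
deleted set.\<close>

lemma explicit_map_infinity_right:
  assumes k: "k > 1/2" and e: "e > 0"
  shows "eventually (\<lambda>z. Re (explicit_map k z) > 0 \<longrightarrow> Im (explicit_map k z) > (k + 1/2) * pi - e) at_inf_uhp"
proof -
  define q where "q = ln (Gamma (k + 1/2) / pi)"
  have "eventually (\<lambda>z. dist (log_remainder k z) (of_real q) < min e 1) at_inf_uhp"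
    using log_remainder_limit_infinity[OF k] e unfolding tendsto_iff q_def by (meson
        less_numeral_extra(1) min_less_iff_conj)
  moreover have "eventually (\<lambda>z. (k + 1/2) * ln (norm z) > \<bar>q\<bar> + 1 + (k + 1/2)) at_inf_uhp"
  proof -
    have "filterlim (\<lambda>r. (k + 1/2) * ln r) at_top at_top" using k by real_asymp
    from filterlim_compose[OF this at_inf_uhp_norm] show ?thesis by (simp add: filterlim_at_top_dense)
  qed
  ultimately show ?thesis using eventually_uhp_at_inf
  proof eventually_elim
    case (elim z)
    show ?case
    proof
      assume R: "Re (explicit_map k z) > 0"
      have z0: "z \<noteq> 0" using elim by (auto simp: upper_half_plane_def)
      have "\<bar>Re (log_remainder k z - of_real q)\<bar> \<le> norm (log_remainder k z - of_real q)" "\<bar>Im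
          (log_remainder k z - of_real q)\<bar> \<le> norm (log_remainder k z - of_real q)"
        by (rule abs_Re_le_cmod, rule abs_Im_le_cmod)
      then have Q: "Re (log_remainder k z) \<le> \<bar>q\<bar> + 1" "\<bar>Im (log_remainder k z)\<bar> < e" using elim by
          (auto simp: dist_norm)
      have "Re (explicit_map k z) = Re z - (k + 1/2) * ln (norm z) + Re (log_remainder k z)"
        unfolding explicit_map_log_remainder by (simp add: Re_Ln_up[OF z0])
      then have Rz: "Re z \<ge> k + 1/2" using R Q elim by linarith
      have "(k + 1/2) * Im (Ln_up z) \<le> Im (Ln_up z) * Re z"
        using Rz Im_Ln_up_strict[OF elim(3)] by (simp add: mult.commute mult_left_mono)
      also have "\<dots> \<le> Im z" by (rule Ln_up_Re_Im[OF elim(3)])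
      finally have "(k + 1/2) * Im (Ln_up z) \<le> Im z" .
      moreover have "Im (explicit_map k z) = Im z - (k + 1/2) * Im (Ln_up z) + (k + 1/2) * pi + Im
          (log_remainder k z)"
        unfolding explicit_map_log_remainder by (simp add: algebra_simps)
      ultimately show "Im (explicit_map k z) > (k + 1/2) * pi - e" using Q by linarith
    qed
  qed
qed

lemma Ln_stieltjes_zero:
  assumes k: "k > 1/2"
  shows "((\<lambda>z. Ln (of_real (1 / pi) * stieltjes_int k z)) \<longlongrightarrow> of_real (ln (Gamma (k - 1/2) / pi))) at_0_uhp"
proof -
  have G: "Gamma (k - 1/2) / pi > 0" using k by (intro divide_pos_pos Gamma_real_pos) auto
  have "((\<lambda>z. Ln (of_real (1 / pi) * stieltjes_int k z)) \<longlongrightarrow> Ln (of_real (1 / pi) * of_real (Gamma (k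
      - 1/2)))) at_0_uhp"
    using G by (intro tendsto_Ln tendsto_intros stieltjes_limit_0[OF k]) (auto simp:
        complex_nonpos_Reals_iff)
  also have "of_real (1 / pi) * of_real (Gamma (k - 1/2)) = complex_of_real (Gamma (k - 1/2) / pi)" by simp
  also have "Ln \<dots> = of_real (ln (Gamma (k - 1/2) / pi))" using G by (rule Ln_of_real)
  finally show ?thesis .
qed

lemma at_0_uhp_norm: "filterlim norm (at_right 0) at_0_uhp"
  unfolding filterlim_at using eventually_uhp_at_0
  by (auto intro!: tendsto_norm_zero tendsto_ident_at elim!: eventually_mono simp: upper_half_plane_def)

lemma explicit_map_zero_Re:
  assumes k: "k > 1/2"
  shows "filterlim (\<lambda>z. Re (explicit_map k z)) at_top at_0_uhp"
proof -
  have "filterlim (\<lambda>r::real. - ((k - 1/2) * ln r)) at_top (at_right 0)" using k by real_asymp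
  from filterlim_compose[OF this at_0_uhp_norm] 
  have 1: "filterlim (\<lambda>z. - ((k - 1/2) * ln (norm z))) at_top at_0_uhp" .
  have "((\<lambda>z. Re z + Re (Ln (of_real (1 / pi) * stieltjes_int k z))) \<longlongrightarrow> Re 0 + Re (of_real (ln (Gamma
      (k - 1/2) / pi)))) at_0_uhp"
    by (intro tendsto_intros Ln_stieltjes_zero[OF k])
  from filterlim_tendsto_add_at_top[OF this 1]
  show ?thesis
  proof (rule filterlim_mono_eventually)
    show "eventually (\<lambda>z. Re z + Re (Ln (of_real (1 / pi) * stieltjes_int k z)) + - ((k - 1/2) * ln
        (norm z)) = Re (explicit_map k z)) at_0_uhp"
      using eventually_uhp_at_0
    proof eventually_elim
      case (elim z)
      then have "z \<noteq> 0" by (auto simp: upper_half_plane_def)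
      then show ?case by (simp add: explicit_map_uhp[OF k elim])
    qed
  qed auto
qed

text \<open>Together with \<open>Re F \<rightarrow> \<infinity>\<close> this describes the approach to \<open>infty1 k\<close> through the channel.\<close>

lemma explicit_map_zero_Im:
  assumes k: "k > 1/2" and e: "e > 0"
  shows "eventually (\<lambda>z. Im (explicit_map k z) < (k - 1/2) * pi + e) at_0_uhp"
proof -
  have "((\<lambda>z. Im z + Im (Ln (of_real (1 / pi) * stieltjes_int k z))) \<longlongrightarrow> Im 0 + Im (of_real (ln (Gamma
      (k - 1/2) / pi)))) at_0_uhp"
    by (intro tendsto_intros Ln_stieltjes_zero[OF k])
  then have "eventually (\<lambda>z. Im z + Im (Ln (of_real (1 / pi) * stieltjes_int k z)) < e) at_0_uhp"
    using e by (intro order_tendstoD) auto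
  then show ?thesis using eventually_uhp_at_0
  proof eventually_elim
    case (elim z)
    have "Im (explicit_map k z) = Im z - (k - 1/2) * Im (Ln (- z)) + Im (Ln (of_real (1 / pi) *
        stieltjes_int k z))"
      by (simp add: explicit_map_uhp[OF k elim(2)])
    moreover have "(k - 1/2) * (- Im (Ln (- z))) \<le> (k - 1/2) * pi"
      using k Im_Ln_uminus[OF elim(2)] by (intro mult_left_mono) auto
    ultimately show ?case using elim by simp
  qed
qed

section \<open>The domain and the boundary values of the explicit map\<close>

text \<open>The deleted set in the form in which the exponential of the map sees it: with \<open>t = exp (- Re w)\<close> the
inequality \<open>|y| \<le> arccos t\<close> becomes \<open>exp (Re w) * cos y \<ge> 1\<close>.\<close>

definition barrier :: "real \<Rightarrow> complex \<Rightarrow> bool" where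
  "barrier k w \<longleftrightarrow> \<bar>Im w - k * pi\<bar> < pi / 2 \<and> exp (Re w) * cos (Im w - k * pi) \<ge> 1"

lemma Pi_dom_barrier: "Pi_dom k = {w \<in> upper_half_plane. \<not> barrier k w}"
proof -
  have "(\<exists>t\<in>{0<..1}. Re w = - ln t \<and> \<bar>Im w - k * pi\<bar> \<le> arccos t) \<longleftrightarrow> barrier k w" for w
  proof
    assume "\<exists>t\<in>{0<..1}. Re w = - ln t \<and> \<bar>Im w - k * pi\<bar> \<le> arccos t"
    then obtain t where t: "0 < t" "t \<le> 1" "Re w = - ln t" "\<bar>Im w - k * pi\<bar> \<le> arccos t" by auto
    have "arccos t < arccos 0" using t by (intro arccos_less_arccos) auto
    then have 1: "\<bar>Im w - k * pi\<bar> < pi / 2" using t by simp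
    have "cos (arccos t) \<le> cos \<bar>Im w - k * pi\<bar>"
      using t arccos_bounded[of t] by (intro cos_monotone_0_pi_le) auto
    then have "t \<le> cos (Im w - k * pi)" using t by simp
    moreover have "exp (Re w) = 1 / t" using t by (simp add: exp_minus inverse_eq_divide)
    ultimately show "barrier k w" using 1 t by (simp add: barrier_def)
  next
    assume b: "barrier k w"
    define t where "t = exp (- Re w)"
    have "1 \<le> exp (Re w) * cos (Im w - k * pi)" using b by (simp add: barrier_def)
    then have "t \<le> t * (exp (Re w) * cos (Im w - k * pi))" by (simp add: t_def)
    also have "\<dots> = cos (Im w - k * pi)" by (simp add: t_def flip: mult.assoc exp_add)
    finally have tc: "t \<le> cos (Im w - k * pi)" .
    moreover have "cos (Im w - k * pi) \<le> 1" by simp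
    ultimately have t: "0 < t" "t \<le> 1" unfolding t_def by (simp, linarith)
    have "arccos (cos \<bar>Im w - k * pi\<bar>) \<le> arccos t"
      using t tc by (intro arccos_le_arccos) auto
    moreover have "arccos (cos \<bar>Im w - k * pi\<bar>) = \<bar>Im w - k * pi\<bar>"
      using b pi_gt_zero unfolding barrier_def by (intro arccos_cos) (simp, linarith)
    ultimately show "\<exists>t\<in>{0<..1}. Re w = - ln t \<and> \<bar>Im w - k * pi\<bar> \<le> arccos t"
      using t by (intro bexI[of _ t]) (auto simp: t_def)
  qed
  then show ?thesis by (auto simp: Pi_dom_def)
qed

lemma barrier_Re: "barrier k w \<Longrightarrow> Re w \<ge> 0"
proof -
  assume "barrier k w"
  then have "1 \<le> exp (Re w) * cos (Im w - k * pi)" by (simp add: barrier_def)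
  also have "\<dots> \<le> exp (Re w) * 1" by (intro mult_left_mono) auto
  finally show ?thesis by simp
qed

text \<open>The deleted set is invariant under shifts to the right, and a shift moves it into its interior.\<close>

lemma barrier_shift:
  assumes "barrier k w" "s > 0"
  shows "barrier k (w + of_real s)" "exp (Re (w + of_real s)) * cos (Im (w + of_real s) - k * pi) > 1"
proof -
  have 1: "1 \<le> exp (Re w) * cos (Im w - k * pi)" using assms by (simp add: barrier_def)
  then have "exp (Re w) * cos (Im w - k * pi) > 0" by linarith
  then have "1 * (exp (Re w) * cos (Im w - k * pi)) < exp s * (exp (Re w) * cos (Im w - k * pi))"
    using assms(2) by (intro mult_strict_right_mono) auto
  then show "exp (Re (w + of_real s)) * cos (Im (w + of_real s) - k * pi) > 1"
    using 1 unfolding plus_complex.sel Re_complex_of_real Im_complex_of_real exp_add by (simp only: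
        add_0_right mult_ac)
  then show "barrier k (w + of_real s)" using assms(1) by (simp add: barrier_def)
qed

text \<open>Shifts to the left stay in the domain, so every point is joined by a horizontal segment to the convex
quadrant \<open>Re w < 0\<close>, \<open>Im w > 0\<close>.\<close>

lemma connected_Pi_dom: "connected (Pi_dom k)"
proof -
  define L where "L = {w. Re w < 0} \<inter> upper_half_plane"
  have L: "convex L" unfolding L_def by (intro convex_Int convex_halfspace_Re_lt convex_uhp)
  have LP: "L \<subseteq> Pi_dom k" using barrier_Re by (force simp: L_def Pi_dom_barrier)
  define T where "T w = L \<union> closed_segment w (w - of_real (\<bar>Re w\<bar> + 1))" for w
  have seg: "closed_segment w (w - of_real (\<bar>Re w\<bar> + 1)) \<subseteq> Pi_dom k" if w: "w \<in> Pi_dom k" for w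
  proof
    fix v assume "v \<in> closed_segment w (w - of_real (\<bar>Re w\<bar> + 1))"
    then obtain u where u: "0 \<le> u" "u \<le> 1" "v = (1 - u) *\<^sub>R w + u *\<^sub>R (w - of_real (\<bar>Re w\<bar> + 1))"
      by (auto simp: in_segment)
    define s where "s = u * (\<bar>Re w\<bar> + 1)"
    have v: "w = v + of_real s" unfolding u(3) s_def by (simp add: scaleR_conv_of_real algebra_simps)
    have "s \<ge> 0" using u by (simp add: s_def)
    then show "v \<in> Pi_dom k"
      using barrier_shift(1)[of k v s] w v by (cases "s = 0") (auto simp: Pi_dom_barrier
          upper_half_plane_def)
  qed
  have "Pi_dom k = \<Union> (T ` Pi_dom k)"
    using LP seg by (auto simp: T_def)
  moreover have "connected (\<Union> (T ` Pi_dom k))"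
  proof (rule connected_Union)
    fix s assume "s \<in> T ` Pi_dom k"
    then obtain w where w: "w \<in> Pi_dom k" "s = T w" by auto
    have "w - of_real (\<bar>Re w\<bar> + 1) \<in> L" using w by (auto simp: L_def Pi_dom_barrier upper_half_plane_def)
    then show "connected s" unfolding w T_def
      by (intro connected_Un convex_connected L) auto
  next
    have "Complex (-1) 1 \<in> \<Inter> (T ` Pi_dom k)" by (auto simp: T_def L_def upper_half_plane_def)
    then show "\<Inter> (T ` Pi_dom k) \<noteq> {}" by blast
  qed
  ultimately show ?thesis by simp
qed

lemma explicit_map_neg:
  assumes k: "k > 1/2" and x: "x > 0"
  shows "explicit_map k (- of_real x) = of_real (- x - (k - 1/2) * ln x + ln (Re (stieltjes_int k (-
      of_real x)) / pi))"
proof -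
  have S: "Im (stieltjes_int k (- of_real x)) = 0" "Re (stieltjes_int k (- of_real x)) > 0"
    using stieltjes_neg_axis[of k x] k x by auto
  then have "stieltjes_int k (- of_real x) / of_real pi = of_real (Re (stieltjes_int k (- of_real x)) / pi)"
    by (simp add: complex_eq_iff)
  then have "Ln (stieltjes_int k (- of_real x) / of_real pi) = of_real (ln (Re (stieltjes_int k (-
      of_real x)) / pi))"
    using S Ln_of_real[of "Re (stieltjes_int k (- of_real x)) / pi"] by simp
  then show ?thesis using stieltjes_ext_neg[of k x] Ln_up_neg[OF x] k x by (simp add: explicit_map_def)
qed

text \<open>Let \<open>F\<close> be the map, \<open>S\<close> the continued transform and \<open>w\<close> the weight. Then \<open>Im F = (k - 1/2) pi + \<theta>\<close> with
\<open>\<theta> = arg S\<close>, and \<open>|S| sin \<theta> = pi w(x)\<close> by the boundary value of \<open>S\<close>. So \<open>exp (Re F) sin \<theta> = 1\<close>, and \<open>sin \<theta>\<close> is the cosine of \<open>\<theta> - pi/2\<close>.\<close>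

lemma explicit_map_pos:
  assumes k: "k > 1/2" and x: "x > 0"
  shows "\<bar>Im (explicit_map k (of_real x)) - k * pi\<bar> < pi / 2" 
    "exp (Re (explicit_map k (of_real x))) * cos (Im (explicit_map k (of_real x)) - k * pi) = 1"
    "Im (explicit_map k (of_real x)) < (k + 1/2) * pi"
proof -
  let ?S = "stieltjes_ext k (of_real x) / of_real pi"
  have ImS: "Im ?S = gamma_weight k x" using Im_stieltjes_ext_pos_axis[of k x] k x by simp
  then have S0: "?S \<noteq> 0" "Im ?S > 0" using gamma_weight_pos[OF x, of k] by auto
  define th where "th = Im (Ln ?S)"
  have th: "0 < th" "th < pi" using Im_Ln_pos_lt_imp[OF S0(2)] by (auto simp: th_def)
  have Im: "Im (explicit_map k (of_real x)) = (k - 1/2) * pi + th"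
    by (simp add: explicit_map_def Ln_up_pos[OF x] th_def)
  then show "\<bar>Im (explicit_map k (of_real x)) - k * pi\<bar> < pi / 2" "Im (explicit_map k (of_real x)) <
      (k + 1/2) * pi" 
    using th unfolding Im abs_less_iff by (simp_all add: algebra_simps)
  have Re: "Re (explicit_map k (of_real x)) = x - (k - 1/2) * ln x + ln (norm ?S)"
    using S0(1) by (simp add: explicit_map_def Ln_up_pos[OF x])
  have "norm ?S * sin th = Im ?S"
    using exp_Ln[OF S0(1)] S0(1) unfolding th_def by (metis Im_exp Re_Ln exp_ln zero_less_norm_iff)
  moreover have "exp (Re (explicit_map k (of_real x))) = exp x * x powr (- (k - 1/2)) * norm ?S"
    unfolding Re using S0(1) x by (simp only: exp_add exp_diff powr_def) (simp add: exp_minus field_simps)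
  moreover have "cos (Im (explicit_map k (of_real x)) - k * pi) = sin th"
  proof -
    have "(k - 1/2) * pi + th - k * pi = - (pi/2 - th)" by (simp add: algebra_simps)
    then show ?thesis unfolding Im by (simp only: cos_minus cos_diff) simp
  qed
  ultimately have "exp (Re (explicit_map k (of_real x))) * cos (Im (explicit_map k (of_real x)) - k
      * pi) = exp x * x powr (- (k - 1/2)) * gamma_weight k x"
    using ImS by (simp only: mult.assoc)
  also have "\<dots> = 1" using x by (simp add: gamma_weight_def exp_minus powr_minus field_simps flip: powr_add)
  finally show "exp (Re (explicit_map k (of_real x))) * cos (Im (explicit_map k (of_real x)) - k *
      pi) = 1" .
qed

lemma explicit_map_boundary:
  assumes k: "k > 1/2" and z: "z \<in> closed_uhp0" "z \<notin> upper_half_plane"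
  shows "Im (explicit_map k z) = 0 \<or> 
     (\<bar>Im (explicit_map k z) - k * pi\<bar> < pi / 2 \<and> exp (Re (explicit_map k z)) * cos (Im
         (explicit_map k z) - k * pi) = 1)"
  using z(1)
proof (cases rule: closed_uhp0_cases)
  case (2 x)
  then show ?thesis using explicit_map_pos[OF k 2(1)] by simp
next
  case (3 x)
  then show ?thesis using explicit_map_neg[OF k 3(1)] by simp
qed (use z in simp)

section \<open>The image of the explicit map\<close>

lemma explicit_map_open_image: "k > 1/2 \<Longrightarrow> open (explicit_map k ` upper_half_plane)"
  by (rule open_mapping_thm3[OF explicit_map_holomorphic open_uhp explicit_map_inj_on])

text \<open>A condition that holds near 0 and near infinity can fail only in a compact part of the punctured closed
half-plane, where the map is bounded.\<close>

lemma explicit_map_compact_exception: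
  assumes k: "k > 1/2" and P0: "eventually P at_0_uhp" and Pinf: "eventually P at_inf_uhp"
  obtains K where "compact K" "K \<subseteq> closed_uhp0" "\<And>z. z \<in> upper_half_plane \<Longrightarrow> \<not> P z \<Longrightarrow> z \<in> K"
proof -
  obtain d where d: "d > 0" "\<And>z. z \<in> upper_half_plane \<Longrightarrow> norm z < d \<Longrightarrow> P z"
  proof -
    obtain d where "d > 0" "\<forall>z\<in>upper_half_plane. z \<noteq> 0 \<and> dist z 0 < d \<longrightarrow> P z"
      using P0 unfolding eventually_at by blast
    then show ?thesis using that[of d] by (force simp: upper_half_plane_def)
  qed
  obtain R where R: "\<And>z. z \<in> upper_half_plane \<Longrightarrow> norm z \<ge> R \<Longrightarrow> P z"
    using Pinf unfolding eventually_inf_principal eventually_at_infinity by blast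
  show ?thesis
  proof
    show "compact ({z. Im z \<ge> 0} \<inter> (cball 0 R - ball 0 d))"
      by (intro closed_Int_compact closed_halfspace_Im_ge compact_diff) auto
    show "{z. Im z \<ge> 0} \<inter> (cball 0 R - ball 0 d) \<subseteq> closed_uhp0" using d(1) by auto
    show "z \<in> {z. Im z \<ge> 0} \<inter> (cball 0 R - ball 0 d)" if "z \<in> upper_half_plane" "\<not> P z" for z
      using d(2)[of z] R[of z] that by (force simp: upper_half_plane_def)
  qed
qed

text \<open>The map tends to infinity at 0 and at infinity, so a sequence with convergent images stays in a compact set.\<close>

lemma closure_explicit_map_image:
  assumes k: "k > 1/2"
  shows "closure (explicit_map k ` upper_half_plane) \<subseteq> explicit_map k ` closed_uhp0"
proof
  fix w assume w: "w \<in> closure (explicit_map k ` upper_half_plane)"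
  let ?P = "\<lambda>z. norm (explicit_map k z) > norm w + 1"
  have "filterlim (\<lambda>z. norm (explicit_map k z)) at_top at_inf_uhp"
    using explicit_map_at_infinity[OF k] by (rule filterlim_at_infinity_imp_norm_at_top)
  then have 1: "eventually ?P at_inf_uhp" by (simp add: filterlim_at_top_dense)
  have "eventually (\<lambda>z. Re (explicit_map k z) > norm w + 1) at_0_uhp"
    using explicit_map_zero_Re[OF k] by (simp add: filterlim_at_top_dense)
  then have 2: "eventually ?P at_0_uhp"
    by eventually_elim (use complex_Re_le_cmod less_le_trans in blast)
  obtain K where K: "compact K" "K \<subseteq> closed_uhp0" "\<And>z. z \<in> upper_half_plane \<Longrightarrow> \<not> ?P z \<Longrightarrow> z \<in> K"
    using explicit_map_compact_exception[OF k 2 1] by blast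
  have cK: "closed (explicit_map k ` K)"
    using K explicit_map_continuous_on[OF k] by (intro compact_imp_closed compact_continuous_image)
        (auto elim: continuous_on_subset)
  have "w \<in> closure (explicit_map k ` K)"
    unfolding closure_approachable
  proof (intro allI impI)
    fix e :: real assume e: "e > 0"
    then obtain z where z: "z \<in> upper_half_plane" "dist (explicit_map k z) w < min e 1"
      using w unfolding closure_approachable by (metis imageE min_less_iff_conj zero_less_one)
    have "norm (explicit_map k z) \<le> norm w + dist (explicit_map k z) w"
      by (metis add.commute dist_norm norm_triangle_sub)
    then have "\<not> ?P z" using z by linarith
    then show "\<exists>y\<in>explicit_map k ` K. dist y w < e" using K(3)[OF z(1)] z(2) by auto
  qed
  then show "w \<in> explicit_map k ` closed_uhp0" using cK K(2) by auto
qed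

text \<open>The image of the half-plane is open, and inside \<open>C\<close> it is also closed, because the limits that
\<open>closure_explicit_map_image\<close> adds are boundary values.\<close>

lemma connected_subset_image:
  assumes k: "k > 1/2" and C: "connected C" "C \<inter> explicit_map k ` upper_half_plane \<noteq> {}"
    and bd: "\<And>z. z \<in> closed_uhp0 \<Longrightarrow> z \<notin> upper_half_plane \<Longrightarrow> explicit_map k z \<notin> C"
  shows "C \<subseteq> explicit_map k ` upper_half_plane"
proof -
  have "C \<inter> explicit_map k ` upper_half_plane = C \<inter> closure (explicit_map k ` upper_half_plane)"
    using closure_explicit_map_image[OF k] closure_subset[of "explicit_map k ` upper_half_plane"] bd
        by blast
  then have "closedin (top_of_set C) (C \<inter> explicit_map k ` upper_half_plane)" by (metis
      closed_closure closedin_closed_Int)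
  moreover have "openin (top_of_set C) (C \<inter> explicit_map k ` upper_half_plane)"
    using explicit_map_open_image[OF k] by (rule openin_open_Int)
  ultimately show ?thesis using C by (auto simp: connected_clopen)
qed

text \<open>If the image met the deleted set, it would contain a point \<open>w\<close> of its interior and then the whole ray
\<open>w + s\<close>, \<open>s \<ge> 0\<close>. On this ray \<open>Im\<close> is a constant strictly between \<open>(k - 1/2) pi\<close> and \<open>(k + 1/2) pi\<close>,
which for values with positive real part is possible neither near 0 nor near infinity, and elsewhere
the map is bounded.\<close>

lemma explicit_map_not_barrier:
  assumes k: "k > 1/2" and z: "z \<in> upper_half_plane"
  shows "\<not> barrier k (explicit_map k z)"
proof
  assume b: "barrier k (explicit_map k z)"
  obtain e where e: "e > 0" "ball (explicit_map k z) e \<subseteq> explicit_map k ` upper_half_plane"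
    using explicit_map_open_image[OF k] z open_contains_ball by blast
  \<comment> \<open>a point of the image in the interior of the deleted set\<close>
  define w where "w = explicit_map k z + of_real (e/2)"
  have wb: "\<bar>Im w - k * pi\<bar> < pi / 2" "exp (Re w) * cos (Im w - k * pi) > 1"
    using barrier_shift[OF b, of "e/2"] e(1) by (auto simp: w_def barrier_def)
  have wb': "(k - 1/2) * pi < Im w" "Im w < (k + 1/2) * pi"
    using wb(1) unfolding abs_less_iff by (simp_all add: algebra_simps)
  have "w \<in> ball (explicit_map k z) e" using e(1) by (simp add: w_def dist_norm)
  then have wi: "w \<in> explicit_map k ` upper_half_plane" using e by blast
  then have w0: "Im w > 0" using Im_explicit_map_gt[OF k] by (force simp: upper_half_plane_def)
  define C where "C = (\<lambda>s. w + of_real s) ` {0..}"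
  have "C \<subseteq> explicit_map k ` upper_half_plane"
  proof (rule connected_subset_image[OF k])
    show "connected C" unfolding C_def
      by (intro connected_continuous_image continuous_intros) auto
    show "C \<inter> explicit_map k ` upper_half_plane \<noteq> {}" 
    proof -
      have "w \<in> C" unfolding C_def by (rule image_eqI[of _ _ 0]) auto
      then show ?thesis using wi by blast
    qed
    fix v assume v: "v \<in> closed_uhp0" "v \<notin> upper_half_plane"
    show "explicit_map k v \<notin> C"
    proof
      assume "explicit_map k v \<in> C"
      then obtain s where s: "s \<ge> 0" "explicit_map k v = w + of_real s" by (auto simp: C_def)
      have "exp (Re w) * cos (Im w - k * pi) \<le> exp s * (exp (Re w) * cos (Im w - k * pi))"
        using s wb(2) mult_right_mono[of 1 "exp s" "exp (Re w) * cos (Im w - k * pi)"] by simp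
      moreover have "exp (Re (explicit_map k v)) * cos (Im (explicit_map k v) - k * pi) = exp s *
          (exp (Re w) * cos (Im w - k * pi))"
        unfolding s(2) by (simp add: exp_add mult_ac)
      ultimately have "exp (Re (explicit_map k v)) * cos (Im (explicit_map k v) - k * pi) > 1"
        using wb(2) by linarith
      then show False using explicit_map_boundary[OF k v] s w0 by auto
    qed
  qed
  then have pre: "\<exists>z\<in>upper_half_plane. explicit_map k z = w + of_real s" if "s \<ge> 0" for s using that
      by (force simp: C_def)
  let ?P = "\<lambda>z. Im (explicit_map k z) \<noteq> Im w \<or> Re (explicit_map k z) \<le> 0"
  have "eventually (\<lambda>z. Im (explicit_map k z) < (k - 1/2) * pi + (Im w - (k - 1/2) * pi)) at_0_uhp"
    using wb'(1) by (intro explicit_map_zero_Im[OF k]) simp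
  then have 1: "eventually ?P at_0_uhp" by eventually_elim auto
  have "eventually (\<lambda>z. Re (explicit_map k z) > 0 \<longrightarrow> Im (explicit_map k z) > (k + 1/2) * pi - ((k +
      1/2) * pi - Im w)) at_inf_uhp"
    using wb'(2) by (intro explicit_map_infinity_right[OF k]) simp
  then have 2: "eventually ?P at_inf_uhp" by eventually_elim auto
  obtain K where K: "compact K" "K \<subseteq> closed_uhp0" "\<And>z. z \<in> upper_half_plane \<Longrightarrow> \<not> ?P z \<Longrightarrow> z \<in> K"
    using explicit_map_compact_exception[OF k 1 2] by blast
  have "bounded (explicit_map k ` K)"
    using K explicit_map_continuous_on[OF k] by (intro compact_imp_bounded compact_continuous_image)
        (auto elim: continuous_on_subset)
  then obtain B where B: "\<And>z. z \<in> K \<Longrightarrow> norm (explicit_map k z) \<le> B" by (auto simp: bounded_iff)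
  define s where "s = \<bar>B\<bar> + \<bar>Re w\<bar> + 1"
  obtain v where v: "v \<in> upper_half_plane" "explicit_map k v = w + of_real s" using pre[of s] by
      (auto simp: s_def)
  then have Re: "Re (explicit_map k v) > \<bar>B\<bar>" and "Im (explicit_map k v) = Im w" by (auto simp: s_def)
  then have "v \<in> K" using v by (intro K(3)) auto
  then show False using B[of v] Re complex_Re_le_cmod[of "explicit_map k v"] by linarith
qed

lemma explicit_map_image:
  assumes k: "k > 1/2"
  shows "explicit_map k ` upper_half_plane = Pi_dom k"
proof
  show sub: "explicit_map k ` upper_half_plane \<subseteq> Pi_dom k"
    using explicit_map_not_barrier[OF k] Im_explicit_map_gt[OF k] by (force simp: Pi_dom_barrier
        upper_half_plane_def)
  show "Pi_dom k \<subseteq> explicit_map k ` upper_half_plane"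
  proof (rule connected_subset_image[OF k connected_Pi_dom])
    have "\<i> \<in> upper_half_plane" by (simp add: upper_half_plane_def)
    then show "Pi_dom k \<inter> explicit_map k ` upper_half_plane \<noteq> {}" using sub by blast
    show "explicit_map k z \<notin> Pi_dom k" if "z \<in> closed_uhp0" "z \<notin> upper_half_plane" for z
      using explicit_map_boundary[OF k that] by (auto simp: Pi_dom_barrier barrier_def upper_half_plane_def)
  qed
qed

lemma explicit_map_normalized:
  assumes k: "k > 1/2"
  shows "is_normalized_map k (explicit_map k)"
  unfolding is_normalized_map_def
proof (intro conjI)
  show "explicit_map k holomorphic_on upper_half_plane" by (rule explicit_map_holomorphic[OF k])
  show "bij_betw (explicit_map k) upper_half_plane (Pi_dom k)"
    using explicit_map_inj_on[OF k] explicit_map_image[OF k] by (simp add: bij_betw_def)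
  show "continuous_on closed_uhp0 (explicit_map k)" by (rule explicit_map_continuous_on[OF k])
  show "((\<lambda>z. explicit_map k z / z) \<longlongrightarrow> 1) at_inf_uhp" by (rule explicit_map_over_z[OF k])
  have inP: "explicit_map k z \<in> Pi_dom k" if "z \<in> upper_half_plane" for z using
      explicit_map_image[OF k] that by blast
  show "filterlim (explicit_map k) (infty1 k) at_0_uhp"
    unfolding infty1_def filterlim_inf filterlim_filtercomap_iff filterlim_principal
  proof
    show "filterlim (Re \<circ> explicit_map k) at_top at_0_uhp" using explicit_map_zero_Re[OF k] by (simp
        add: o_def)
    then have "eventually (\<lambda>z. Re (explicit_map k z) > 0) at_0_uhp" by (simp add:
        filterlim_at_top_dense o_def)
    moreover have "eventually (\<lambda>z. Im (explicit_map k z) < (k - 1/2) * pi + pi/2) at_0_uhp"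
      by (rule explicit_map_zero_Im[OF k]) simp
    ultimately show "eventually (\<lambda>z. explicit_map k z \<in> channel k) at_0_uhp" using eventually_uhp_at_0
      by eventually_elim (auto simp: channel_def inP algebra_simps)
  qed
  show "filterlim (explicit_map k) (infty2 k) at_inf_uhp"
    unfolding infty2_def filterlim_inf filterlim_principal
  proof
    show "filterlim (explicit_map k) at_infinity at_inf_uhp" by (rule explicit_map_at_infinity[OF k])
    have "eventually (\<lambda>z. Re (explicit_map k z) > 0 \<longrightarrow> Im (explicit_map k z) > (k + 1/2) * pi - pi/2)
        at_inf_uhp"
      by (rule explicit_map_infinity_right[OF k]) simp
    with eventually_uhp_at_inf show "eventually (\<lambda>z. explicit_map k z \<in> Pi_dom k - channel k) at_inf_uhp"
      by eventually_elim (auto simp: inP channel_def algebra_simps)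
  qed
qed

section \<open>Automorphisms of the half-plane\<close>

definition cayley :: "complex \<Rightarrow> complex" where "cayley z = (z - \<i>) / (z + \<i>)"
definition uncayley :: "complex \<Rightarrow> complex" where "uncayley w = \<i> * (1 + w) / (1 - w)"

lemma uhp_plus_i_nonzero: "z \<in> upper_half_plane \<Longrightarrow> z + \<i> \<noteq> 0"
  by (auto simp: upper_half_plane_def complex_eq_iff)

lemma cayley_ball: 
  assumes "z \<in> upper_half_plane" 
  shows "cayley z \<in> ball 0 1"
proof -
  have z: "Im z > 0" using assms by (simp add: upper_half_plane_def)
  have "(Im z - 1)\<^sup>2 < (Im z + 1)\<^sup>2" using z by (simp add: power2_eq_square algebra_simps)
  then have "norm (z - \<i>) < norm (z + \<i>)" by (simp add: cmod_def)
  then show ?thesis using uhp_plus_i_nonzero[OF assms] by (simp add: cayley_def norm_divide)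
qed

lemma uncayley_uhp:
  assumes "w \<in> ball 0 1" 
  shows "uncayley w \<in> upper_half_plane"
proof -
  have w: "norm w < 1" "1 - w \<noteq> 0" using assms by auto
  have "(Re w)\<^sup>2 + (Im w)\<^sup>2 < 1" using w(1) by (simp add: cmod_def real_sqrt_lt_1_iff)
  moreover have "(1 - Re w)\<^sup>2 + (Im w)\<^sup>2 > 0"
    using w(2) by (simp add: complex_eq_iff sum_power2_gt_zero_iff)
  ultimately show ?thesis
    by (simp add: upper_half_plane_def uncayley_def Im_divide power2_eq_square algebra_simps)
qed

lemma cayley_uncayley: "w \<in> ball 0 1 \<Longrightarrow> cayley (uncayley w) = w"
proof -
  assume "w \<in> ball 0 1"
  then have "1 - w \<noteq> 0" by auto
  then have "uncayley w - \<i> = 2 * \<i> * w / (1 - w)" "uncayley w + \<i> = 2 * \<i> / (1 - w)"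
    by (simp_all add: uncayley_def field_simps)
  then show ?thesis using \<open>1 - w \<noteq> 0\<close> by (simp add: cayley_def)
qed

lemma uncayley_cayley: "z \<in> upper_half_plane \<Longrightarrow> uncayley (cayley z) = z"
proof -
  assume "z \<in> upper_half_plane"
  then have "z + \<i> \<noteq> 0" by (rule uhp_plus_i_nonzero)
  then have "1 + cayley z = 2 * z / (z + \<i>)" "1 - cayley z = 2 * \<i> / (z + \<i>)"
    by (simp_all add: cayley_def field_simps)
  then show ?thesis using \<open>z + \<i> \<noteq> 0\<close> by (simp add: uncayley_def)
qed

lemma cayley_holomorphic: "cayley holomorphic_on upper_half_plane"
  unfolding cayley_def by (intro holomorphic_intros) (auto dest: uhp_plus_i_nonzero)

lemma uncayley_holomorphic: "uncayley holomorphic_on ball 0 1"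
  unfolding uncayley_def by (intro holomorphic_intros) auto

text \<open>In the disc model both the automorphism and its inverse satisfy the Schwarz lemma, so equality holds in it
and the automorphism is a rotation.\<close>

lemma uhp_automorphism_fix_i:
  assumes hol: "\<psi> holomorphic_on upper_half_plane" and bij: "bij_betw \<psi> upper_half_plane
      upper_half_plane" and fix_i: "\<psi> \<i> = \<i>"
  obtains \<alpha> where "\<And>z. z \<in> upper_half_plane \<Longrightarrow> cayley (\<psi> z) = \<alpha> * cayley z"
proof -
  have inj: "inj_on \<psi> upper_half_plane" and im: "\<psi> ` upper_half_plane = upper_half_plane" using bij
      by (auto simp: bij_betw_def)
  have iOm: "\<i> \<in> upper_half_plane" by (simp add: upper_half_plane_def)
  obtain \<tau> where chi: "\<tau> holomorphic_on (\<psi> ` upper_half_plane)" "\<And>z. z \<in> upper_half_plane \<Longrightarrow> \<tau> (\<psi> z) = z"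
    using holomorphic_has_inverse[OF hol open_uhp inj] by metis
  have tau_uhp: "\<tau> z \<in> upper_half_plane" if "z \<in> upper_half_plane" for z
    using that im chi(2) by (metis imageE)
  have schwarz: "norm (cayley (h (uncayley w))) \<le> norm w"
    "w \<noteq> 0 \<Longrightarrow> norm (cayley (h (uncayley w))) = norm w \<Longrightarrow> \<exists>\<alpha>. \<forall>z. norm z < 1 \<longrightarrow> cayley (h (uncayley z)) = \<alpha> * z"
    if h: "h holomorphic_on upper_half_plane" "\<And>z. z \<in> upper_half_plane \<Longrightarrow> h z \<in> upper_half_plane" "h
        \<i> = \<i>" and w: "norm w < 1" for h w
  proof -
    let ?f = "cayley \<circ> h \<circ> uncayley"
    have hol: "?f holomorphic_on ball 0 1"
    proof (rule holomorphic_on_compose_gen[OF uncayley_holomorphic])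
      show "cayley \<circ> h holomorphic_on upper_half_plane"
        by (rule holomorphic_on_compose_gen[OF h(1) cayley_holomorphic]) (use h(2) in auto)
      show "uncayley ` ball 0 1 \<subseteq> upper_half_plane" using uncayley_uhp by auto
    qed
    have 0: "?f 0 = 0" by (simp add: uncayley_def h(3) cayley_def)
    have no: "norm (?f z) < 1" if "norm z < 1" for z
      using cayley_ball[OF h(2)[OF uncayley_uhp[of z]]] that by simp
    note S = Schwarz_Lemma[OF hol 0 no w]
    show "norm (cayley (h (uncayley w))) \<le> norm w" using S(1) by simp
    assume "w \<noteq> 0" "norm (cayley (h (uncayley w))) = norm w"
    then show "\<exists>\<alpha>. \<forall>z. norm z < 1 \<longrightarrow> cayley (h (uncayley z)) = \<alpha> * z"
      using S(3) w by force
  qed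
  \<comment> \<open>any nonzero point of the disc can serve as the point of equality\<close>
  let ?w = "1/2 :: complex"
  have wb: "?w \<in> ball 0 1" by simp
  have psi_uhp: "\<psi> z \<in> upper_half_plane" if "z \<in> upper_half_plane" for z using im that by blast
  have chi_i: "\<tau> \<i> = \<i>" using chi(2)[OF iOm] fix_i by simp
  let ?v = "cayley (\<psi> (uncayley ?w))"
  have v: "?v \<in> ball 0 1" by (intro cayley_ball psi_uhp uncayley_uhp wb)
  have "norm (cayley (\<tau> (uncayley ?v))) \<le> norm ?v"
    using chi(1) im tau_uhp chi_i v by (intro schwarz(1)) auto
  also have "uncayley ?v = \<psi> (uncayley ?w)" by (intro uncayley_cayley psi_uhp uncayley_uhp wb)
  also have "cayley (\<tau> (\<psi> (uncayley ?w))) = ?w"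
    by (simp only: chi(2)[OF uncayley_uhp[OF wb]] cayley_uncayley[OF wb])
  finally have "norm ?w \<le> norm ?v" .
  moreover have "norm ?v \<le> norm ?w" using hol psi_uhp fix_i by (intro schwarz(1)) auto
  ultimately have eq: "norm ?v = norm ?w" by simp
  obtain \<alpha> where a: "\<And>z. norm z < 1 \<Longrightarrow> cayley (\<psi> (uncayley z)) = \<alpha> * z"
    using schwarz(2)[OF hol psi_uhp fix_i _ _ eq] by auto
  show ?thesis
  proof (rule that)
    show "cayley (\<psi> z) = \<alpha> * cayley z" if "z \<in> upper_half_plane" for z
      using a[of "cayley z"] cayley_ball[OF that] uncayley_cayley[OF that] by simp
  qed
qed

lemma cayley_at_infinity: "(cayley \<longlongrightarrow> 1) at_infinity"
proof -
  have "((\<lambda>z. 1 - 2 * \<i> / (\<i> + z)) \<longlongrightarrow> 1 - 0) at_infinity"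
    by (intro tendsto_diff tendsto_const tendsto_divide_0[OF tendsto_const]
        tendsto_add_filterlim_at_infinity[OF tendsto_const] filterlim_ident)
  then have "((\<lambda>z. 1 - 2 * \<i> / (\<i> + z)) \<longlongrightarrow> 1) at_infinity" by simp
  then show ?thesis
  proof (rule Lim_transform_eventually)
    have "eventually (\<lambda>z::complex. norm z > 1) at_infinity"
      unfolding eventually_at_infinity by (intro exI[of _ 2]) auto
    then show "eventually (\<lambda>z. 1 - 2 * \<i> / (\<i> + z) = cayley z) at_infinity"
    proof eventually_elim
      case (elim z)
      have "\<i> + z \<noteq> 0" using elim by (metis add_eq_0_iff less_irrefl norm_ii norm_minus_cancel)
      then show ?case by (simp add: cayley_def field_simps)
    qed
  qed
qed

lemma at_inf_uhp_nontrivial: "at_inf_uhp \<noteq> bot"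
proof
  assume "at_inf_uhp = bot"
  then have "eventually (\<lambda>z. False) at_inf_uhp" by simp
  then obtain b where b: "\<And>z::complex. norm z \<ge> b \<Longrightarrow> z \<notin> upper_half_plane"
    unfolding eventually_inf_principal eventually_at_infinity by auto
  have "\<i> * of_real (\<bar>b\<bar> + 1) \<in> upper_half_plane" by (simp add: upper_half_plane_def)
  moreover have "norm (\<i> * complex_of_real (\<bar>b\<bar> + 1)) \<ge> b" unfolding norm_mult norm_of_real by simp
  ultimately show False using b by blast
qed

text \<open>Composing with a real affine map makes \<open>i\<close> a fixed point. The rotation that the Schwarz lemma gives then
fixes the boundary point 1, the image of infinity, so it is trivial and the automorphism is
affine. The two limits determine its coefficients.\<close>

lemma uhp_automorphism_id:
  assumes hol: "\<phi> holomorphic_on upper_half_plane" and bij: "bij_betw \<phi> upper_half_plane upper_half_plane"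
    and inf: "((\<lambda>z. \<phi> z / z) \<longlongrightarrow> 1) at_inf_uhp" and zero: "(\<phi> \<longlongrightarrow> 0) at_0_uhp" and z: "z \<in> upper_half_plane"
  shows "\<phi> z = z"
proof -
  have iOm: "\<i> \<in> upper_half_plane" by (simp add: upper_half_plane_def)
  have im: "\<phi> ` upper_half_plane = upper_half_plane" and inj: "inj_on \<phi> upper_half_plane" using bij
      by (auto simp: bij_betw_def)
  define p q where "p = Re (\<phi> \<i>)" and "q = Im (\<phi> \<i>)"
  have q: "q > 0" using im iOm by (auto simp: q_def upper_half_plane_def)
  define \<psi> where "\<psi> z = (\<phi> z - of_real p) / of_real q" for z
  have phi: "\<phi> z = of_real q * \<psi> z + of_real p" for z using q by (simp add: \<psi>_def)
  have "bij_betw \<psi> upper_half_plane upper_half_plane"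
    unfolding bij_betw_def
  proof
    show "inj_on \<psi> upper_half_plane" using inj q by (auto simp: inj_on_def \<psi>_def)
    show "\<psi> ` upper_half_plane = upper_half_plane"
    proof (intro equalityI subsetI)
      fix w assume "w \<in> \<psi> ` upper_half_plane"
      then obtain z where "z \<in> upper_half_plane" "w = \<psi> z" by auto
      then have "Im (\<phi> z) > 0" using im by (auto simp: upper_half_plane_def)
      then show "w \<in> upper_half_plane" using q \<open>w = \<psi> z\<close> by (simp add: \<psi>_def upper_half_plane_def)
    next
      fix w assume "w \<in> upper_half_plane"
      then have "of_real q * w + of_real p \<in> upper_half_plane" using q by (simp add: upper_half_plane_def)
      then obtain z where "z \<in> upper_half_plane" "\<phi> z = of_real q * w + of_real p" using im by
          (metis imageE)
      then show "w \<in> \<psi> ` upper_half_plane" using q by (intro image_eqI[of _ _ z]) (auto simp: \<psi>_def)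
    qed
  qed
  moreover have "\<psi> holomorphic_on upper_half_plane" unfolding \<psi>_def using q by (intro
      holomorphic_intros hol) auto
  moreover have "\<phi> \<i> = of_real p + \<i> * of_real q" by (simp add: p_def q_def complex_eq_iff)
  then have "\<psi> \<i> = \<i>" using q by (simp add: \<psi>_def)
  ultimately obtain \<alpha> where a: "\<And>z. z \<in> upper_half_plane \<Longrightarrow> cayley (\<psi> z) = \<alpha> * cayley z"
    using uhp_automorphism_fix_i by blast
  have "filterlim (\<lambda>z. \<phi> z / z * z) at_infinity at_inf_uhp"
    by (rule tendsto_mult_filterlim_at_infinity[OF inf _ at_inf_uhp_at_infinity]) auto
  moreover have ev: "eventually (\<lambda>z. \<phi> z / z * z = \<phi> z) at_inf_uhp"
    using eventually_uhp_at_inf by eventually_elim (auto simp: upper_half_plane_def)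
  ultimately have phinf: "filterlim \<phi> at_infinity at_inf_uhp" using filterlim_cong[OF refl refl ev,
      of at_infinity] by blast
  have "filterlim (\<lambda>z. (1 / of_real q) * (- of_real p + \<phi> z)) at_infinity at_inf_uhp"
    using q by (intro tendsto_mult_filterlim_at_infinity[OF tendsto_const]
        tendsto_add_filterlim_at_infinity[OF tendsto_const] phinf) auto
  then have "filterlim \<psi> at_infinity at_inf_uhp" by (simp add: \<psi>_def[abs_def])
  from filterlim_compose[OF cayley_at_infinity this]
  have "((\<lambda>z. cayley (\<psi> z)) \<longlongrightarrow> 1) at_inf_uhp" .
  moreover have "((\<lambda>z. \<alpha> * cayley z) \<longlongrightarrow> \<alpha> * 1) at_inf_uhp"
    by (intro tendsto_intros filterlim_compose[OF cayley_at_infinity at_inf_uhp_at_infinity])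
  then have "((\<lambda>z. cayley (\<psi> z)) \<longlongrightarrow> \<alpha> * 1) at_inf_uhp"
    by (rule Lim_transform_eventually) (use eventually_uhp_at_inf in eventually_elim, simp add: a)
  ultimately have "\<alpha> = 1" using tendsto_unique[OF at_inf_uhp_nontrivial] by fastforce
  have psi: "\<psi> z = z" if "z \<in> upper_half_plane" for z
  proof -
    have "\<psi> z \<in> upper_half_plane" using \<open>bij_betw \<psi> upper_half_plane upper_half_plane\<close> that by (auto
        simp: bij_betw_def)
    then show ?thesis using a[OF that] \<open>\<alpha> = 1\<close> uncayley_cayley that by (metis mult_1)
  qed
  have "((\<lambda>z. of_real q + of_real p / z) \<longlongrightarrow> of_real q + 0) at_inf_uhp"
    by (intro tendsto_add tendsto_const tendsto_divide_0[OF tendsto_const at_inf_uhp_at_infinity])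
  then have "((\<lambda>z. \<phi> z / z) \<longlongrightarrow> of_real q + 0) at_inf_uhp"
    by (rule Lim_transform_eventually) (use eventually_uhp_at_inf in eventually_elim, auto simp: phi
        psi upper_half_plane_def add_divide_distrib)
  then have "complex_of_real q + 0 = 1" using inf by (rule tendsto_unique[OF at_inf_uhp_nontrivial])
  then have q1: "q = 1" by simp
  have "((\<lambda>z. of_real q * z + of_real p) \<longlongrightarrow> of_real q * 0 + of_real p) at_0_uhp" by (intro tendsto_intros)
  then have "(\<phi> \<longlongrightarrow> of_real q * 0 + of_real p) at_0_uhp"
    by (rule Lim_transform_eventually) (use eventually_uhp_at_0 in eventually_elim, simp add: phi psi)
  then have "complex_of_real q * 0 + of_real p = 0" using zero by (rule tendsto_unique[OF
      at_within_uhp_nontrivial, rotated]) simp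
  then show ?thesis using phi[of z] psi[OF z] q1 by simp
qed

section \<open>Uniqueness of the normalized map\<close>

lemma normalized_bounded:
  assumes "is_normalized_map k H" "d > 0"
  obtains B where "\<And>z. z \<in> upper_half_plane \<Longrightarrow> d \<le> norm z \<Longrightarrow> norm z \<le> R \<Longrightarrow> norm (H z) \<le> B"
proof -
  let ?K = "{z. Im z \<ge> 0} \<inter> (cball 0 R - ball 0 d)"
  have "compact ?K" by (intro closed_Int_compact closed_halfspace_Im_ge compact_diff) auto
  moreover have "continuous_on ?K H"
    using assms by (auto simp: is_normalized_map_def elim!: continuous_on_subset)
  ultimately have "bounded (H ` ?K)" by (intro compact_imp_bounded compact_continuous_image)
  then obtain B where "\<forall>w\<in>H ` ?K. norm w \<le> B" unfolding bounded_iff by blast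
  then show ?thesis using that[of B] by (auto simp: upper_half_plane_def)
qed

text \<open>Away from 0 and from infinity a normalized map is bounded, so only small points can be mapped far into the
channel and only large points far out in the rest of the domain.\<close>

lemma normalized_inverse_limits:
  assumes H: "is_normalized_map k H" and G: "\<And>z. z \<in> upper_half_plane \<Longrightarrow> G (H z) = z"
  shows "filterlim G at_infinity (infty2 k)" "(G \<longlongrightarrow> 0) (infty1 k)"
proof -
  have im: "H ` upper_half_plane = Pi_dom k" using H by (auto simp: is_normalized_map_def bij_betw_def)
  have ev0: "eventually (\<lambda>z. H z \<in> channel k) at_0_uhp"
    using H by (simp add: is_normalized_map_def infty1_def filterlim_inf filterlim_principal)
  have evinf: "eventually (\<lambda>z. H z \<in> Pi_dom k - channel k) at_inf_uhp"
    using H by (simp add: is_normalized_map_def infty2_def filterlim_inf filterlim_principal)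
  show "filterlim G at_infinity (infty2 k)"
    unfolding filterlim_at_infinity[OF order_refl]
  proof (intro allI impI)
    fix r :: real assume r: "r > 0"
    obtain d where d: "d > 0" "\<And>z. z \<in> upper_half_plane \<Longrightarrow> norm z < d \<Longrightarrow> H z \<in> channel k"
    proof -
      obtain d where "d > 0" "\<forall>z\<in>upper_half_plane. z \<noteq> 0 \<and> dist z 0 < d \<longrightarrow> H z \<in> channel k"
        using ev0 unfolding eventually_at by blast
      then show ?thesis using that[of d] by (force simp: upper_half_plane_def)
    qed
    obtain B where B: "\<And>z. z \<in> upper_half_plane \<Longrightarrow> d \<le> norm z \<Longrightarrow> norm z \<le> r \<Longrightarrow> norm (H z) \<le> B"
      using normalized_bounded[OF H d(1), of r] by metis
    have "eventually (\<lambda>w::complex. norm w > B) at_infinity"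
      unfolding eventually_at_infinity by (intro exI[of _ "B + 1"]) auto
    then show "eventually (\<lambda>w. r \<le> norm (G w)) (infty2 k)"
      unfolding infty2_def eventually_inf_principal
    proof eventually_elim
      case (elim w)
      show ?case
      proof
        assume w: "w \<in> Pi_dom k - channel k"
        then obtain z where z: "z \<in> upper_half_plane" "w = H z" using im by blast
        show "r \<le> norm (G w)" using z w elim d(2)[of z] B[of z] G[of z] by force
      qed
    qed
  qed
  show "(G \<longlongrightarrow> 0) (infty1 k)"
    unfolding tendsto_iff
  proof (intro allI impI)
    fix e :: real assume e: "e > 0"
    obtain R where R: "\<And>z. z \<in> upper_half_plane \<Longrightarrow> norm z \<ge> R \<Longrightarrow> H z \<in> Pi_dom k - channel k"
      using evinf unfolding eventually_inf_principal eventually_at_infinity by blast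
    obtain B where B: "\<And>z. z \<in> upper_half_plane \<Longrightarrow> e \<le> norm z \<Longrightarrow> norm z \<le> R \<Longrightarrow> norm (H z) \<le> B"
      using normalized_bounded[OF H e, of R] by metis
    have "eventually (\<lambda>w. Re w > B) (filtercomap Re at_top)"
      by (rule eventually_filtercomapI) (rule eventually_gt_at_top)
    then show "eventually (\<lambda>w. dist (G w) 0 < e) (infty1 k)"
      unfolding infty1_def eventually_inf_principal
    proof eventually_elim
      case (elim w)
      show ?case
      proof
        assume w: "w \<in> channel k"
        then obtain z where z: "z \<in> upper_half_plane" "w = H z" using im by (auto simp: channel_def)
        have "norm w > B" using elim complex_Re_le_cmod[of w] by linarith
        then show "dist (G w) 0 < e" using z w R[of z] B[of z] G[of z] by force
      qed
    qed
  qed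
qed

lemma normalized_map_unique:
  assumes H1: "is_normalized_map k H1" and H2: "is_normalized_map k H2" and z: "z \<in> upper_half_plane"
  shows "H1 z = H2 z"
proof -
  have im: "H1 ` upper_half_plane = Pi_dom k" "H2 ` upper_half_plane = Pi_dom k" and inj: "inj_on H1
      upper_half_plane" "inj_on H2 upper_half_plane"
    and hol: "H1 holomorphic_on upper_half_plane" "H2 holomorphic_on upper_half_plane"
    using H1 H2 by (auto simp: is_normalized_map_def bij_betw_def)
  obtain G where G: "G holomorphic_on (H2 ` upper_half_plane)" "\<And>z. z \<in> upper_half_plane \<Longrightarrow> G (H2 z) = z"
    using holomorphic_has_inverse[OF hol(2) open_uhp inj(2)] by metis
  have H2G: "H2 (G w) = w" "G w \<in> upper_half_plane" if "w \<in> Pi_dom k" for w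
    using that im(2) G(2) by force+
  define \<phi> where "\<phi> = G \<circ> H1"
  have H12: "H2 (\<phi> z) = H1 z" "\<phi> z \<in> upper_half_plane" if "z \<in> upper_half_plane" for z
    using H2G[of "H1 z"] im that by (auto simp: \<phi>_def)
  have l1: "filterlim H1 (infty1 k) at_0_uhp" "filterlim H1 (infty2 k) at_inf_uhp" "((\<lambda>z. H1 z / z)
      \<longlongrightarrow> 1) at_inf_uhp"
    and l2: "((\<lambda>z. H2 z / z) \<longlongrightarrow> 1) at_inf_uhp"
    using H1 H2 by (auto simp: is_normalized_map_def)
  have "\<phi> z = z"
  proof (rule uhp_automorphism_id[OF _ _ _ _ z])
    show "\<phi> holomorphic_on upper_half_plane" unfolding \<phi>_def
      using G(1) im by (intro holomorphic_on_compose_gen[OF hol(1)]) auto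
    show "bij_betw \<phi> upper_half_plane upper_half_plane"
      unfolding bij_betw_def
    proof
      show "inj_on \<phi> upper_half_plane" using H12 inj(1) by (metis inj_on_def)
      show "\<phi> ` upper_half_plane = upper_half_plane"
      proof (intro equalityI subsetI)
        fix w assume w: "w \<in> upper_half_plane"
        then obtain v where v: "v \<in> upper_half_plane" "H1 v = H2 w" using im by (metis imageE imageI)
        then show "w \<in> \<phi> ` upper_half_plane" using G(2)[OF w] by (intro image_eqI[of _ _ v]) (auto
            simp: \<phi>_def)
      qed (use H12 in auto)
    qed
    show "(\<phi> \<longlongrightarrow> 0) at_0_uhp" unfolding \<phi>_def o_def
      by (rule filterlim_compose[OF normalized_inverse_limits(2)[OF H2 G(2)] l1(1)])
    have "filterlim \<phi> at_infinity at_inf_uhp" unfolding \<phi>_def o_def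
      by (rule filterlim_compose[OF normalized_inverse_limits(1)[OF H2 G(2)] l1(2)])
    then have "filterlim \<phi> at_inf_uhp at_inf_uhp"
      unfolding filterlim_inf filterlim_principal using eventually_uhp_at_inf H12 by (auto elim:
          eventually_mono)
    from filterlim_compose[OF l2 this]
    have "((\<lambda>z. (H1 z / z) / (H2 (\<phi> z) / \<phi> z)) \<longlongrightarrow> 1 / 1) at_inf_uhp"
      by (intro tendsto_divide l1) auto
    then have "((\<lambda>z. (H1 z / z) / (H2 (\<phi> z) / \<phi> z)) \<longlongrightarrow> 1) at_inf_uhp" by simp
    then show "((\<lambda>z. \<phi> z / z) \<longlongrightarrow> 1) at_inf_uhp"
    proof (rule Lim_transform_eventually)
      show "eventually (\<lambda>z. (H1 z / z) / (H2 (\<phi> z) / \<phi> z) = \<phi> z / z) at_inf_uhp"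
        using eventually_uhp_at_inf
      proof eventually_elim
        case (elim z)
        then have "H1 z \<in> upper_half_plane" using im by (auto simp: Pi_dom_barrier)
        then have "H1 z \<noteq> 0" by (auto simp: upper_half_plane_def)
        then show ?case using H12[OF elim] by simp
      qed
    qed
  qed
  then show ?thesis using H12(1)[OF z] by simp
qed

lemma H_map_eq_explicit_map:
  assumes k: "k > 1/2" and z: "z \<in> closed_uhp0"
  shows "H_map k z = explicit_map k z"
proof -
  have n: "is_normalized_map k (H_map k)"
    unfolding H_map_def by (rule someI[of "is_normalized_map k", OF explicit_map_normalized[OF k]])
  have e: "H_map k z = explicit_map k z" if "z \<in> upper_half_plane" for z
    by (rule normalized_map_unique[OF n explicit_map_normalized[OF k] that])
  have c: "continuous_on closed_uhp0 (H_map k)" using n by (simp add: is_normalized_map_def)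
  have "norm (H_map k z - explicit_map k z) \<le> 0"
  proof (rule le_on_boundary[where f = "\<lambda>z. norm (H_map k z - explicit_map k z)" and g = "\<lambda>_. 0"])
    show "eventually (\<lambda>z. norm (H_map k z - explicit_map k z) \<le> 0) (at z within upper_half_plane)"
      unfolding eventually_at_filter using e by auto
  qed (use z c explicit_map_continuous_on[OF k] in \<open>auto intro!: continuous_intros\<close>)
  then show ?thesis by simp
qed

section \<open>A Schwarz integral formula for the half-plane\<close>

lemma interior_closed_uhp: "interior {z. Im z \<ge> 0} = upper_half_plane"
proof -
  have "{z. Im z \<ge> 0} = {z. 0 \<le> \<i> \<bullet> z}" "upper_half_plane = {z. 0 < \<i> \<bullet> z}"
    by (auto simp: upper_half_plane_def inner_complex_def)
  then show ?thesis using interior_halfspace_ge[of \<i> 0] by simp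
qed

lemma half_disc_base_integral:
  fixes f :: "complex \<Rightarrow> complex"
  assumes cont: "continuous_on {z. Im z \<ge> 0} f" and hol: "f holomorphic_on upper_half_plane" and R: "R > 0"
    and B: "B \<ge> 0" "\<And>z. z \<in> upper_half_plane \<Longrightarrow> norm z = R \<Longrightarrow> norm (f z) \<le> B"
  obtains I where "((\<lambda>t. f (of_real t)) has_integral I) {-R..R}" "norm I \<le> B * R * pi"
proof -
  let ?l = "linepath (of_real (-R)) (of_real R)" and ?c = "part_circlepath 0 R 0 pi"
  have arc: "path_image ?c = (\<lambda>x. of_real R * cis x) ` {0..pi}"
    by (simp add: path_image_part_circlepath' closed_segment_eq_real_ivl)
  have arcH: "path_image ?c \<subseteq> {z. Im z \<ge> 0}"
    unfolding arc using R sin_ge_zero by auto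
  have lineH: "path_image ?l \<subseteq> {z. Im z \<ge> 0}"
    unfolding path_image_linepath
    by (rule closed_segment_subset) (auto simp: convex_halfspace_Im_ge)
  have il: "f contour_integrable_on ?l"
    using cont lineH by (intro contour_integrable_continuous_linepath) (auto elim: continuous_on_subset)
  have ic: "f contour_integrable_on ?c"
    using cont arcH by (intro contour_integrable_continuous_part_circlepath) (auto elim:
        continuous_on_subset)
  have "(f has_contour_integral 0) (?l +++ ?c)"
  proof (rule Cauchy_theorem_convex[where S = "{z. Im z \<ge> 0}" and K = "{}"])
    show "f field_differentiable at x" if "x \<in> interior {z. Im z \<ge> 0} - {}" for x
      using hol that interior_closed_uhp open_uhp holomorphic_on_imp_differentiable_at by simp
    show "path_image (?l +++ ?c) \<subseteq> {z. Im z \<ge> 0}"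
      using arcH lineH by (simp add: path_image_join)
  qed (use cont in \<open>auto simp: convex_halfspace_Im_ge valid_path_join exp_pi_i' mult.commute[of \<i>]\<close>)
  then have "contour_integral ?l f + contour_integral ?c f = 0"
    using il ic contour_integral_join[OF il ic] by (simp add: contour_integral_unique)
  then have "norm (contour_integral ?l f) = norm (contour_integral ?c f)"
    by (metis add_eq_0_iff norm_minus_cancel)
  also have "\<dots> \<le> B * R * (pi - 0)"
  proof (rule has_contour_integral_bound_part_circlepath_strong[where k = "{of_real R, - of_real R}"])
    show "(f has_contour_integral contour_integral ?c f) ?c" using ic by (rule
        has_contour_integral_integral)
    fix x assume x: "x \<in> path_image ?c - {of_real R, - of_real R}"
    then obtain th where th: "0 \<le> th" "th \<le> pi" "x = of_real R * cis th" unfolding arc by auto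
    have "th \<noteq> 0" "th \<noteq> pi" using x th(3) by auto
    then have "sin th > 0" using th by (intro sin_gt_zero) auto
    then show "norm (f x) \<le> B"
      using R by (intro B(2)) (auto simp: th(3) norm_mult upper_half_plane_def)
  qed (use B R in auto)
  finally have bd: "norm (contour_integral ?l f) \<le> B * R * pi" by simp
  have "(f has_contour_integral contour_integral ?l f) ?l" using il by (rule has_contour_integral_integral)
  then have "((\<lambda>t. f (of_real t)) has_integral contour_integral ?l f) {-R..R}"
    using R by (subst (asm) has_contour_integral_linepath_Reals_iff) auto
  then show ?thesis using bd that by blast
qed

lemma integrable_abs_powr:
  assumes "R \<ge> 0" "p > (-1::real)"
  shows "(\<lambda>t::real. \<bar>t\<bar> powr p) integrable_on {-R..R}"
proof (rule Henstock_Kurzweil_Integration.integrable_combine[of "-R" 0 R])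
  have 1: "(\<lambda>t. \<bar>t\<bar> powr p) integrable_on {0..R}"
    using integrable_on_powr_from_0[OF assms(2,1)] by (rule integrable_eq) auto
  then show "(\<lambda>t. \<bar>t\<bar> powr p) integrable_on {0..R}" .
  show "(\<lambda>t. \<bar>t\<bar> powr p) integrable_on {-R..0}"
    using Henstock_Kurzweil_Integration.integrable_reflect_real[where f = "\<lambda>t. \<bar>t\<bar> powr p" and a = 0
        and b = R] 1 by simp
qed (use assms in auto)

text \<open>An integrable singularity at 0 does no harm to the integral over the base of the half-disc: the factor
\<open>z / (z + i \<epsilon>)\<close>, of modulus at most 1 in the closed half-plane, removes it, and tends to 1 as \<open>\<epsilon> \<rightarrow> 0\<close>.\<close>

lemma half_disc_base_integral_singular:
  fixes q :: "complex \<Rightarrow> complex"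
  assumes cont: "continuous_on closed_uhp0 q" and hol: "q holomorphic_on upper_half_plane" and R: "R > 0"
    and B: "B \<ge> 0" "\<And>z. z \<in> upper_half_plane \<Longrightarrow> norm z = R \<Longrightarrow> norm (q z) \<le> B"
    and zero: "d > 0" "\<And>z. z \<in> closed_uhp0 \<Longrightarrow> norm z < d \<Longrightarrow> norm (q z) \<le> C * norm z powr (-1/2)"
  obtains I where "((\<lambda>t. q (of_real t)) has_integral I) {-R..R}" "norm I \<le> B * R * pi"
proof -
  \<comment> \<open>the value 0 at 0 makes \<open>f e\<close> continuous there\<close>
  define f where "f e z = (if z = 0 then 0 else q z * (z / (z + \<i> * of_real e)))" for e z
  have zi: "norm z \<le> norm (z + \<i> * of_real e)" if "Im z \<ge> 0" "e > 0" for z e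
    using norm_ge_segment_up(3)[OF that(1), of "z + \<i> * of_real e" e] that(2) by simp
  have zi0: "z + \<i> * of_real e \<noteq> 0" if "Im z \<ge> 0" "e > 0" for z e
    using that by (auto simp: complex_eq_iff)
  have fq: "norm (f e z) \<le> norm (q z)" if "z \<in> closed_uhp0" "e > 0" for e z
  proof -
    have "norm (z / (z + \<i> * of_real e)) \<le> 1" using zi[of z e] zi0[of z e] that by (auto simp:
        norm_divide divide_le_eq_1)
    then have "norm (q z * (z / (z + \<i> * of_real e))) \<le> norm (q z)"
      unfolding norm_mult[of "q z"] by (intro mult_left_le) auto
    then show ?thesis using that by (simp add: f_def)
  qed
  have fcont: "continuous_on {z. Im z \<ge> 0} (f e)" if e: "e > 0" for e
    unfolding continuous_on_def
  proof
    fix z :: complex assume z: "z \<in> {z. Im z \<ge> 0}"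
    show "(f e \<longlongrightarrow> f e z) (at z within {z. Im z \<ge> 0})"
    proof (cases "z = 0")
      case True
      have "(f e \<longlongrightarrow> 0) (at 0 within {z. Im z \<ge> 0})"
      proof (rule Lim_null_comparison)
        have "eventually (\<lambda>z. z \<in> ball 0 d) (at 0 within {z. Im z \<ge> 0})"
          unfolding eventually_at using zero(1) by (intro exI[of _ d]) (auto simp: dist_commute)
        moreover have "eventually (\<lambda>z. z \<in> closed_uhp0) (at 0 within {z. Im z \<ge> 0})"
          by (auto simp: eventually_at_filter)
        ultimately show "eventually (\<lambda>z. norm (f e z) \<le> \<bar>C\<bar> * norm z powr (1/2) / e) (at 0 within
            {z. Im z \<ge> 0})"
        proof eventually_elim
          case (elim z)
          have "norm (z + \<i> * of_real e) \<ge> \<bar>Im (z + \<i> * of_real e)\<bar>" by (rule abs_Im_le_cmod)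
          then have ge: "norm (z + \<i> * of_real e) \<ge> e" using elim e by simp
          have "norm (f e z) = norm (q z) * (norm z / norm (z + \<i> * of_real e))"
            using elim by (simp add: f_def norm_mult norm_divide)
          also have "\<dots> \<le> (\<bar>C\<bar> * norm z powr (-1/2)) * (norm z / e)"
          proof (intro mult_mono divide_left_mono)
            have "C * norm z powr (-1/2) \<le> \<bar>C\<bar> * norm z powr (-1/2)" by (intro mult_right_mono) auto
            then show "norm (q z) \<le> \<bar>C\<bar> * norm z powr (-1/2)"
              using elim by (intro order_trans[OF zero(2)]) auto
          qed (use ge e in \<open>auto intro!: mult_pos_pos\<close>)
          also have "\<dots> = \<bar>C\<bar> * (norm z * norm z powr (-1/2)) / e" by simp
          also have "norm z * norm z powr (-1/2) = norm z powr (1/2)"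
            by (subst powr_mult_base) auto
          finally show ?case .
        qed
        have "((\<lambda>z::complex. \<bar>C\<bar> * norm z powr (1/2) / e) \<longlongrightarrow> \<bar>C\<bar> * norm (0::complex) powr (1/2) / e)
            (at 0 within {z. Im z \<ge> 0})"
          using e by (intro tendsto_intros tendsto_powr2) auto
        then show "((\<lambda>z::complex. \<bar>C\<bar> * norm z powr (1/2) / e) \<longlongrightarrow> 0) (at 0 within {z. Im z \<ge> 0})" by simp
      qed
      then show ?thesis using True by (simp add: f_def)
    next
      case False
      then have z': "z \<in> closed_uhp0" using z by auto
      have "continuous_on closed_uhp0 (\<lambda>z. q z * (z / (z + \<i> * of_real e)))"
        using zi0 e by (intro continuous_intros cont) auto
      then have n1: "((\<lambda>z. q z * (z / (z + \<i> * of_real e))) \<longlongrightarrow> f e z) (at z within closed_uhp0)"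
        using z' False by (simp add: continuous_on_def f_def)
      have n2: "at z within closed_uhp0 = at z within {z. Im z \<ge> 0}"
        using False by (intro at_within_nhd[of _ "- {0}"]) auto
      have n3: "eventually (\<lambda>z. q z * (z / (z + \<i> * of_real e)) = f e z) (at z within closed_uhp0)"
        by (auto simp: eventually_at_filter f_def)
      from Lim_transform_eventually[OF n1 n3] show ?thesis unfolding n2 .
    qed
  qed
  have fhol: "f e holomorphic_on upper_half_plane" if e: "e > 0" for e
  proof -
    have "(\<lambda>z. q z * (z / (z + \<i> * of_real e))) holomorphic_on upper_half_plane"
      using zi0 e by (intro holomorphic_intros hol) (auto simp: upper_half_plane_def)
    then show ?thesis by (rule holomorphic_transform) (auto simp: f_def upper_half_plane_def)
  qed
  have "\<exists>I. ((\<lambda>t. f e (of_real t)) has_integral I) {-R..R} \<and> norm I \<le> B * R * pi" if e: "e > 0" for e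
  proof -
    have b: "norm (f e z) \<le> B" if "z \<in> upper_half_plane" "norm z = R" for z
      using fq[of z e] B(2)[OF that] that e R uhp_subset(1) by (auto intro: order_trans)
    show ?thesis
      by (rule half_disc_base_integral[OF fcont[OF e] fhol[OF e] R B(1) b]) blast+
  qed
  then obtain J where J: "\<And>e. e > 0 \<Longrightarrow> ((\<lambda>t. f e (of_real t)) has_integral J e) {-R..R}"
    "\<And>e. e > 0 \<Longrightarrow> norm (J e) \<le> B * R * pi" by metis
  obtain M where M: "M \<ge> 0" "\<And>t::real. \<bar>t\<bar> \<le> R \<Longrightarrow> d \<le> \<bar>t\<bar> \<Longrightarrow> norm (q (of_real t)) \<le> M"
  proof -
    let ?K = "{-R..R} - {-d<..<d}"
    have "compact ?K" by (intro compact_diff) auto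
    moreover have "continuous_on ?K (\<lambda>t. q (of_real t))"
      using zero(1) by (intro continuous_on_compose2[OF cont] continuous_intros) auto
    ultimately have "bounded ((\<lambda>t. q (of_real t)) ` ?K)" by (intro compact_imp_bounded
        compact_continuous_image)
    then obtain M where M: "\<forall>x\<in>?K. norm (q (of_real x)) \<le> M" unfolding bounded_iff by blast
    have "norm (q (of_real t)) \<le> \<bar>M\<bar>" if "\<bar>t\<bar> \<le> R" "d \<le> \<bar>t\<bar>" for t :: real
    proof -
      have "t \<in> ?K" using that by auto
      then have "norm (q (of_real t)) \<le> M" using M by blast
      then show ?thesis by linarith
    qed
    then show ?thesis using that[of "\<bar>M\<bar>"] by simp
  qed
  let ?g = "\<lambda>t. if t = 0 then 0 else q (of_real t)"
  let ?f = "\<lambda>n t. f (1 / real (Suc n)) (complex_of_real t)"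
  let ?h = "\<lambda>t. M + \<bar>C\<bar> * \<bar>t\<bar> powr (-1/2)"
  have conv: "?g integrable_on {-R..R}" "(\<lambda>n. integral {-R..R} (?f n)) \<longlonglongrightarrow> integral {-R..R} ?g"
  proof -
    have fi: "?f n integrable_on {-R..R}" for n using J(1)[of "1 / real (Suc n)"] by (auto simp:
        integrable_on_def)
    have hi: "?h integrable_on {-R..R}"
      using R by (intro integrable_add integrable_on_mult_right integrable_abs_powr) auto
    have le: "norm (?f n t) \<le> ?h t" if t: "t \<in> {-R..R}" for n t
    proof (cases "t = 0")
      case False
      then have "norm (?f n t) \<le> norm (q (of_real t))" by (intro fq) auto
      also have "\<dots> \<le> ?h t"
      proof (cases "\<bar>t\<bar> < d")
        case True
        then have "norm (q (of_real t)) \<le> C * \<bar>t\<bar> powr (-1/2)" using zero(2)[of "of_real t"] False by simp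
        also have "\<dots> \<le> \<bar>C\<bar> * \<bar>t\<bar> powr (-1/2)" by (intro mult_right_mono) auto
        finally show ?thesis using M(1) by simp
      next
        case False
        then have "norm (q (of_real t)) \<le> M" using t by (intro M(2)) auto
        then show ?thesis by (simp add: add_increasing2)
      qed
      finally show ?thesis .
    qed (use M(1) in \<open>simp add: f_def\<close>)
    have lim: "(\<lambda>n. ?f n t) \<longlonglongrightarrow> ?g t" if "t \<in> {-R..R}" for t
    proof (cases "t = 0")
      case False
      have "(\<lambda>n. 1 / real (Suc n)) \<longlonglongrightarrow> 0" by real_asymp
      then have "(\<lambda>n. q (of_real t) * (of_real t / (of_real t + \<i> * of_real (1 / real (Suc n))))) \<longlonglongrightarrow>
         q (of_real t) * (of_real t / (of_real t + \<i> * of_real 0))"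
        using False by (intro tendsto_intros) auto
      then show ?thesis using False by (simp add: f_def)
    qed (simp add: f_def)
    show "?g integrable_on {-R..R}" "(\<lambda>n. integral {-R..R} (?f n)) \<longlonglongrightarrow> integral {-R..R} ?g"
      using dominated_convergence[where f = ?f and h = ?h and g = ?g, OF fi hi le lim] by auto
  qed
  have "norm (integral {-R..R} ?g) \<le> B * R * pi"
  proof (rule LIMSEQ_le_const2[OF tendsto_norm[OF conv(2)]])
    show "\<exists>N. \<forall>n\<ge>N. norm (integral {-R..R} (?f n)) \<le> B * R * pi"
    proof (intro exI allI impI)
      fix n :: nat
      have "1 / real (Suc n) > 0" by simp
      from integral_unique[OF J(1)[OF this]] J(2)[OF this]
      show "norm (integral {-R..R} (?f n)) \<le> B * R * pi" by simp
    qed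
  qed
  moreover have "((\<lambda>t. q (of_real t)) has_integral integral {-R..R} ?g) {-R..R}"
    by (rule has_integral_spike_finite[OF _ _ integrable_integral[OF conv(1)], of "{0}"]) auto
  ultimately show ?thesis using that by blast
qed

text \<open>Let \<open>r = Q (-D)\<close>, which is real. Cauchy's theorem is applied to \<open>q = (Q - r h) / (z + D)\<close> with
\<open>h z = i / (z + D + i)\<close>. As \<open>h (-D) = 1\<close>, there is no pole at \<open>-D\<close>; as \<open>Q\<close> and \<open>h\<close> tend to 0, the
half-circles contribute nothing in the limit. On the real axis \<open>Im h / (t + D) = 1 / (1 + (t + D)^2)\<close>, whose
integral is \<open>pi\<close>, so the vanishing of the imaginary part is the formula.\<close>

lemma half_plane_schwarz_integral:
  fixes Q :: "complex \<Rightarrow> complex" and D :: real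
  assumes U: "open U" "closed_uhp0 \<subseteq> U" and hol: "Q holomorphic_on U"
    and lim: "(Q \<longlongrightarrow> 0) at_inf_uhp"
    and zero: "d > 0" "\<And>z. z \<in> closed_uhp0 \<Longrightarrow> norm z < d \<Longrightarrow> norm (Q z) \<le> C * norm z powr (-1/2)"
    and neg: "\<And>t. t < 0 \<Longrightarrow> Im (Q (of_real t)) = 0" and pos: "\<And>t. t > 0 \<Longrightarrow> Im (Q (of_real t)) \<le> 0"
    and D: "D > 0"
  shows "((\<lambda>t. Im (Q (of_real t)) / (t + D)) has_integral pi * Re (Q (- of_real D))) {0<..}"
proof -
  define r where "r = Re (Q (- of_real D))"
  have QD: "Q (- of_real D) = of_real r" using neg[of "-D"] D by (simp add: r_def complex_eq_iff)
  define h where "h z = \<i> / (z + of_real D + \<i>)" for z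
  define V where "V = U \<inter> {z. Im z > -1}"
  have V: "open V" "closed_uhp0 \<subseteq> V" unfolding V_def using U by (auto simp: open_Int open_halfspace_Im_gt)
  define P where "P z = Q z - of_real r * h z" for z
  have "z + of_real D + \<i> \<noteq> 0" if "z \<in> V" for z using that by (auto simp: V_def complex_eq_iff)
  then have "P holomorphic_on V" unfolding P_def h_def
    by (intro holomorphic_intros holomorphic_on_subset[OF hol]) (auto simp: V_def)
  define q where "q z = (if z = - of_real D then deriv P (- of_real D) else (P z - P (- of_real D))
      / (z - (- of_real D)))" for z
  have qV: "q holomorphic_on V"
    unfolding q_def[abs_def] by (rule pole_lemma_open[OF \<open>P holomorphic_on V\<close> V(1)])
  have P0: "P (- of_real D) = 0" by (simp add: P_def QD h_def)
  have q: "q z = (Q z - of_real r * h z) / (z + of_real D)" if "z \<noteq> - of_real D" for z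
    using that by (simp add: q_def P0) (simp add: P_def)
  have qc: "continuous_on closed_uhp0 q" and qh: "q holomorphic_on upper_half_plane"
    using qV V(2) uhp_subset(1) by (meson holomorphic_on_imp_continuous_on holomorphic_on_subset
        order_trans)+
  have "\<exists>d'>0. \<exists>C'. \<forall>z\<in>closed_uhp0. norm z < d' \<longrightarrow> norm (q z) \<le> C' * norm z powr (-1/2)"
  proof (intro exI conjI ballI impI)
    \<comment> \<open>\<open>|z| < 1\<close> lets \<open>|z|^(-1/2)\<close> absorb constants, and \<open>|z| < D/2\<close> keeps \<open>z + D\<close> away from 0\<close>
    show "min d (min 1 (D/2)) > 0" using zero(1) D by simp
    fix z assume z: "z \<in> closed_uhp0" "norm z < min d (min 1 (D/2))"
    have "norm (complex_of_real D) \<le> norm (z + of_real D) + norm z"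
      using norm_triangle_ineq4[of "z + of_real D" z] by simp
    then have zD: "norm (z + of_real D) \<ge> D/2" using z D by simp
    have "1 \<le> \<bar>Im (z + of_real D + \<i>)\<bar>" using z by simp
    also have "\<dots> \<le> norm (z + of_real D + \<i>)" by (rule abs_Im_le_cmod)
    finally have h1: "norm (h z) \<le> 1" by (auto simp: h_def norm_divide divide_le_eq_1)
    have p1: "1 \<le> norm z powr (-1/2)"
    proof -
      have "1 powr (-1/2) \<le> norm z powr (-1/2)" using z by (intro powr_mono2') auto
      then show ?thesis by simp
    qed
    have "norm (Q z - of_real r * h z) \<le> norm (Q z) + \<bar>r\<bar> * norm (h z)"
      using norm_triangle_ineq4[of "Q z" "of_real r * h z"] by (simp add: norm_mult)
    also have "\<dots> \<le> C * norm z powr (-1/2) + \<bar>r\<bar> * norm z powr (-1/2)"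
      using zero(2)[OF z(1)] z h1 p1 by (intro add_mono mult_left_mono) auto
    finally have 1: "norm (Q z - of_real r * h z) \<le> (C + \<bar>r\<bar>) * norm z powr (-1/2)"
      by (simp add: algebra_simps)
    have "z \<noteq> - of_real D" using zD D by auto
    then have "norm (q z) = norm (Q z - of_real r * h z) / norm (z + of_real D)" by (simp add: q
        norm_divide)
    also have "\<dots> \<le> (C + \<bar>r\<bar>) * norm z powr (-1/2) / (D/2)"
      using 1 zD D by (intro frac_le order_trans[OF norm_ge_zero 1]) auto
    also have "\<dots> = ((C + \<bar>r\<bar>) / (D/2)) * norm z powr (-1/2)" by simp
    finally show "norm (q z) \<le> ((C + \<bar>r\<bar>) / (D/2)) * norm z powr (-1/2)" .
  qed
  then obtain d' C' where zero': "d' > 0" "\<And>z. z \<in> closed_uhp0 \<Longrightarrow> norm z < d' \<Longrightarrow> norm (q z) \<le> C' *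
      norm z powr (-1/2)"
    by blast
  have I: "\<exists>R1>0. \<forall>R\<ge>R1. \<exists>I. ((\<lambda>t. q (of_real t)) has_integral I) {-R..R} \<and> norm I \<le> 4 * e * pi"
    if e: "e > 0" for e
  proof -
    have "eventually (\<lambda>z. dist (Q z) 0 < e) at_inf_uhp" using lim e unfolding tendsto_iff by blast
    then obtain R0 where R0: "\<And>z. z \<in> upper_half_plane \<Longrightarrow> norm z \<ge> R0 \<Longrightarrow> norm (Q z) < e"
      unfolding eventually_inf_principal eventually_at_infinity by auto
    \<comment> \<open>the three conditions give \<open>|Q| < e\<close>, \<open>|z + D| \<ge> R/2\<close> and \<open>|r h| \<le> e\<close> on the half-circle\<close>
    define R1 where "R1 = max R0 (max (2 * D) (2 * \<bar>r\<bar> / e))"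
    show ?thesis
    proof (intro exI[of _ R1] conjI allI impI)
      show "R1 > 0" using D by (auto simp: R1_def)
      fix R assume "R \<ge> R1"
      then have R: "R \<ge> R0" "R \<ge> 2 * D" "2 * \<bar>r\<bar> / e \<le> R" "R > 0" using D by (auto simp: R1_def)
      have b: "norm (q z) \<le> 4 * e / R" if z: "z \<in> upper_half_plane" "norm z = R" for z
      proof -
        have "norm z \<le> norm (z + of_real D) + norm (complex_of_real D)"
          using norm_triangle_ineq4[of "z + of_real D" "of_real D"] by simp
        then have zD: "norm (z + of_real D) \<ge> R/2" using z R D by simp
        then have z0: "z \<noteq> - of_real D" using R by auto
        have "norm (z + of_real D + \<i> * of_real 1) \<ge> norm (z + of_real D)"
          using norm_ge_segment_up(3)[of "z + of_real D" "z + of_real D + \<i> * of_real 1" 1] z by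
              (simp add: upper_half_plane_def)
        then have "norm (z + of_real D + \<i>) \<ge> R/2" using zD by simp
        then have "norm (h z) \<le> 1 / (R/2)" unfolding h_def norm_divide using R by (intro frac_le) auto
        then have "\<bar>r\<bar> * norm (h z) \<le> \<bar>r\<bar> * (1 / (R/2))" by (intro mult_left_mono) auto
        also have "\<dots> \<le> e" using R e by (simp add: field_simps)
        finally have "norm (Q z - of_real r * h z) \<le> 2 * e"
          using norm_triangle_ineq4[of "Q z" "of_real r * h z"] R0[OF z(1)] z(2) R by (simp add: norm_mult)
        then have "norm (Q z - of_real r * h z) / norm (z + of_real D) \<le> 2 * e / (R/2)"
          using zD R e by (intro frac_le) auto
        then show ?thesis using z0 by (simp add: q norm_divide)
      qed
      obtain I where "((\<lambda>t. q (of_real t)) has_integral I) {-R..R}" "norm I \<le> 4 * e / R * R * pi"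
        using half_disc_base_integral_singular[OF qc qh R(4) _ b zero'] e R(4) by (metis
            divide_nonneg_pos less_imp_le mult_nonneg_nonneg zero_le_numeral)
      then show "\<exists>I. ((\<lambda>t. q (of_real t)) has_integral I) {-R..R} \<and> norm I \<le> 4 * e * pi"
        using R(4) by auto
    qed
  qed
  \<comment> \<open>the integrand of the claim, extended by 0, since its value at 0 is unspecified\<close>
  define F where "F t = (if t > 0 then Im (Q (of_real t)) / (t + D) else 0)" for t
  define A where "A R = arctan (R + D) + arctan (R - D)" for R
  have Imq: "Im (q (of_real t)) = F t - r * (1 / (1 + (t + D)\<^sup>2))" if t: "t \<noteq> 0" "t \<noteq> - D" for t
  proof -
    have s: "t + D \<noteq> 0" using t by simp
    have "complex_of_real t \<noteq> - of_real D" using t(2) by (metis of_real_eq_iff of_real_minus)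
    then have "q (of_real t) = (Q (of_real t) - of_real r * h (of_real t)) / of_real (t + D)" by
        (simp add: q)
    then have "Im (q (of_real t)) = (Im (Q (of_real t)) - r * Im (h (of_real t))) / (t + D)" by
        (simp only: Im_divide_of_real) simp
    also have "Im (h (of_real t)) = (t + D) / (1 + (t + D)\<^sup>2)"
      by (simp add: h_def Im_divide add.commute)
    also have "(Im (Q (of_real t)) - r * ((t + D) / (1 + (t + D)\<^sup>2))) / (t + D) = Im (Q (of_real t))
        / (t + D) - r * (1 / (1 + (t + D)\<^sup>2))"
      using s by (simp add: diff_divide_distrib)
    also have "Im (Q (of_real t)) / (t + D) = F t" using neg[of t] t by (auto simp: F_def)
    finally show ?thesis .
  qed
  have FI: "\<exists>J. (F has_integral (J + r * A R)) {0..R} \<and> \<bar>J\<bar> \<le> 4 * e * pi"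
    if "((\<lambda>t. q (of_real t)) has_integral I) {-R..R}" "norm I \<le> 4 * e * pi" "R > 0" for I R e
  proof -
    have "((\<lambda>t. Im (q (of_real t))) has_integral Im I) {-R..R}" using that(1) by (rule has_integral_Im)
    then have "((\<lambda>t. F t - r * (1 / (1 + (t + D)\<^sup>2))) has_integral Im I) {-R..R}"
      by (rule has_integral_spike_finite[of "{0, -D}", rotated 2]) (auto simp: Imq)
    moreover have "((\<lambda>t. r * (1 / (1 + (t + D)\<^sup>2))) has_integral r * (arctan (R + D) - arctan (- R +
        D))) {-R..R}"
      using that(3)
      by (intro has_integral_mult_right fundamental_theorem_of_calculus)
         (auto intro!: derivative_eq_intros simp: field_simps simp flip:
             has_real_derivative_iff_has_vector_derivative)
    ultimately have "((\<lambda>t. F t - r * (1 / (1 + (t + D)\<^sup>2)) + r * (1 / (1 + (t + D)\<^sup>2))) has_integral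
        (Im I + r * (arctan (R + D) - arctan (- R + D)))) {-R..R}"
      by (rule has_integral_add)
    moreover have "arctan (- R + D) = - arctan (R - D)" using arctan_minus[of "R - D"] by simp
    ultimately have "(F has_integral (Im I + r * A R)) {-R..R}" by (simp add: A_def)
    then have "(F has_integral (Im I + r * A R)) {0..R}"
    proof (subst has_integral_spike_set_eq[of _ "{-R..R}"])
      have e: "{x \<in> {0..R} - {-R..R}. F x \<noteq> 0} = {}" "{x \<in> {-R..R} - {0..R}. F x \<noteq> 0} = {}"
        by (auto simp: F_def)
      show "negligible {x \<in> {0..R} - {-R..R}. F x \<noteq> 0}" "negligible {x \<in> {-R..R} - {0..R}. F x \<noteq> 0}"
        unfolding e by auto
    qed
    moreover have "\<bar>Im I\<bar> \<le> 4 * e * pi" using abs_Im_le_cmod[of I] that(2) by linarith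
    ultimately show ?thesis by blast
  qed
  have Fint: "F integrable_on {0..y}" for y
  proof -
    obtain R1 where R1: "R1 > 0" "\<And>R. R \<ge> R1 \<Longrightarrow> \<exists>I. ((\<lambda>t. q (of_real t)) has_integral I) {-R..R} \<and>
        norm I \<le> 4 * 1 * pi"
      using I[OF zero_less_one] by blast
    define R where "R = max R1 y"
    have R: "R \<ge> R1" "R > 0" using R1(1) by (auto simp: R_def)
    obtain I where "((\<lambda>t. q (of_real t)) has_integral I) {-R..R}" "norm I \<le> 4 * 1 * pi"
      using R1(2)[OF R(1)] by blast
    from FI[OF this R(2)] obtain J where "(F has_integral (J + r * A R)) {0..R}" by blast
    then show ?thesis by (rule integrable_on_subinterval[OF has_integral_integrable]) (auto simp: R_def)
  qed
  have Alim: "((\<lambda>R. r * A R) \<longlongrightarrow> r * pi) at_top"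
  proof -
    have "((\<lambda>R. arctan (R + D) + arctan (R - D)) \<longlongrightarrow> pi/2 + pi/2) at_top"
    proof (intro tendsto_add filterlim_compose[OF tendsto_arctan_at_top])
      show "filterlim (\<lambda>R. R + D) at_top at_top" by real_asymp
      show "filterlim (\<lambda>R. R - D) at_top at_top" by real_asymp
    qed
    then show ?thesis unfolding A_def by (intro tendsto_intros) simp
  qed
  have "((\<lambda>R. integral {0..R} F - r * A R) \<longlongrightarrow> 0) at_top"
    unfolding tendsto_iff
  proof (intro allI impI)
    fix e :: real assume e: "e > 0"
    then have e': "e / (8 * pi) > 0" by simp
    obtain R1 where R1: "R1 > 0" "\<And>R. R \<ge> R1 \<Longrightarrow> \<exists>I. ((\<lambda>t. q (of_real t)) has_integral I) {-R..R} \<and>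
        norm I \<le> 4 * (e / (8 * pi)) * pi"
      using I[OF e'] by blast
    show "eventually (\<lambda>R. dist (integral {0..R} F - r * A R) 0 < e) at_top"
      using eventually_ge_at_top[of R1]
    proof eventually_elim
      case (elim R)
      obtain I where "((\<lambda>t. q (of_real t)) has_integral I) {-R..R}" "norm I \<le> 4 * (e / (8 * pi)) * pi"
        using R1(2)[OF elim] by blast
      moreover have "R > 0" using R1(1) elim by simp
      ultimately obtain J where J: "(F has_integral (J + r * A R)) {0..R}" "\<bar>J\<bar> \<le> 4 * (e / (8 * pi)) * pi"
        using FI by blast
      have "4 * (e / (8 * pi)) * pi < e" using e by simp
      then show ?case using J by (simp add: integral_unique dist_norm)
    qed
  qed
  from tendsto_add[OF this Alim] have Flim: "((\<lambda>R. integral {0..R} F) \<longlongrightarrow> r * pi) at_top" by simp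
  have "((\<lambda>t. - F t) has_integral - (r * pi)) {0..}"
  proof (rule has_integral_to_inf)
    show "(\<lambda>t. - F t) integrable_on {0..y}" for y using Fint by (intro integrable_neg)
    show "((\<lambda>y. integral {0..y} (\<lambda>t. - F t)) \<longlongrightarrow> - (r * pi)) at_top"
      using tendsto_minus[OF Flim] by simp
    show "- F y \<ge> 0" if "y \<ge> 0" for y
      using pos[of y] D by (auto simp: F_def divide_nonpos_pos)
  qed
  from has_integral_neg[OF this] have "(F has_integral r * pi) {0..}" by simp
  then have "(F has_integral r * pi) {0<..}"
    by (subst has_integral_spike_set_eq[of _ "{0..}"]) (auto intro: negligible_subset[of "{0}"])
  then have "((\<lambda>t. Im (Q (of_real t)) / (t + D)) has_integral r * pi) {0<..}"
    by (rule has_integral_eq[rotated]) (simp add: F_def)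
  then show ?thesis by (simp add: r_def mult.commute)
qed

section \<open>The constants\<close>

text \<open>On the negative axis the map is real, and all three terms decrease in \<open>x = -z\<close>. Monotonicity of the transform
also gives the signs at the two end points for the intermediate value theorem.\<close>

lemma explicit_map_zero_unique:
  assumes k: "k > 1/2"
  shows "\<exists>!D. D > 0 \<and> explicit_map k (- of_real D) = 0"
proof -
  define S where "S x = Re (stieltjes_int k (- of_real x)) / pi" for x
  define m where "m x = - x - (k - 1/2) * ln x + ln (S x)" for x
  have hm: "explicit_map k (- of_real x) = of_real (m x)" if "x > 0" for x
    using explicit_map_neg[OF k that] by (simp add: m_def S_def)
  have Spos: "S x > 0" if "x > 0" for x using stieltjes_neg_axis(3)[of k x] k that by (simp add: S_def)
  have Smono: "S y \<le> S x" if "0 < x" "x \<le> y" for x y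
  proof -
    have "Re (stieltjes_int k (- of_real y)) \<le> Re (stieltjes_int k (- of_real x))"
    proof (rule has_integral_le)
      show "((\<lambda>t. gamma_weight k t / (t + y)) has_integral Re (stieltjes_int k (- of_real y))) {0<..}"
        using stieltjes_neg_axis(1)[of k y] k that by simp
      show "((\<lambda>t. gamma_weight k t / (t + x)) has_integral Re (stieltjes_int k (- of_real x))) {0<..}"
        using stieltjes_neg_axis(1)[of k x] k that by simp
      show "gamma_weight k t / (t + y) \<le> gamma_weight k t / (t + x)" if "t \<in> {0<..}" for t
        using that \<open>0 < x\<close> \<open>x \<le> y\<close> gamma_weight_nonneg[of k t] by (intro divide_left_mono) auto
    qed
    then show ?thesis by (simp add: S_def divide_right_mono)
  qed
  have mdec: "m y < m x" if "0 < x" "x < y" for x y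
  proof -
    have "ln (S y) \<le> ln (S x)" using Smono[of x y] Spos[of x] Spos[of y] that by simp
    moreover have "(k - 1/2) * ln x \<le> (k - 1/2) * ln y" using that k by (intro mult_left_mono) auto
    ultimately show ?thesis using that by (simp add: m_def)
  qed
  have mc: "continuous_on {0<..} m"
  proof -
    have "continuous_on {0<..} (\<lambda>x. Re (explicit_map k (- of_real x)))"
      by (intro continuous_on_Re continuous_on_compose2[OF explicit_map_continuous_on[OF k]]
          continuous_intros) auto
    then show ?thesis by (rule continuous_on_cong[THEN iffD1, rotated 2]) (auto simp: hm)
  qed
  define L where "L = ln (S 1)"
  \<comment> \<open>as \<open>S\<close> decreases, \<open>ln (S x)\<close> is at most \<open>L\<close> for \<open>x \<ge> 1\<close> and at least \<open>L\<close> for \<open>x \<le> 1\<close>\<close>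
  define x1 where "x1 = max 1 (L + 1)"
  have x1: "x1 \<ge> 1" "m x1 \<le> 0"
  proof -
    show g: "x1 \<ge> 1" by (simp add: x1_def)
    have "ln (S x1) \<le> L" using Smono[of 1 x1] Spos[of 1] Spos[of x1] g by (simp add: L_def)
    moreover have "(k - 1/2) * ln x1 \<ge> 0" using k g by (intro mult_nonneg_nonneg) auto
    ultimately show "m x1 \<le> 0" unfolding m_def by (simp add: x1_def)
  qed
  define x0 where "x0 = exp (- ((1 + \<bar>L\<bar>) / (k - 1/2)))"
  have x0: "0 < x0" "x0 \<le> 1" "m x0 \<ge> 0"
  proof -
    show "0 < x0" by (simp add: x0_def)
    show le: "x0 \<le> 1" using k by (simp add: x0_def)
    have "ln (S x0) \<ge> L" using Smono[of x0 1] Spos[of 1] Spos[of x0] le \<open>0 < x0\<close> by (simp add: L_def)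
    moreover have "(k - 1/2) * ln x0 = - (1 + \<bar>L\<bar>)" using k by (simp add: x0_def)
    ultimately show "m x0 \<ge> 0" unfolding m_def using le by linarith
  qed
  have "\<exists>D\<ge>x0. D \<le> x1 \<and> m D = 0"
  proof (rule IVT2')
    show "continuous_on {x0..x1} m" using x0 by (intro continuous_on_subset[OF mc]) auto
  qed (use x0 x1 in auto)
  then obtain D where "x0 \<le> D" "m D = 0" by blast
  then have D: "D > 0" "m D = 0" using x0(1) by auto
  show ?thesis
  proof (rule ex1I[of _ D])
    show "D > 0 \<and> explicit_map k (- of_real D) = 0" using D hm by simp
    fix E assume E: "E > 0 \<and> explicit_map k (- of_real E) = 0"
    then have "m E = 0" using hm[of E] by simp
    then show "E = D" using mdec[of D E] mdec[of E D] D E by (metis less_irrefl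
        linorder_neqE_linordered_idom)
  qed
qed

text \<open>At 0 the remainder has only a logarithmic singularity.\<close>

lemma log_remainder_near_zero:
  assumes k: "k > 1/2"
  obtains d where "d > 0" 
    "\<And>z. z \<in> closed_uhp0 \<Longrightarrow> norm z < d \<Longrightarrow> norm (log_remainder k z - of_real q) \<le> 1 * norm z powr (-1/2)"
proof -
  let ?L = "\<lambda>z. Ln (of_real (1 / pi) * stieltjes_int k z) - of_real q"
  have "((\<lambda>r::real. r powr (1/2) * (\<bar>ln r\<bar> + pi)) \<longlongrightarrow> 0) (at_right 0)" by real_asymp
  from filterlim_compose[OF this at_0_uhp_norm]
  have 1: "((\<lambda>z::complex. norm z powr (1/2) * (\<bar>ln (norm z)\<bar> + pi)) \<longlongrightarrow> 0) at_0_uhp" .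
  have "((\<lambda>r::real. r powr (1/2)) \<longlongrightarrow> 0) (at_right 0)" by real_asymp
  from filterlim_compose[OF this at_0_uhp_norm]
  have 2: "((\<lambda>z::complex. norm z powr (1/2)) \<longlongrightarrow> 0) at_0_uhp" .
  have "((\<lambda>z. norm z powr (1/2) * (\<bar>ln (norm z)\<bar> + pi) + norm z powr (1/2) * norm (?L z)) \<longlongrightarrow>
      0 + 0 * norm (of_real (ln (Gamma (k - 1/2) / pi)) - complex_of_real q)) at_0_uhp"
    by (intro tendsto_intros 1 2 Ln_stieltjes_zero[OF k])
  then have "eventually (\<lambda>z. norm z powr (1/2) * (\<bar>ln (norm z)\<bar> + pi) + norm z powr (1/2) * norm (?L
      z) < 1) at_0_uhp"
    by (rule order_tendstoD) simp
  with eventually_uhp_at_0 have "eventually (\<lambda>z. norm (log_remainder k z - of_real q) \<le> norm z powr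
      (-1/2)) at_0_uhp"
  proof eventually_elim
    case (elim z)
    have z0: "z \<noteq> 0" using elim by (auto simp: upper_half_plane_def)
    have "log_remainder k z - of_real q = (Ln_up z - \<i> * of_real pi) + ?L z"
      by (simp add: log_remainder_def explicit_map_uhp[OF k elim(1)] Ln_uminus_Ln_up[OF elim(1)]
          algebra_simps add_divide_distrib)
    then have "norm (log_remainder k z - of_real q) \<le> norm (Ln_up z - \<i> * of_real pi) + norm (?L z)"
        by (metis norm_triangle_ineq)
    also have "norm (Ln_up z - \<i> * of_real pi) \<le> \<bar>Re (Ln_up z - \<i> * of_real pi)\<bar> + \<bar>Im (Ln_up z - \<i>
        * of_real pi)\<bar>"
      by (rule cmod_le)
    also have "\<dots> \<le> \<bar>ln (norm z)\<bar> + pi" using Im_Ln_up_strict[OF elim(1)] by (simp add: Re_Ln_up[OF z0])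
    finally have "norm z powr (1/2) * norm (log_remainder k z - of_real q) \<le> norm z powr (1/2) *
        (\<bar>ln (norm z)\<bar> + pi + norm (?L z))"
      by (intro mult_left_mono) auto
    also have "\<dots> < 1" using elim(2) by (simp add: algebra_simps)
    finally have "norm z powr (1/2) * norm (log_remainder k z - of_real q) \<le> 1" by simp
    then have "norm z powr (-1/2) * (norm z powr (1/2) * norm (log_remainder k z - of_real q)) \<le>
        norm z powr (-1/2) * 1"
      by (intro mult_left_mono) auto
    moreover have "norm z powr (-1/2) * norm z powr (1/2) = 1" using z0 by (simp flip: powr_add)
    ultimately show ?case by (simp flip: mult.assoc)
  qed
  then obtain d where d: "d > 0" "\<And>z. z \<in> upper_half_plane \<Longrightarrow> norm z < d \<Longrightarrow> norm (log_remainder k z -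
      of_real q) \<le> norm z powr (-1/2)"
  proof -
    assume a: "eventually (\<lambda>z. norm (log_remainder k z - of_real q) \<le> norm z powr (-1/2)) at_0_uhp"
      and t: "\<And>d. d > 0 \<Longrightarrow> (\<And>z. z \<in> upper_half_plane \<Longrightarrow> norm z < d \<Longrightarrow> norm (log_remainder k z - of_real
          q) \<le> norm z powr (-1/2)) \<Longrightarrow> thesis"
    obtain d where "d > 0" "\<forall>z\<in>upper_half_plane. z \<noteq> 0 \<and> dist z 0 < d \<longrightarrow> norm (log_remainder k z -
        of_real q) \<le> norm z powr (-1/2)"
      using a unfolding eventually_at by blast
    then show ?thesis using t[of d] by (force simp: upper_half_plane_def)
  qed
  show ?thesis
  proof (rule that[OF d(1)])
    fix z assume z: "z \<in> closed_uhp0" "norm z < d"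
    have "norm (log_remainder k z - of_real q) \<le> norm z powr (-1/2)"
    proof (rule le_on_boundary[where f = "\<lambda>z. norm (log_remainder k z - of_real q)" and g = "\<lambda>z.
        norm z powr (-1/2)"])
      show "continuous_on closed_uhp0 (\<lambda>z. norm (log_remainder k z - of_real q))"
        unfolding log_remainder_def using uhp_subset(2)
        by (intro continuous_intros explicit_map_continuous_on[OF k]
            holomorphic_on_imp_continuous_on Ln_up_holomorphic') auto
      show "continuous_on closed_uhp0 (\<lambda>z. norm z powr (-1/2))" by (intro continuous_intros) auto
      have "eventually (\<lambda>w. w \<in> ball 0 d) (nhds z)"
        using z by (intro eventually_nhds_in_open) auto
      then show "eventually (\<lambda>z. norm (log_remainder k z - of_real q) \<le> norm z powr (-1/2)) (at z
          within upper_half_plane)"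
        unfolding eventually_at_filter by eventually_elim (use d(2) in auto)
    qed (rule z)
    then show "norm (log_remainder k z - of_real q) \<le> 1 * norm z powr (-1/2)" by simp
  qed
qed

lemma Y_const_eq:
  assumes k: "k > 1/2"
  shows "Y_const k = ln (Gamma (k + 1/2)) - ln pi"
proof -
  define D where "D = D_const k"
  have "D_const k = (THE D. D > 0 \<and> explicit_map k (- of_real D) = 0)"
    unfolding D_const_def by (rule arg_cong[of _ _ The]) (auto simp: fun_eq_iff H_map_eq_explicit_map[OF k])
  then have D: "D > 0" "explicit_map k (- of_real D) = 0"
    using theI'[OF explicit_map_zero_unique[OF k]] by (auto simp: D_def)
  define q where "q = ln (Gamma (k + 1/2) / pi)"
  define Q where "Q z = log_remainder k z - of_real q" for z
  obtain d where d: "d > 0" "\<And>z. z \<in> closed_uhp0 \<Longrightarrow> norm z < d \<Longrightarrow> norm (log_remainder k z - of_real q)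
      \<le> 1 * norm z powr (-1/2)"
    using log_remainder_near_zero[OF k] by blast
  have rho: "Im (Q (of_real t)) = pi * (rho k t - (k + 1/2))" if "t > 0" for t
    using that by (simp add: Q_def log_remainder_def Ln_up_pos rho_def H_map_eq_explicit_map[OF k]
        algebra_simps)
  have "((\<lambda>t. Im (Q (of_real t)) / (t + D)) has_integral pi * Re (Q (- of_real D))) {0<..}"
  proof (rule half_plane_schwarz_integral[OF open_ext_dom[OF k] closed_uhp0_ext_dom[OF k] _ _ d(1) _
      _ _ D(1)])
    show "Q holomorphic_on ext_dom k"
      unfolding Q_def log_remainder_def by (intro holomorphic_intros explicit_map_holomorphic_ext k)
          (auto simp: ext_dom_def)
    show "(Q \<longlongrightarrow> 0) at_inf_uhp"
      using log_remainder_limit_infinity[OF k] unfolding Q_def q_def by (simp add: LIM_zero)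
    show "norm (Q z) \<le> 1 * norm z powr (-1/2)" if "z \<in> closed_uhp0" "norm z < d" for z
      using d(2)[OF that] by (simp add: Q_def)
    show "Im (Q (of_real t)) = 0" if "t < 0" for t
      using explicit_map_neg[OF k, of "-t"] Ln_up_neg[of "-t"] that by (simp add: Q_def log_remainder_def)
    show "Im (Q (of_real t)) \<le> 0" if "t > 0" for t
      using explicit_map_pos(3)[OF k that] Ln_up_pos[OF that] by (simp add: Q_def log_remainder_def)
  qed
  moreover have "Re (Q (- of_real D)) = D + (k + 1/2) * ln D - q"
    using D Ln_up_neg[OF D(1)] by (simp add: Q_def log_remainder_def)
  ultimately have "((\<lambda>t. pi * ((rho k t - (k + 1/2)) / (t + D))) has_integral pi * (D + (k + 1/2) *
      ln D - q)) {0<..}"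
    by (auto elim!: has_integral_eq[rotated] simp: rho)
  from has_integral_mult_right[OF this, of "1 / pi"]
  have "((\<lambda>t. (rho k t - (k + 1/2)) / (t + D)) has_integral (D + (k + 1/2) * ln D - q)) {0<..}" by simp
  then have "Y_const k = q" unfolding Y_const_def D_def[symmetric] by (simp add: integral_unique)
  also have "q = ln (Gamma (k + 1/2)) - ln pi"
  proof -
    have "Gamma (k + 1/2) > 0" using k by (intro Gamma_real_pos) auto
    then show ?thesis by (simp add: q_def ln_div)
  qed
  finally show ?thesis .
qed

theorem theorem2p3:
  fixes k :: real
  assumes "k > 1/2"
  shows "(\<forall>\<zeta>. Im \<zeta> > 0 \<longrightarrow>
            H_map k \<zeta> = \<zeta> - complex_of_real (k - 1/2) * Ln (- \<zeta>)
              + Ln (complex_of_real (1 / pi) * stieltjes_int k \<zeta>))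
         \<and> Y_const k = ln (Gamma (k + 1/2)) - ln pi"
proof (intro conjI allI impI)
  fix \<zeta> :: complex assume "Im \<zeta> > 0"
  then have z: "\<zeta> \<in> upper_half_plane" by (simp add: upper_half_plane_def)
  then show "H_map k \<zeta> = \<zeta> - complex_of_real (k - 1/2) * Ln (- \<zeta>)
              + Ln (complex_of_real (1 / pi) * stieltjes_int k \<zeta>)"
    using H_map_eq_explicit_map[OF assms, of \<zeta>] explicit_map_uhp[OF assms z] uhp_subset(1) by auto
qed (rule Y_const_eq[OF assms])

end
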